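(* Let $G$ be a split graph. Then $G$ is semi-transitive if and only if $G$ contains none of the graphs in the family $\mathcal{G}_{\mathrm{split}}$ as an induced subgraph, where $\mathcal{G}_{\mathrm{split}}$ consists of the graphs $SG(M_I^*(k))$ for $k\ge3$, $SG(M_{II}(k))$ for $k\ge4$, $SG(M_{III}(k))$ for $k\ge3$, $SG(M_{IV})$, $SG(M_V)$, $SG(M_{VI})$, and $SG(0101\oplus M_I^*(4))$.
   Context: All graphs are finite, simple and undirected. A graph is a split graph if its vertex set can be partitioned into an independent set and a clique. A graph contains $H$ as an induced subgraph if $H$ is isomorphic to one of its induced subgraphs. Semi-transitivity. A semi-transitive orientation of a graph is an acyclic orientation such that for any directed path $v_0\to v_1\to\cdots\to v_m$ with $m\ge2$, either there is no arc between $v_0$ and $v_m$, or there is an arc from $v_i$ to $v_j$ for all $0\le i<j\le m$. A graph is semi-transitive if it admits a semi-transitive orientation. For a $(0,1)$-matrix $M$ of size $m\times n$, $SG(M)$ is the split graph with an independent set of $m$ vertices corresponding to the rows of $M$ and a clique of $n$ vertices corresponding to the columns of $M$, where the independent-set vertex $i$ is adjacent to the clique vertex $j$ if and only if $m_{ij}=1$. Notation. For a binary sequence $a=a_1\dots a_k$ and a matrix $M$ with $k$ rows, $a\oplus M$ is obtained from $M$ by complementing (interchanging $0$'s and $1$'s in) every row $i$ with $a_i=1$. $M^*$ is $M$ with an all-zero column appended; $M_I^*(k)$ means $(M_I(k))^*$. Matrices. - $M_I(k)$ ($k\ge3$), size $k\times k$: for $1\le i\le k-1$, row $i$ has $1$'s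 exactly in columns $i,i+1$; row $k$ has $1$'s exactly in columns $1,k$. - $M_{II}(k)$ ($k\ge4$), size $k\times k$: for $1\le i\le k-2$, row $i$ has $1$'s exactly in columns $i,i+1$; row $k-1$ has $1$'s exactly in columns $1,\dots,k-2$ and $k$; row $k$ has $1$'s exactly in columns $2,\dots,k$. - $M_{III}(k)$ ($k\ge3$), size $k\times(k+1)$: for $1\le i\le k-1$, row $i$ has $1$'s exactly in columns $i,i+1$; row $k$ has $1$'s exactly in columns $2,\dots,k-1$ and $k+1$. - $M_{IV}=\begin{pmatrix}1&1&0&0&0&0\\0&0&1&1&0&0\\0&0&0&0&1&1\\0&1&0&1&0&1\end{pmatrix}$, $M_V=\begin{pmatrix}1&1&0&0&0\\1&1&1&1&0\\0&0&1&1&0\\1&0&0&1&1\end{pmatrix}$, $M_{VI}=\begin{pmatrix}1&1&0&1\\0&1&1&1\\1&0&1&1\end{pmatrix}$. - Explicitly, $SG(0101\oplus M_I^*(4))$ has clique $\{1,2,3,4,5\}$ and four independent vertices with neighborhoods $\{1,2\},\{1,4,5\},\{3,4\},\{2,3,5\}$. *)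

theory Defs
  imports "Graph_Theory.Graph_Theory" "Jordan_Normal_Form.Matrix"
begin

text \<open>
  A finite simple undirected graph is a \<^locale>\<open>pair_graph\<close>: a finite, loop-free, symmetric set
  of arcs, in which an edge is a pair of opposite arcs.
\<close>

definition split_graph :: "'a pair_pre_digraph \<Rightarrow> bool" where
  "split_graph G \<longleftrightarrow> (\<exists>I K. I \<union> K = pverts G \<and> I \<inter> K = {} \<and>
     (\<forall>u\<in>I. \<forall>v\<in>I. (u, v) \<notin> parcs G) \<and>
     (\<forall>u\<in>K. \<forall>v\<in>K. u \<noteq> v \<longrightarrow> (u, v) \<in> parcs G))"

definition contains_induced :: "'a pair_pre_digraph \<Rightarrow> 'b pair_pre_digraph \<Rightarrow> bool" where
  "contains_induced G H \<longleftrightarrow>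
     (\<exists>S \<subseteq> pverts G. digraph_iso (with_proj H) (with_proj G \<restriction> S))"

definition orientation :: "'a pair_pre_digraph \<Rightarrow> 'a pair_pre_digraph \<Rightarrow> bool" where
  "orientation G D \<longleftrightarrow> pverts D = pverts G \<and> parcs D \<subseteq> parcs G \<and>
     (\<forall>(u, v) \<in> parcs G. (u, v) \<in> parcs D \<longleftrightarrow> (v, u) \<notin> parcs D)"

text \<open>
  A directed path $v_0 \to \dots \to v_m$ with $m \ge 2$ is a \<^const>\<open>vpath\<close> with at least three
  vertices, and $v_i$ is \<open>p ! i\<close>.
\<close>

definition semi_transitive_orientation ::
    "'a pair_pre_digraph \<Rightarrow> 'a pair_pre_digraph \<Rightarrow> bool" where
  "semi_transitive_orientation G D \<longleftrightarrow> orientation G D \<and> acyclic (parcs D) \<and>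
     (\<forall>p. vpath p (with_proj D) \<and> length p \<ge> 3 \<longrightarrow>
        ((hd p, last p) \<notin> parcs D \<and> (last p, hd p) \<notin> parcs D) \<or>
        (\<forall>i j. i < j \<and> j < length p \<longrightarrow> (p ! i, p ! j) \<in> parcs D))"

definition semi_transitive :: "'a pair_pre_digraph \<Rightarrow> bool" where
  "semi_transitive G \<longleftrightarrow> (\<exists>D. semi_transitive_orientation G D)"

text \<open>
  \<open>Inl i\<close> is the independent vertex of row \<open>i\<close> and \<open>Inr j\<close> the clique vertex of column \<open>j\<close>;
  library matrices are indexed from 0.
\<close>

definition SG :: "nat mat \<Rightarrow> (nat + nat) pair_pre_digraph" where
  "SG M = \<lparr> pverts = Inl ` {0..<dim_row M} \<union> Inr ` {0..<dim_col M},
     parcs = {(Inr j, Inr j') | j j'. j < dim_col M \<and> j' < dim_col M \<and> j \<noteq> j'} \<union>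
       {(Inl i, Inr j) | i j. i < dim_row M \<and> j < dim_col M \<and> M $$ (i, j) = 1} \<union>
       {(Inr j, Inl i) | i j. i < dim_row M \<and> j < dim_col M \<and> M $$ (i, j) = 1} \<rparr>"

text \<open>\<open>a \<oplus> M\<close>, for a 0-1 matrix \<open>M\<close> and a binary sequence \<open>a\<close> with one entry for each row of \<open>M\<close>:\<close>

definition complement_rows :: "nat list \<Rightarrow> nat mat \<Rightarrow> nat mat" where
  "complement_rows a M = mat (dim_row M) (dim_col M)
     (\<lambda>(i, j). if a ! i = 1 then 1 - M $$ (i, j) else M $$ (i, j))"

text \<open>\<open>M\<^sup>*\<close>:\<close>

definition append_zero_col :: "nat mat \<Rightarrow> nat mat" where
  "append_zero_col M = mat (dim_row M) (dim_col M + 1)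
     (\<lambda>(i, j). if j < dim_col M then M $$ (i, j) else 0)"

text \<open>
  The \<open>m \<times> n\<close> 0-1 matrix whose row \<open>i\<close> has its ones exactly in the columns \<open>R i\<close>, where rows and
  columns are numbered from 1.
\<close>

definition mat_of_row_supports :: "nat \<Rightarrow> nat \<Rightarrow> (nat \<Rightarrow> nat set) \<Rightarrow> nat mat" where
  "mat_of_row_supports m n R = mat m n (\<lambda>(i, j). if Suc j \<in> R (Suc i) then 1 else 0)"

definition M_I :: "nat \<Rightarrow> nat mat" where
  "M_I k = mat_of_row_supports k k (\<lambda>i. if i \<le> k - 1 then {i, i + 1} else {1, k})"

definition M_II :: "nat \<Rightarrow> nat mat" where
  "M_II k = mat_of_row_supports k k (\<lambda>i.
     if i \<le> k - 2 then {i, i + 1}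
     else if i = k - 1 then {1..k - 2} \<union> {k}
     else {2..k})"

definition M_III :: "nat \<Rightarrow> nat mat" where
  "M_III k = mat_of_row_supports k (k + 1) (\<lambda>i.
     if i \<le> k - 1 then {i, i + 1} else {2..k - 1} \<union> {k + 1})"

definition M_IV :: "nat mat" where
  "M_IV = mat_of_rows_list 6
    [[1, 1, 0, 0, 0, 0],
     [0, 0, 1, 1, 0, 0],
     [0, 0, 0, 0, 1, 1],
     [0, 1, 0, 1, 0, 1]]"

definition M_V :: "nat mat" where
  "M_V = mat_of_rows_list 5
    [[1, 1, 0, 0, 0],
     [1, 1, 1, 1, 0],
     [0, 0, 1, 1, 0],
     [1, 0, 0, 1, 1]]"

definition M_VI :: "nat mat" where
  "M_VI = mat_of_rows_list 4
    [[1, 1, 0, 1],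
     [0, 1, 1, 1],
     [1, 0, 1, 1]]"

definition G_split :: "(nat + nat) pair_pre_digraph set" where
  "G_split =
     {SG (append_zero_col (M_I k)) | k. k \<ge> 3} \<union>
     {SG (M_II k) | k. k \<ge> 4} \<union>
     {SG (M_III k) | k. k \<ge> 3} \<union>
     {SG M_IV, SG M_V, SG M_VI,
      SG (complement_rows [0, 1, 0, 1] (append_zero_col (M_I 4)))}"

end

theory Submission
  imports Defs
begin

text \<open>
  After moving an independent vertex adjacent to the whole clique \<open>K\<close> into the clique, the
  neighbourhoods \<open>N x\<close> of the independent vertices are proper subsets of \<open>K\<close>. A semi-transitive
  orientation orders \<open>K\<close> linearly, and closing this order up to a circle turns every \<open>N x \<inter> N y\<close> into
  an arc; conversely, every such circular order gives a semi-transitive orientation. It remains to see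
  which families \<open>F\<close> of proper subsets of \<open>K\<close> have a circular order in which all \<open>r \<inter> s\<close> with
  \<open>r, s \<in> F\<close> are arcs.

  Such an order is found by induction on the number of sets. If the overlap graph of \<open>F\<close> is
  disconnected, circular orders of smaller families are substituted into one another. If it is
  connected, two sets \<open>S\<close>, \<open>T\<close> can be removed such that the rest \<open>F0\<close> stays connected, and the circular
  order \<open>h\<close> of the classes of elements not separated by \<open>F0\<close> is unique up to reversal. Each of \<open>S\<close> and
  \<open>T\<close> splits classes into two sides \<open>sS\<close> and \<open>sT\<close>, and \<open>3 * h + sS + sT\<close> is the required order
  unless \<open>S\<close> and \<open>T\<close> disagree inside a class or \<open>S \<inter> T\<close> is not an arc. A shortest
  walk through sets of \<open>F0\<close> then exhibits one of the forbidden matrices; in the first case it is found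
  after cutting the circle open at that class.
\<close>

section \<open>Arcs of a circular order\<close>

text \<open>The arc conditions involve at most two sets at a time. Hence every condition except the
  one for \<open>S \<inter> T\<close> already appears in the orders that induction supplies for
  \<open>F\<close> without \<open>T\<close> and for \<open>F\<close> without \<open>S\<close>; the
  obstacle is to merge these two orders. Uniqueness over \<open>F0\<close> makes this possible: up
  to reflection both refine the same \<open>h\<close>, so they differ only inside its classes, where
  each contributes one cut. The factor 3 leaves room for the values 0, 1, 2 of
  \<open>sS + sT\<close>. Uniqueness needs at least two sets in \<open>F0\<close>, so families of at
  most three sets are ordered explicitly. Circles arise from semi-transitivity: if
  \<open>a -> x -> c\<close> for clique vertices \<open>a\<close>, \<open>c\<close>, then
  \<open>x\<close> is adjacent to every clique vertex before \<open>a\<close> and after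
  \<open>c\<close>, so its neighbourhood wraps around the ends of the line. The set \<open>K\<close>
  itself is excluded because it adds no arc condition, although its vertex can act as the zero
  column of M_I*(k) when the rest has a circular order.\<close>

definition cyc :: "('v \<Rightarrow> int) \<Rightarrow> 'v \<Rightarrow> 'v \<Rightarrow> 'v \<Rightarrow> bool" where
  "cyc f a b c \<longleftrightarrow> f a < f b \<and> f b < f c \<or> f b < f c \<and> f c < f a \<or> f c < f a \<and> f a < f b"

text \<open>Arcs are defined by the absence of alternation, without naming endpoints. The condition
  is invariant under rotation and reflection and makes sense for non-injective \<open>f\<close>,
  where tied elements form one position.\<close>

definition is_arc :: "'v set \<Rightarrow> ('v \<Rightarrow> int) \<Rightarrow> 'v set \<Rightarrow> bool" where
  "is_arc K f A \<longleftrightarrow> (\<forall>a\<in>K. \<forall>b\<in>K. \<forall>c\<in>K. \<forall>d\<in>K.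
     cyc f a b c \<and> cyc f a c d \<and> a \<in> A \<and> c \<in> A \<longrightarrow> b \<in> A \<or> d \<in> A)"

definition twins :: "'v set set \<Rightarrow> 'v \<Rightarrow> 'v \<Rightarrow> bool" where
  "twins F u v \<longleftrightarrow> (\<forall>r\<in>F. u \<in> r \<longleftrightarrow> v \<in> r)"

text \<open>Ties are restricted to twins because \<open>cyc\<close> is strict and
  \<open>is_arc\<close> cannot see a set that splits a tied class. The case \<open>r = s\<close>
  makes the sets themselves arcs.\<close>

definition circ_good :: "'v set \<Rightarrow> 'v set set \<Rightarrow> ('v \<Rightarrow> int) \<Rightarrow> bool" where
  "circ_good K F f \<longleftrightarrow> (\<forall>u\<in>K. \<forall>v\<in>K. f u = f v \<longrightarrow> twins F u v) \<and>
     (\<forall>r\<in>F. \<forall>s\<in>F. is_arc K f (r \<inter> s))"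

lemma is_arcD:
  "is_arc K f A \<Longrightarrow> cyc f a b c \<Longrightarrow> cyc f a c d \<Longrightarrow> a \<in> A \<Longrightarrow> c \<in> A \<Longrightarrow> b \<notin> A \<Longrightarrow> d \<notin> A \<Longrightarrow>
   a \<in> K \<Longrightarrow> b \<in> K \<Longrightarrow> c \<in> K \<Longrightarrow> d \<in> K \<Longrightarrow> False"
  unfolding is_arc_def by blast

lemma cyc_rotate: "cyc f a b c \<longleftrightarrow> cyc f b c a"
  unfolding cyc_def by auto

lemma cyc4_rotate: "cyc f a b c \<Longrightarrow> cyc f a c d \<Longrightarrow> cyc f b c d \<and> cyc f b d a"
  unfolding cyc_def by auto

lemma cyc_total: "f a \<noteq> f b \<Longrightarrow> f b \<noteq> f c \<Longrightarrow> f a \<noteq> f c \<Longrightarrow> cyc f a b c \<or> cyc f c b a"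
  unfolding cyc_def by auto

lemma cyc_neq: "cyc f a b c \<Longrightarrow> f a \<noteq> f b \<and> f b \<noteq> f c \<and> f a \<noteq> f c"
  unfolding cyc_def by auto

lemma cyc_uminus: "cyc (\<lambda>v. - f v) a b c \<longleftrightarrow> cyc f c b a"
  unfolding cyc_def by auto

lemma is_arc_uminus: "is_arc K (\<lambda>v. - f v) A \<longleftrightarrow> is_arc K f A"
proof -
  have "is_arc K g A \<Longrightarrow> is_arc K (\<lambda>v. - g v) A" for g
    unfolding is_arc_def cyc_uminus by (meson cyc_rotate cyc4_rotate)
  from this[of f] this[of "\<lambda>v. - f v"] show ?thesis by auto
qed

lemma circ_good_uminus: "circ_good K F (\<lambda>v. - f v) \<longleftrightarrow> circ_good K F f"
  unfolding circ_good_def is_arc_uminus by auto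

text \<open>The complement of an arc is an arc: rotating the four points by one exchanges inside and
  outside.\<close>

lemma is_arc_outD:
  assumes "is_arc K f A" "cyc f a b c" "cyc f a c d" "a \<notin> A" "c \<notin> A" "b \<in> A" "d \<in> A"
    "a \<in> K" "b \<in> K" "c \<in> K" "d \<in> K"
  shows False
  using is_arcD[OF assms(1), of b c d a] cyc4_rotate[OF assms(2,3)] assms by (auto simp: cyc_rotate)

lemma is_arc_interval:
  assumes "\<And>v. v \<in> K \<Longrightarrow> v \<in> A \<longleftrightarrow> lo \<le> f v \<and> f v \<le> hi"
  shows "is_arc K f A"
  unfolding is_arc_def cyc_def using assms by fastforce

lemma is_arc_cointerval:
  assumes "\<And>v. v \<in> K \<Longrightarrow> v \<in> A \<longleftrightarrow> \<not> (lo \<le> f v \<and> f v \<le> hi)"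
  shows "is_arc K f A"
  unfolding is_arc_def cyc_def using assms by fastforce

text \<open>An alternation of \<open>A\<close> in \<open>j\<close> survives in \<open>g\<close>
  after \<open>p\<close>: neighbouring points differ in membership, so \<open>sep\<close> excludes a
  tie between them and \<open>mono\<close> keeps their order. Later \<open>p\<close> is the identity
  or collapses a module to one element.\<close>

lemma is_arc_coarsen:
  assumes arc: "is_arc K g A'"
    and p: "\<And>v. v \<in> K \<Longrightarrow> p v \<in> K" "\<And>v. v \<in> K \<Longrightarrow> v \<in> A \<longleftrightarrow> p v \<in> A'"
    and mono: "\<And>u v. u \<in> K \<Longrightarrow> v \<in> K \<Longrightarrow> j u < j v \<Longrightarrow> g (p u) \<le> g (p v)"
    and sep: "\<And>u v. u \<in> K \<Longrightarrow> v \<in> K \<Longrightarrow> g (p u) = g (p v) \<Longrightarrow> p u \<in> A' \<longleftrightarrow> p v \<in> A'"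
  shows "is_arc K j A"
  unfolding is_arc_def
proof (intro ballI impI, rule ccontr)
  fix a b c d
  assume K: "a \<in> K" "b \<in> K" "c \<in> K" "d \<in> K"
    and *: "cyc j a b c \<and> cyc j a c d \<and> a \<in> A \<and> c \<in> A" and n: "\<not> (b \<in> A \<or> d \<in> A)"
  have lt: "g (p u) < g (p v)" if "u \<in> K" "v \<in> K" "j u < j v" "(u \<in> A) \<noteq> (v \<in> A)" for u v
    using that mono[of u v] sep[of u v] p(2) by (metis order_le_less)
  have "cyc g (p a) (p b) (p c) \<and> cyc g (p a) (p c) (p d)"
    using * n K lt[of a b] lt[of b a] lt[of b c] lt[of c b] lt[of c d] lt[of d c] lt[of d a] lt[of a d]
    unfolding cyc_def by (smt (verit))
  with is_arcD[OF arc, of "p a" "p b" "p c" "p d"] * n K p show False by auto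
qed

section \<open>Connectivity of the overlap graph\<close>

definition overlap :: "'v set \<Rightarrow> 'v set \<Rightarrow> bool" where
  "overlap r s \<longleftrightarrow> r \<inter> s \<noteq> {} \<and> \<not> r \<subseteq> s \<and> \<not> s \<subseteq> r"

lemma overlap_sym: "overlap r s \<longleftrightarrow> overlap s r"
  unfolding overlap_def by auto

text \<open>Connectivity is phrased by cuts instead of paths, which suits arguments that grow a
  subfamily one set at a time.\<close>

definition ov_conn :: "'v set set \<Rightarrow> bool" where
  "ov_conn F \<longleftrightarrow> F \<noteq> {} \<and> (\<forall>A. A \<noteq> {} \<and> A \<subset> F \<longrightarrow> (\<exists>a\<in>A. \<exists>b\<in>F - A. overlap a b))"

lemma ov_connD: "ov_conn F \<Longrightarrow> A \<noteq> {} \<Longrightarrow> A \<subseteq> F \<Longrightarrow> A \<noteq> F \<Longrightarrow> \<exists>a\<in>A. \<exists>b\<in>F - A. overlap a b"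
  unfolding ov_conn_def by blast

lemma ov_conn_singleton: "ov_conn {r}"
  unfolding ov_conn_def by blast

lemma ov_conn_insert:
  assumes "ov_conn C" "c \<in> C" "overlap c b"
  shows "ov_conn (insert b C)"
  unfolding ov_conn_def
proof (intro conjI allI impI)
  fix A assume A: "A \<noteq> {} \<and> A \<subset> insert b C"
  show "\<exists>a\<in>A. \<exists>d\<in>insert b C - A. overlap a d"
  proof (cases "A \<inter> C = {} \<or> A \<inter> C = C")
    case True
    then consider "A = {b}" "b \<notin> C" | "C \<subseteq> A" "b \<notin> A" using A by auto
    then show ?thesis
      by cases (use assms overlap_sym in blast)+
  next
    case False
    then show ?thesis using ov_connD[OF assms(1), of "A \<inter> C"] by auto
  qed
qed auto

lemma ov_conn_overlap_exists:
  assumes "ov_conn F" "card F \<ge> 2" "r \<in> F"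
  shows "\<exists>s\<in>F. overlap r s"
proof -
  have "F \<noteq> {r}" using assms(2) by auto
  from ov_connD[OF assms(1), of "{r}"] this assms(3) show ?thesis by auto
qed

text \<open>A largest connected proper subfamily containing \<open>u\<close> lacks exactly one set,
  since a set overlapping it across the cut can always be added. The missing set is a non-cut vertex
  of the overlap graph.\<close>

lemma ov_conn_remove:
  assumes F: "ov_conn F" "finite F" "card F \<ge> 2" "u \<in> F"
  obtains b where "b \<in> F" "b \<noteq> u" "ov_conn (F - {b})"
proof -
  let ?P = "\<lambda>C. ov_conn C \<and> u \<in> C \<and> C \<subset> F"
  have "F \<noteq> {u}" using F(3) by auto
  then have "?P {u}" using ov_conn_singleton F(4) by auto
  moreover have "\<forall>C. ?P C \<longrightarrow> card C < card F" using F(2) by (simp add: psubset_card_mono)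
  ultimately obtain C where C: "?P C" and max: "\<And>D. ?P D \<Longrightarrow> card D \<le> card C"
    using ex_has_greatest_nat[of ?P "{u}" card "card F"] by (metis order_less_imp_le)
  from C ov_connD[OF F(1), of C] obtain a b where ab: "a \<in> C" "b \<in> F - C" "overlap a b" by blast
  have "ov_conn (insert b C)" using ov_conn_insert C ab by blast
  have "\<not> card (insert b C) \<le> card C"
    using ab C F(2) by (metis Diff_iff card_insert_disjoint finite_subset not_less_eq_eq order_refl psubset_imp_subset)
  with max[of "insert b C"] \<open>ov_conn (insert b C)\<close> C ab have "insert b C = F" by blast
  then have "F - {b} = C" using ab by auto
  with that[of b] C ab show thesis by auto
qed

text \<open>\<open>T\<close> is chosen different from a neighbour \<open>u\<close> of
  \<open>S\<close>; thus \<open>S\<close> still overlaps a remaining set after both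
  removals.\<close>

lemma ov_conn_two_removable:
  assumes F: "ov_conn F" "finite F" "card F \<ge> 3"
  obtains S T a b where "S \<in> F" "T \<in> F" "S \<noteq> T" "ov_conn (F - {S, T})"
    "a \<in> F - {S, T}" "overlap a S" "b \<in> F - {S, T}" "overlap b T"
proof -
  from F(1) obtain u0 where "u0 \<in> F" by (auto simp: ov_conn_def)
  with ov_conn_remove[of F u0] F obtain S where S: "S \<in> F" "ov_conn (F - {S})" by auto
  have "card F \<ge> 2" using F by auto
  from ov_conn_overlap_exists[OF F(1) this S(1)] obtain u where u: "u \<in> F" "overlap S u" by auto
  then have u': "u \<in> F - {S}" by (auto simp: overlap_def)
  have c: "card (F - {S}) \<ge> 2" using F S by (simp add: card_Diff_singleton)
  from ov_conn_remove[OF S(2) _ c u'] F(2) obtain T where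
    T: "T \<in> F - {S}" "T \<noteq> u" "ov_conn (F - {S} - {T})" by blast
  from ov_conn_overlap_exists[OF S(2) c T(1)] obtain b where "b \<in> F - {S}" "overlap T b" by auto
  moreover have "F - {S} - {T} = F - {S, T}" by auto
  ultimately show thesis using that[of S T u b] S T u by (auto simp: overlap_sym overlap_def)
qed

lemma circ_goodI:
  assumes "\<And>u v. u \<in> K \<Longrightarrow> v \<in> K \<Longrightarrow> f u = f v \<Longrightarrow> twins F u v"
    and "\<And>r s. r \<in> F \<Longrightarrow> s \<in> F \<Longrightarrow> is_arc K f (r \<inter> s)"
  shows "circ_good K F f"
  using assms unfolding circ_good_def by blast

lemma circ_good_subset: "circ_good K F f \<Longrightarrow> G \<subseteq> F \<Longrightarrow> circ_good K G f"
  unfolding circ_good_def twins_def by (meson subsetD)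

lemma circ_good_arc: "circ_good K F f \<Longrightarrow> r \<in> F \<Longrightarrow> s \<in> F \<Longrightarrow> is_arc K f (r \<inter> s)"
  unfolding circ_good_def by blast

lemma circ_good_arc1: "circ_good K F f \<Longrightarrow> r \<in> F \<Longrightarrow> is_arc K f r"
  using circ_good_arc[of K F f r r] by simp

lemma circ_good_twins: "circ_good K F f \<Longrightarrow> u \<in> K \<Longrightarrow> v \<in> K \<Longrightarrow> f u = f v \<Longrightarrow> twins F u v"
  unfolding circ_good_def by blast

section \<open>Circular orders of overlap-connected families\<close>

definition exact :: "'v set \<Rightarrow> 'v set set \<Rightarrow> ('v \<Rightarrow> int) \<Rightarrow> bool" where
  "exact K F h \<longleftrightarrow> (\<forall>u\<in>K. \<forall>v\<in>K. h u = h v \<longleftrightarrow> twins F u v)"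

text \<open>Only triples from three different classes of \<open>h\<close> are compared, so
  \<open>g\<close> may order the elements inside a class freely.\<close>

definition refines :: "'v set \<Rightarrow> ('v \<Rightarrow> int) \<Rightarrow> ('v \<Rightarrow> int) \<Rightarrow> bool" where
  "refines K h g \<longleftrightarrow> (\<forall>a\<in>K. \<forall>b\<in>K. \<forall>c\<in>K. cyc h a b c \<longrightarrow> cyc g a b c)"

definition rigid :: "'v set \<Rightarrow> 'v set set \<Rightarrow> ('v \<Rightarrow> int) \<Rightarrow> bool" where
  "rigid K F h \<longleftrightarrow> exact K F h \<and> circ_good K F h \<and>
     (\<forall>g. circ_good K F g \<longrightarrow> refines K h g \<or> refines K h (\<lambda>v. - g v))"

lemma exactD: "exact K F h \<Longrightarrow> u \<in> K \<Longrightarrow> v \<in> K \<Longrightarrow> h u = h v \<longleftrightarrow> twins F u v"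
  unfolding exact_def by blast

lemma refinesD: "refines K h g \<Longrightarrow> cyc h a b c \<Longrightarrow> a \<in> K \<Longrightarrow> b \<in> K \<Longrightarrow> c \<in> K \<Longrightarrow> cyc g a b c"
  unfolding refines_def by blast

text \<open>On a circle, precedence inside a class makes sense only relative to a cutting point; an
  element \<open>w\<close> outside the class provides it. By \<open>class_cyc\<close> the choice of
  \<open>w\<close> does not matter when \<open>g\<close> respects \<open>h\<close>.\<close>

definition before :: "'v set \<Rightarrow> ('v \<Rightarrow> int) \<Rightarrow> ('v \<Rightarrow> int) \<Rightarrow> 'v \<Rightarrow> 'v \<Rightarrow> bool" where
  "before K h g u v \<longleftrightarrow> (\<exists>w\<in>K. h w \<noteq> h u \<and> cyc g u v w)"

text \<open>One extension step of the uniqueness proof: \<open>S\<close> is added to a connected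
  family \<open>F\<close> whose twin classes are the ties of \<open>h\<close>.\<close>

locale rigid_ext =
  fixes K :: "'v set" and F S h
  assumes F: "ov_conn F" "card F \<ge> 2" and sub: "\<And>r. r \<in> F \<Longrightarrow> r \<subseteq> K \<and> r \<noteq> K"
    and S: "S \<subseteq> K" and ex: "exact K F h" and ov: "\<exists>r\<in>F. overlap r S"
begin

lemma three: obtains a b c where "a \<in> K" "b \<in> K" "c \<in> K" "h a \<noteq> h b" "h b \<noteq> h c" "h a \<noteq> h c"
proof -
  from F(1) obtain r where r: "r \<in> F" by (auto simp: ov_conn_def)
  with ov_conn_overlap_exists[OF F r] obtain s where s: "s \<in> F" "overlap r s" by auto
  then obtain a b c where "a \<in> r - s" "b \<in> r \<inter> s" "c \<in> s - r" by (auto simp: overlap_def)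
  moreover from this have "\<not> twins F a b" "\<not> twins F b c" "\<not> twins F a c"
    using r s by (auto simp: twins_def)
  ultimately show thesis using that[of a b c] exactD[OF ex] sub[OF r] sub[OF s(1)] by blast
qed

lemma good_neq:
  assumes "circ_good K F g" "u \<in> K" "v \<in> K" "h u \<noteq> h v" shows "g u \<noteq> g v"
  using circ_good_twins[OF assms(1,2,3)] exactD[OF ex assms(2,3)] assms(4) by metis

text \<open>For \<open>x\<close>, \<open>y\<close> in two other classes, the triples
  \<open>u, x, y\<close> and \<open>v, x, y\<close> have the same orientation in \<open>h\<close>,
  hence in \<open>g\<close>; so \<open>x\<close> and \<open>y\<close> lie on the same side of the
  pair \<open>u\<close>, \<open>v\<close>. If \<open>w\<close> and \<open>w'\<close> share a class,
  an element of a third class mediates.\<close>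

lemma class_cyc:
  assumes g: "refines K h g" and K: "u \<in> K" "v \<in> K" "w \<in> K" "w' \<in> K"
    and e: "h u = h v" "h w \<noteq> h u" "h w' \<noteq> h u" and c: "cyc g u v w"
  shows "cyc g u v w'"
proof -
  have step: "cyc g u v y" if "x \<in> K" "y \<in> K" "h x \<noteq> h u" "h y \<noteq> h u" "h x \<noteq> h y" "cyc g u v x" for x y
  proof -
    have hv: "cyc h u x y = cyc h v x y" "cyc h u y x = cyc h v y x" using e(1) by (simp_all add: cyc_def)
    have "cyc h u x y \<or> cyc h y x u" using cyc_total[of h u x y] that by metis
    then consider "cyc h u x y" | "cyc h u y x" by (metis cyc_rotate)
    then have "cyc g u x y \<and> cyc g v x y \<or> cyc g u y x \<and> cyc g v y x"
      by cases (use refinesD[OF g] K that hv in metis)+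
    with that(6) show ?thesis unfolding cyc_def by (smt (verit))
  qed
  obtain a b d where abd: "a \<in> K" "b \<in> K" "d \<in> K" "h a \<noteq> h b" "h b \<noteq> h d" "h a \<noteq> h d" by (rule three)
  show ?thesis
  proof (cases "h w = h w'")
    case True
    obtain z where "z \<in> K" "h z \<noteq> h u" "h z \<noteq> h w" using abd by metis
    with step[of w z] step[of z w'] True e c K show ?thesis by metis
  qed (use step c K e in blast)
qed

text \<open>Suppose a common arc \<open>A\<close> splits the class as \<open>S\<close> does, and
  other classes contain \<open>p\<close> in \<open>A\<close> and \<open>q\<close> outside
  \<open>A\<close>, in different classes. According to the position of \<open>x, p, q\<close> in
  \<open>h\<close>, either \<open>x, y, p, q\<close> alternate in \<open>g1\<close> or
  \<open>y', x', q, p\<close> alternate in \<open>g2\<close>. \<open>A = S\<close> works unless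
  \<open>S\<close> covers all other classes; then \<open>A = r \<inter> S\<close> works for a set
  \<open>r\<close> overlapping \<open>S\<close>. For \<open>g1 = g2\<close> the lemma says that
  \<open>S\<close> cuts a class only once.\<close>

lemma type_unique:
  assumes g1: "refines K h g1" "circ_good K (insert S F) g1"
    and g2: "refines K h g2" "circ_good K (insert S F) g2"
    and K: "x \<in> K" "y \<in> K" "x' \<in> K" "y' \<in> K" and e: "h y = h x" "h x' = h x" "h y' = h x"
    and m: "x \<in> S" "x' \<in> S" "y \<notin> S" "y' \<notin> S"
    and b: "before K h g1 x y" "before K h g2 y' x'"
  shows False
proof -
  have c1: "cyc g1 x y w" and c2: "cyc g2 y' x' w" if "w \<in> K" "h w \<noteq> h x" for w
    using b class_cyc[OF g1(1), of x y _ w] class_cyc[OF g2(1), of y' x' _ w] that K e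
    unfolding before_def by metis+
  have key: False if A: "is_arc K g1 A" "is_arc K g2 A" "x \<in> A" "x' \<in> A" "y \<notin> A" "y' \<notin> A"
    and w: "p \<in> K" "q \<in> K" "h p \<noteq> h x" "h q \<noteq> h x" "h p \<noteq> h q" "p \<in> A" "q \<notin> A" for A p q
  proof (cases "cyc h x p q")
    case True
    then have "cyc g1 x p q" using refinesD[OF g1(1)] K w by blast
    with is_arcD[OF A(1) c1[of p], of q] A w K show False by auto
  next
    case False
    then have "cyc h y' q p" using w e unfolding cyc_def by auto
    then have "cyc g2 y' q p" using refinesD[OF g2(1)] K w by blast
    with is_arc_outD[OF A(2) c2[of q], of p] A w K show False by auto
  qed
  from ov obtain r where r: "r \<in> F" "overlap r S" by blast
  have arcS: "is_arc K g1 S" "is_arc K g2 S"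
    using circ_good_arc1[OF g1(2)] circ_good_arc1[OF g2(2)] by auto
  have arcrS: "is_arc K g1 (r \<inter> S)" "is_arc K g2 (r \<inter> S)"
    using circ_good_arc[OF g1(2), of r S] circ_good_arc[OF g2(2), of r S] r by auto
  have hr: "h u = h v \<Longrightarrow> u \<in> K \<Longrightarrow> v \<in> K \<Longrightarrow> u \<in> s \<longleftrightarrow> v \<in> s" if "s \<in> F" for u v s
    using exactD[OF ex] that by (simp add: twins_def)
  from r obtain p1 p2 where p12: "p1 \<in> S" "p2 \<in> S" "p1 \<in> r" "p2 \<notin> r" "p1 \<in> K" "p2 \<in> K"
    using S by (auto simp: overlap_def)
  then have "h p1 \<noteq> h p2" using hr[OF r(1)] by blast
  then obtain p where p: "p \<in> S" "p \<in> K" "h p \<noteq> h x" using p12 by metis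
  show False
  proof (cases "\<exists>q\<in>K. q \<notin> S \<and> h q \<noteq> h x")
    case True
    then obtain q where q: "q \<in> K" "q \<notin> S" "h q \<noteq> h x" by blast
    obtain a b d where abd: "a \<in> K" "b \<in> K" "d \<in> K" "h a \<noteq> h b" "h b \<noteq> h d" "h a \<noteq> h d" by (rule three)
    \<comment> \<open>Away from the class of \<open>x\<close>, every element of \<open>S\<close>
      would share its class with every element outside \<open>S\<close>. A further class, which
      exists by \<open>three\<close>, then fits neither side of \<open>S\<close>.\<close>
    have k: "h p' = h q'" if "p' \<in> S" "p' \<in> K" "h p' \<noteq> h x" "q' \<in> K" "q' \<notin> S" "h q' \<noteq> h x" for p' q'
      using key[OF arcS m(1,2,3,4), of p' q'] that by blast
    then have "h p = h q" using p q by blast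
    obtain e where "e \<in> K" "h e \<noteq> h x" "h e \<noteq> h p" using abd by metis
    then show False using k[of e q] k[of p e] p q \<open>h p = h q\<close> by metis
  next
    case False
    \<comment> \<open>Now \<open>S\<close> covers all other classes, so the part of \<open>r\<close>
      outside \<open>S\<close> lies in the class of \<open>x\<close>, and \<open>r\<close> contains
      that whole class.\<close>
    obtain t where t: "t \<in> r" "t \<notin> S" "t \<in> K" using r sub[of r] by (auto simp: overlap_def)
    with False have "h t = h x" by blast
    then have inr: "x \<in> r" "x' \<in> r" "y \<in> r" "y' \<in> r"
      using hr[OF r(1)] t K e by metis+
    obtain s where s: "s \<in> F" "overlap r s" using ov_conn_overlap_exists[OF F r(1)] by blast
    then obtain e1 e2 where "e1 \<in> r" "e1 \<notin> s" "e2 \<in> r" "e2 \<in> s" by (auto simp: overlap_def)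
    then have "h e1 \<noteq> h e2" "e1 \<in> K" "e2 \<in> K" using hr[OF s(1)] sub[OF r(1)] by blast+
    then obtain e' where e': "e' \<in> r" "e' \<in> K" "h e' \<noteq> h x" using \<open>e1 \<in> r\<close> \<open>e2 \<in> r\<close> by metis
    obtain w where w: "w \<in> K" "w \<notin> r" using sub[OF r(1)] by blast
    have "h w \<noteq> h x" "h e' \<noteq> h w" using hr[OF r(1)] w e' inr K by metis+
    moreover have "e' \<in> S" using False e' by blast
    ultimately show False
      using key[OF arcrS, of e' w] m inr w e' by auto
  qed
qed

text \<open>A class split by \<open>S\<close> consists of two consecutive blocks; the value 1 marks
  the second block. A class that \<open>S\<close> does not split gets 0.\<close>

definition side :: "('v \<Rightarrow> int) \<Rightarrow> 'v \<Rightarrow> int" where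
  "side g v = (if \<exists>u\<in>K. h u = h v \<and> (u \<in> S) \<noteq> (v \<in> S) \<and> before K h g u v then 1 else 0)"

lemma side_range: "side g v = 0 \<or> side g v = 1"
  unfolding side_def by auto

lemma before_total:
  assumes "circ_good K (insert S F) g" "u \<in> K" "v \<in> K" "h u = h v" "u \<in> S" "v \<notin> S"
  shows "before K h g u v \<or> before K h g v u"
proof -
  obtain a b c where abc: "a \<in> K" "b \<in> K" "c \<in> K" "h a \<noteq> h b" "h b \<noteq> h c" "h a \<noteq> h c" by (rule three)
  then obtain w where w: "w \<in> K" "h w \<noteq> h u" by metis
  have gF: "circ_good K F g" using circ_good_subset[OF assms(1)] by blast
  have "g w \<noteq> g u" "g w \<noteq> g v" using good_neq[OF gF] w assms(2-4) by metis+
  moreover have "g u \<noteq> g v"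
    using circ_good_twins[OF assms(1-3)] assms(5,6) by (auto simp: twins_def)
  ultimately have "cyc g u v w \<or> cyc g v u w" unfolding cyc_def by auto
  then show ?thesis
  proof
    assume "cyc g u v w"
    with w show ?thesis unfolding before_def by blast
  next
    assume "cyc g v u w"
    moreover have "h w \<noteq> h v" using w assms(4) by simp
    ultimately show ?thesis using w(1) unfolding before_def by blast
  qed
qed

text \<open>\<open>type_unique\<close> applied to \<open>g\<close> and itself excludes two opposite
  changes of membership inside one class, so the members of \<open>S\<close> and the others form two
  blocks.\<close>

lemma side_props:
  assumes g: "refines K h g" "circ_good K (insert S F) g"
    and K: "u \<in> K" "v \<in> K" and e: "h u = h v"
  shows "(side g u = side g v) \<longleftrightarrow> (u \<in> S \<longleftrightarrow> v \<in> S)"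
    and "side g u < side g v \<Longrightarrow> before K h g u v"
proof -
  have *: "side g v = 1 \<and> side g u = 0" if "(u \<in> S) \<noteq> (v \<in> S)" "before K h g u v" "u \<in> K" "v \<in> K" "h u = h v" for u v
  proof -
    have "\<exists>u\<in>K. h u = h v \<and> (u \<in> S) \<noteq> (v \<in> S) \<and> before K h g u v"
      by (rule bexI[of _ u], intro conjI, fact that(5), fact that(1), fact that(2), fact that(3))
    then have "side g v = 1" unfolding side_def by (rule if_P)
    moreover have False if "u' \<in> K" "h u' = h u" "(u' \<in> S) \<noteq> (u \<in> S)" "before K h g u' u" for u'
    proof (cases "u \<in> S")
      case True
      show False by (rule type_unique[OF g g, of u v u u']) (use True that \<open>u \<in> K\<close> \<open>v \<in> K\<close> \<open>h u = h v\<close> \<open>(u \<in> S) \<noteq> (v \<in> S)\<close> \<open>before K h g u v\<close> in auto)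
    next
      case False
      show False by (rule type_unique[OF g g, of u' u v u]) (use False that \<open>u \<in> K\<close> \<open>v \<in> K\<close> \<open>h u = h v\<close> \<open>(u \<in> S) \<noteq> (v \<in> S)\<close> \<open>before K h g u v\<close> in auto)
    qed
    then have "side g u = 0" unfolding side_def by (intro if_not_P) blast
    ultimately show ?thesis by simp
  qed
  have differ: "before K h g u v \<and> side g u = 0 \<and> side g v = 1 \<or> before K h g v u \<and> side g v = 0 \<and> side g u = 1"
    if "(u \<in> S) \<noteq> (v \<in> S)" "u \<in> K" "v \<in> K" "h u = h v" for u v
    using before_total[OF g(2), of u v] before_total[OF g(2), of v u] *[of u v] *[of v u] that by metis
  have same: "side g u = side g v" if uv: "(u \<in> S) = (v \<in> S)" "u \<in> K" "v \<in> K" "h u = h v" for u v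
  proof -
    have "side g u = 1 \<Longrightarrow> side g v = 1" if uv: "(u \<in> S) = (v \<in> S)" "u \<in> K" "v \<in> K" "h u = h v" for u v
    proof -
      assume "side g u = 1"
      then obtain u' where u': "u' \<in> K" "h u' = h u" "(u' \<in> S) \<noteq> (u \<in> S)" "before K h g u' u"
        unfolding side_def by (auto split: if_splits)
      then have "side g u' = 0" using *[of u' u] uv by auto
      then show "side g v = 1" using differ[of u' v] u' uv by auto
    qed
    from this[of u v] this[of v u] uv side_range[of g u] side_range[of g v] show ?thesis by metis
  qed
  show "(side g u = side g v) \<longleftrightarrow> (u \<in> S \<longleftrightarrow> v \<in> S)"
    using same[of u v] differ[of u v] K e by force
  show "before K h g u v" if "side g u < side g v"
    using same[of u v] differ[of u v] K e that by force
qed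

definition ext where "ext g v = 2 * h v + side g v"

lemma ext_eq: "ext g u = ext g v \<longleftrightarrow> h u = h v \<and> side g u = side g v"
  unfolding ext_def using side_range[of g u] side_range[of g v] by presburger

lemma ext_less: "ext g u < ext g v \<longleftrightarrow> h u < h v \<or> h u = h v \<and> side g u < side g v"
  unfolding ext_def using side_range[of g u] side_range[of g v] by presburger

text \<open>Another admissible order cannot exchange the two blocks of a class, by
  \<open>type_unique\<close> for \<open>g\<close> and \<open>g2\<close>. Hence the refined order is
  forced as well.\<close>

lemma refines_ext:
  assumes g: "refines K h g" "circ_good K (insert S F) g"
    and g2: "refines K h g2" "circ_good K (insert S F) g2"
  shows "refines K (ext g) g2"
  unfolding refines_def
proof (intro ballI impI)
  have lt: "cyc g2 u v w" if "u \<in> K" "v \<in> K" "w \<in> K" "h u = h v" "h w \<noteq> h u" "side g u < side g v" for u v w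
  proof -
    have b: "before K h g u v" using side_props(2)[OF g] that by blast
    have ne: "(u \<in> S) \<noteq> (v \<in> S)" using side_props(1)[OF g, of u v] that by auto
    have "\<not> before K h g2 v u"
    proof
      assume b2: "before K h g2 v u"
      show False
      proof (cases "u \<in> S")
        case True
        show False by (rule type_unique[OF g g2, of u v u v]) (use True ne that b b2 in auto)
      next
        case False
        show False by (rule type_unique[OF g2 g, of v u v u]) (use False ne that b b2 in auto)
      qed
    qed
    then have "before K h g2 u v" using before_total[OF g2(2), of u v] before_total[OF g2(2), of v u] ne that by metis
    then show ?thesis using class_cyc[OF g2(1)] that unfolding before_def by metis
  qed
  fix a b c assume K: "a \<in> K" "b \<in> K" "c \<in> K"
  assume "cyc (ext g) a b c"
  then have c: "(h a < h b \<or> h a = h b \<and> side g a < side g b) \<and> (h b < h c \<or> h b = h c \<and> side g b < side g c) \<or>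
    (h b < h c \<or> h b = h c \<and> side g b < side g c) \<and> (h c < h a \<or> h c = h a \<and> side g c < side g a) \<or>
    (h c < h a \<or> h c = h a \<and> side g c < side g a) \<and> (h a < h b \<or> h a = h b \<and> side g a < side g b)"
    unfolding cyc_def ext_less .
  have "cyc h a b c \<or> (h a = h b \<and> h c \<noteq> h a \<and> side g a < side g b)
    \<or> (h b = h c \<and> h a \<noteq> h b \<and> side g b < side g c) \<or> (h c = h a \<and> h b \<noteq> h c \<and> side g c < side g a)"
    using c side_range[of g a] side_range[of g b] side_range[of g c] unfolding cyc_def by (smt (verit))
  then consider "cyc h a b c" | "h a = h b" "h c \<noteq> h a" "side g a < side g b"
    | "h b = h c" "h a \<noteq> h b" "side g b < side g c" | "h c = h a" "h b \<noteq> h c" "side g c < side g a"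
    by blast
  then show "cyc g2 a b c"
    by cases (use refinesD[OF g2(1)] lt K cyc_rotate in metis)+
qed

text \<open>\<open>g\<close> itself refines \<open>ext g\<close>, so an alternation for
  \<open>ext g\<close> would be one for \<open>g\<close>.\<close>

lemma ext_good:
  assumes g: "refines K h g" "circ_good K (insert S F) g"
  shows "circ_good K (insert S F) (ext g)" "exact K (insert S F) (ext g)"
proof -
  show e: "exact K (insert S F) (ext g)"
    unfolding exact_def ext_eq using exactD[OF ex] side_props(1)[OF g] by (auto simp: twins_def)
  show "circ_good K (insert S F) (ext g)"
  proof (rule circ_goodI)
    show "twins (insert S F) u v" if "u \<in> K" "v \<in> K" "ext g u = ext g v" for u v
      using exactD[OF e] that by blast
    show "is_arc K (ext g) (r \<inter> s)" if "r \<in> insert S F" "s \<in> insert S F" for r s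
      using circ_good_arc[OF g(2) that] refinesD[OF refines_ext[OF g g]] unfolding is_arc_def by blast
  qed
qed

text \<open>By rigidity a good order of the larger family respects \<open>h\<close> up to reversal;
  the reversal is undone before the blocks are read off.\<close>

lemma side_exists:
  assumes rg: "rigid K F h" and g: "circ_good K (insert S F) g"
  obtains sg where "\<And>v. sg v = 0 \<or> sg v = (1::int)"
    "\<And>u v. u \<in> K \<Longrightarrow> v \<in> K \<Longrightarrow> h u = h v \<Longrightarrow> sg u = sg v \<longleftrightarrow> (u \<in> S \<longleftrightarrow> v \<in> S)"
    "circ_good K (insert S F) (\<lambda>v. 2 * h v + sg v)" "rigid K (insert S F) (\<lambda>v. 2 * h v + sg v)"
proof -
  have orient: "\<exists>g'. refines K h g' \<and> circ_good K (insert S F) g' \<and> (g' = g \<or> g' = (\<lambda>v. - g v))"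
    if "circ_good K (insert S F) g" for g
  proof -
    have "circ_good K F g" using circ_good_subset[OF that] by blast
    then consider "refines K h g" | "refines K h (\<lambda>v. - g v)" using rg unfolding rigid_def by blast
    then show ?thesis
    proof cases
      case 2
      have "circ_good K (insert S F) (\<lambda>v. - g v)" using that circ_good_uminus[of K "insert S F" g] by simp
      with 2 show ?thesis by blast
    qed (use that in blast)
  qed
  from orient[OF g] obtain g' where g': "refines K h g'" "circ_good K (insert S F) g'" by blast
  have e: "ext g' = (\<lambda>v. 2 * h v + side g' v)" by (simp add: ext_def fun_eq_iff)
  have "rigid K (insert S F) (ext g')"
    unfolding rigid_def using ext_good[OF g'] orient refines_ext[OF g'] by metis
  with that[of "side g'"] side_range side_props(1)[OF g'] ext_good[OF g'] e show thesis by metis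
qed

end

section \<open>Uniqueness: two overlapping sets, then induction\<close>

lemma refinesI_less:
  assumes "\<And>a b c. a \<in> K \<Longrightarrow> b \<in> K \<Longrightarrow> c \<in> K \<Longrightarrow> h a < h b \<Longrightarrow> h b < h c \<Longrightarrow> cyc g a b c"
  shows "refines K h g"
  unfolding refines_def
proof (intro ballI impI)
  fix a b c assume K: "a \<in> K" "b \<in> K" "c \<in> K" and c: "cyc h a b c"
  from c consider "h a < h b" "h b < h c" | "h b < h c" "h c < h a" | "h c < h a" "h a < h b"
    unfolding cyc_def by blast
  then show "cyc g a b c"
  proof cases
    case 1 then show ?thesis using assms K by blast
  next
    case 2 then show ?thesis using assms[of b c a] K by (simp add: cyc_rotate[of g a])
  next
    case 3 then show ?thesis using assms[of c a b] K by (simp add: cyc_rotate[of g c])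
  qed
qed

text \<open>The four Venn regions must follow each other as \<open>r - s\<close>,
  \<open>r \<inter> s\<close>, \<open>s - r\<close>, outside. Once one triple fixes the direction,
  every other arrangement makes \<open>r\<close>, \<open>s\<close> or \<open>r \<inter> s\<close>
  alternate.\<close>

lemma rigid_pair:
  assumes K: "r \<subseteq> K" "s \<subseteq> K" and ov: "overlap r s"
  shows "rigid K {r, s} (\<lambda>v. if v \<in> r then if v \<in> s then 1 else 0 else if v \<in> s then 2 else 3)"
    (is "rigid K _ ?h")
proof -
  have ex: "exact K {r, s} ?h" unfolding exact_def twins_def by auto
  have good: "circ_good K {r, s} ?h"
  proof (rule circ_goodI)
    show "twins {r, s} u v" if "u \<in> K" "v \<in> K" "?h u = ?h v" for u v
      using exactD[OF ex that(1,2)] that(3) by blast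
    have "is_arc K ?h r" by (rule is_arc_interval[of _ _ 0 _ 1]) auto
    moreover have "is_arc K ?h s" by (rule is_arc_interval[of _ _ 1 _ 2]) auto
    moreover have "is_arc K ?h (r \<inter> s)" by (rule is_arc_interval[of _ _ 1 _ 1]) auto
    ultimately show "is_arc K ?h (r' \<inter> s')" if "r' \<in> {r, s}" "s' \<in> {r, s}" for r' s'
      using that by (auto simp: Int_commute)
  qed
  obtain a0 b0 c0 where abc: "a0 \<in> r - s" "b0 \<in> r \<inter> s" "c0 \<in> s - r" using ov by (auto simp: overlap_def)
  have core: "refines K ?h g" if g: "circ_good K {r, s} g" and c0: "cyc g a0 b0 c0" for g
  proof -
    have ar: "is_arc K g r" and as: "is_arc K g s" and ars: "is_arc K g (r \<inter> s)"
      using circ_good_arc1[OF g] circ_good_arc[OF g, of r s] by auto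
    have ne: "g u \<noteq> g v" if "u \<in> K" "v \<in> K" "(u \<in> r) \<noteq> (v \<in> r) \<or> (u \<in> s) \<noteq> (v \<in> s)" for u v
      using circ_good_twins[OF g that(1,2)] that(3) unfolding twins_def by blast
    have tot: "cyc g a b c \<or> cyc g a c b"
      if "a \<in> K" "b \<in> K" "c \<in> K" "(a \<in> r) \<noteq> (b \<in> r) \<or> (a \<in> s) \<noteq> (b \<in> s)"
        "(a \<in> r) \<noteq> (c \<in> r) \<or> (a \<in> s) \<noteq> (c \<in> s)" "(c \<in> r) \<noteq> (b \<in> r) \<or> (c \<in> s) \<noteq> (b \<in> s)" for a b c
      using cyc_total[of g a b c] ne[of a b] ne[of a c] ne[of c b] that cyc_rotate by metis
    have 1: "cyc g a b0 c0" if "a \<in> r - s" for a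
    proof (rule ccontr)
      assume "\<not> ?thesis"
      with tot[of a b0 c0] that abc K have "cyc g a c0 b0" by blast
      then have "cyc g b0 a c0" "cyc g b0 c0 a0" using c0 by (metis cyc_rotate)+
      from is_arcD[OF as this] abc that K show False by blast
    qed
    have 2: "cyc g a b0 c" if "a \<in> r - s" "c \<in> s - r" for a c
    proof (rule ccontr)
      assume "\<not> ?thesis"
      with tot[of a b0 c] that abc K have "cyc g a c b0" by blast
      from is_arcD[OF ar this 1[OF that(1)]] abc that K show False by blast
    qed
    have 3: "cyc g a b c" if "a \<in> r - s" "b \<in> r \<inter> s" "c \<in> s - r" for a b c
    proof (rule ccontr)
      assume "\<not> ?thesis"
      with tot[of a b c] that abc K have "cyc g a c b" by blast
      from cyc4_rotate[OF 2[OF that(1,3)] this] have *: "cyc g b0 c b" "cyc g b0 b a" by auto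
      from is_arcD[OF ars *] abc that K show False by blast
    qed
    have 4: "cyc g a b z \<and> cyc g b c z \<and> cyc g a c z"
      if "a \<in> r - s" "b \<in> r \<inter> s" "c \<in> s - r" "z \<in> K" "z \<notin> r" "z \<notin> s" for a b c z
    proof -
      have "cyc g a b z"
      proof (rule ccontr)
        assume "\<not> ?thesis"
        with tot[of a b z] that K have "cyc g a z b" by blast
        from is_arcD[OF ar this 3[OF that(1,2,3)]] that K show False by blast
      qed
      moreover have "cyc g b c z"
      proof (rule ccontr)
        assume "\<not> ?thesis"
        with tot[of b c z] that K have *: "cyc g b z c" by blast
        have "cyc g b c a" using 3[OF that(1,2,3)] by (metis cyc_rotate)
        from is_arcD[OF as * this] that K show False by blast
      qed
      ultimately show ?thesis using 3[OF that(1,2,3)] unfolding cyc_def by (smt (verit))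
    qed
    show ?thesis
    proof (rule refinesI_less)
      fix x y w assume xyw: "x \<in> K" "y \<in> K" "w \<in> K" "?h x < ?h y" "?h y < ?h w"
      then consider "x \<in> r - s" "y \<in> r \<inter> s" "w \<in> s - r" | "x \<in> r - s" "y \<in> r \<inter> s" "w \<notin> r" "w \<notin> s"
        | "x \<in> r - s" "y \<in> s - r" "w \<notin> r" "w \<notin> s" | "x \<in> r \<inter> s" "y \<in> s - r" "w \<notin> r" "w \<notin> s"
        by (auto split: if_splits)
      then show "cyc g x y w"
        by cases (use 3 4 xyw abc in blast)+
    qed
  qed
  have "refines K ?h g \<or> refines K ?h (\<lambda>v. - g v)" if g: "circ_good K {r, s} g" for g
  proof -
    have "g a0 \<noteq> g b0" "g b0 \<noteq> g c0" "g a0 \<noteq> g c0"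
      using circ_good_twins[OF g, of a0 b0] circ_good_twins[OF g, of b0 c0] circ_good_twins[OF g, of a0 c0] abc K
      unfolding twins_def by blast+
    then have "cyc g a0 b0 c0 \<or> cyc (\<lambda>v. - g v) a0 b0 c0"
      unfolding cyc_uminus by (rule cyc_total)
    then show ?thesis using core[OF g] core[of "\<lambda>v. - g v"] g circ_good_uminus by blast
  qed
  with ex good show ?thesis unfolding rigid_def by blast
qed

text \<open>A good order \<open>g\<close> of the whole family is assumed: it is good for all
  subfamilies and supplies the cuts in each extension.\<close>

lemma rigid_exists:
  assumes "finite F" "ov_conn F" "card F \<ge> 2" "\<And>r. r \<in> F \<Longrightarrow> r \<subseteq> K \<and> r \<noteq> K" "circ_good K F g"
  shows "\<exists>h. rigid K F h"
  using assms
proof (induction "card F" arbitrary: F rule: less_induct)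
  case less
  from less.prems(2) obtain u where "u \<in> F" by (auto simp: ov_conn_def)
  with ov_conn_remove[of F u] less.prems obtain b where b: "b \<in> F" "ov_conn (F - {b})" by blast
  from ov_conn_overlap_exists[OF less.prems(2,3) b(1)] obtain a where a: "a \<in> F" "overlap a b"
    by (auto simp: overlap_sym)
  then have ab: "a \<in> F - {b}" by (auto simp: overlap_def)
  show ?case
  proof (cases "card F = 2")
    case True
    then have "F = {a, b}" using a(1) b(1) ab by (auto simp: card_2_iff)
    moreover have "a \<subseteq> K" "b \<subseteq> K" using less.prems(4) a b by blast+
    ultimately show ?thesis using rigid_pair[of a K b] a by blast
  next
    case False
    have c: "card (F - {b}) < card F" "card (F - {b}) \<ge> 2"
      using False less.prems(1,3) b(1) by (auto simp: card_Diff_singleton)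
    from less.hyps[OF c(1) _ b(2) c(2)] less.prems circ_good_subset[OF less.prems(5)]
    obtain h where h: "rigid K (F - {b}) h" by blast
    have rx: "rigid_ext K (F - {b}) b h"
      by unfold_locales (use b c less.prems a ab h in \<open>auto simp: rigid_def\<close>)
    have ins: "insert b (F - {b}) = F" using b by auto
    show ?thesis
      by (rule rigid_ext.side_exists[OF rx h, of g]) (use less.prems(5) ins in auto)
  qed
qed

text \<open>No set of \<open>F'\<close> separates \<open>X\<close>, so \<open>X\<close> can occupy
  the single position \<open>f1 x0\<close>. There \<open>f2\<close> is inserted, cut open at a point
  \<open>z\<close> outside \<open>X\<close>. Since \<open>z\<close> lies in no set of
  \<open>F''\<close>, no arc coming from \<open>F''\<close> runs through the cut, and all of them
  become intervals.\<close>

lemma circ_good_module: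
  assumes fin: "finite K" and X: "X \<subseteq> K" "X \<noteq> K"
    and F': "\<And>r. r \<in> F' \<Longrightarrow> X \<subseteq> r \<or> r \<inter> X = {}" and F'': "\<And>r. r \<in> F'' \<Longrightarrow> r \<subseteq> X"
    and f1: "circ_good K F' f1" and f2: "circ_good K F'' f2"
  shows "\<exists>f. circ_good K (F' \<union> F'') f"
proof (cases "X = {}")
  case True
  then have "is_arc K f1 {}" "\<And>r. r \<in> F'' \<Longrightarrow> r = {}" using F'' by (auto simp: is_arc_def)
  then have "circ_good K (F' \<union> F'') f1"
    using f1 unfolding circ_good_def twins_def by (metis Int_empty_left Int_empty_right Un_iff empty_iff)
  then show ?thesis by blast
next
  case False
  then obtain x0 where x0: "x0 \<in> X" by blast
  obtain z where z: "z \<in> K" "z \<notin> X" using X by blast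
  obtain N where N: "\<And>v. v \<in> K \<Longrightarrow> \<bar>f2 v\<bar> < N" "N > 0"
  proof -
    have M: "\<bar>f2 v\<bar> \<le> Max ((\<lambda>v. \<bar>f2 v\<bar>) ` K)" if "v \<in> K" for v
      using that fin by (intro Max_ge) auto
    from M[OF z(1)] have "Max ((\<lambda>v. \<bar>f2 v\<bar>) ` K) \<ge> 0" by simp
    with M show thesis by (intro that[of "Max ((\<lambda>v. \<bar>f2 v\<bar>) ` K) + 1"]) force+
  qed
  \<comment> \<open>\<open>e\<close> reads \<open>f2\<close> as a line starting at \<open>z\<close>:
    values below \<open>f2 z\<close> are wrapped around by \<open>2 * N\<close>, a bound for all
    differences. In \<open>h\<close> the same factor keeps different values of \<open>f1\<close>
    apart.\<close>
  define e where "e v = (if f2 v \<ge> f2 z then f2 v - f2 z else f2 v - f2 z + 2 * N)" for v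
  define h where "h v = (if v \<in> X then 2 * N * f1 x0 + e v else 2 * N * f1 v)" for v
  have e_range: "0 \<le> e v" "e v < 2 * N" if "v \<in> K" for v
    using N(1)[OF that] N(1)[OF z(1)] unfolding e_def by auto
  have e_eq: "f2 u = f2 v" if "e u = e v" "u \<in> K" "v \<in> K" for u v
    using that N(1)[of u] N(1)[of v] N(1)[OF z(1)] unfolding e_def by (auto split: if_splits)
  have e_cyc: "cyc f2 z a b \<longleftrightarrow> f2 a \<noteq> f2 z \<and> e a < e b" if "a \<in> K" "b \<in> K" for a b
    using that N(1)[of a] N(1)[of b] N(1)[OF z(1)] unfolding e_def cyc_def by (auto split: if_splits)
  define p where "p v = (if v \<in> X then x0 else v)" for v
  have x0K: "x0 \<in> K" using x0 X by blast
  have pK: "p v \<in> K" if "v \<in> K" for v using that x0K by (simp add: p_def)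
  have pmem: "v \<in> r \<longleftrightarrow> p v \<in> r" if "r \<in> F'" for r v using F'[OF that] x0 by (auto simp: p_def)
  have scale: "a \<le> b" if "2 * N * a + i < 2 * N * b + j" "0 \<le> i" "j < 2 * N" for a b i j :: int
  proof (rule ccontr)
    assume "\<not> a \<le> b"
    then have "2 * N * (b + 1) \<le> 2 * N * a" using N(2) by (intro mult_left_mono) auto
    with that show False by (simp add: algebra_simps)
  qed
  have h_p: "h v = 2 * N * f1 (p v) + (if v \<in> X then e v else 0)" for v by (simp add: h_def p_def)
  have hmono: "f1 (p u) \<le> f1 (p v)" if "u \<in> K" "v \<in> K" "h u < h v" for u v
    by (rule scale[OF that(3)[unfolded h_p]]) (use e_range that N(2) in auto)
  have h_eq: "f1 (p u) = f1 (p v) \<and> (if u \<in> X then e u else 0) = (if v \<in> X then e v else 0)"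
    if "u \<in> K" "v \<in> K" "h u = h v" for u v
  proof -
    let ?i = "if u \<in> X then e u else 0" and ?j = "if v \<in> X then e v else 0"
    have ij: "0 \<le> ?i" "?i < 2 * N" "0 \<le> ?j" "?j < 2 * N"
      using e_range[OF that(1)] e_range[OF that(2)] N(2) by simp_all
    have "(2 * N * f1 (p u) + ?i) div (2 * N) = f1 (p u)" "(2 * N * f1 (p v) + ?j) div (2 * N) = f1 (p v)"
      using ij N(2) by (simp_all add: div_pos_pos_trivial)
    then have "f1 (p u) = f1 (p v)" using that(3) unfolding h_p by metis
    with that(3) show ?thesis unfolding h_p by simp
  qed
  have tw2: "twins F'' u v" if "u \<in> K" "v \<in> K" "h u = h v" for u v
  proof -
    \<comment> \<open>Offset 0 is shared with elements outside \<open>X\<close> in the same position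
      of \<open>f1\<close>. An element of \<open>X\<close> with this offset is tied with
      \<open>z\<close>, so it lies in no set of \<open>F''\<close>, and the tie is harmless.\<close>
    have *: "twins F'' u' v'" if "u' \<in> X" "v' \<in> K" "v' \<notin> X" "e u' = 0" for u' v'
    proof -
      have "e z = 0" by (simp add: e_def)
      then have "f2 u' = f2 z" using e_eq[of u' z] that z X by auto
      then have "twins F'' u' z" using circ_good_twins[OF f2, of u' z] that X z by blast
      then show ?thesis using that z F'' unfolding twins_def by blast
    qed
    from h_eq[OF that] consider "u \<in> X" "v \<in> X" "e u = e v" | "u \<in> X" "v \<notin> X" "e u = 0"
      | "u \<notin> X" "v \<in> X" "e v = 0" | "u \<notin> X" "v \<notin> X" by (auto split: if_splits)
    then show ?thesis
    proof cases
      case 1 then show ?thesis using e_eq circ_good_twins[OF f2] that by blast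
    next
      case 2 then show ?thesis using *[of u v] that by blast
    next
      case 3 then show ?thesis using *[of v u] that unfolding twins_def by blast
    next
      case 4 then show ?thesis using F'' unfolding twins_def by blast
    qed
  qed
  have tw1: "twins F' u v" if "u \<in> K" "v \<in> K" "h u = h v" for u v
    using circ_good_twins[OF f1 pK[OF that(1)] pK[OF that(2)]] h_eq[OF that] pmem unfolding twins_def by blast
  have arc1: "is_arc K h (r \<inter> s)" if "r \<in> F'" "s \<in> F'" for r s
  proof (rule is_arc_coarsen[OF circ_good_arc[OF f1 that], of p])
    show "p u \<in> r \<inter> s \<longleftrightarrow> p v \<in> r \<inter> s" if "u \<in> K" "v \<in> K" "f1 (p u) = f1 (p v)" for u v
      using circ_good_twins[OF f1 pK[OF that(1)] pK[OF that(2)] that(3)] \<open>r \<in> F'\<close> \<open>s \<in> F'\<close> unfolding twins_def by blast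
    show "p v \<in> K" if "v \<in> K" for v using pK[OF that] .
    show "v \<in> r \<inter> s \<longleftrightarrow> p v \<in> r \<inter> s" for v using pmem[OF \<open>r \<in> F'\<close>, of v] pmem[OF \<open>s \<in> F'\<close>, of v] by blast
    show "f1 (p u) \<le> f1 (p v)" if "u \<in> K" "v \<in> K" "h u < h v" for u v using hmono[OF that] .
  qed
  have arc2: "is_arc K h A" if A: "A \<subseteq> X" "is_arc K f2 A" and At: "\<And>u v. twins F'' u v \<Longrightarrow> u \<in> A \<longleftrightarrow> v \<in> A" for A
  proof -
    have int: "b \<in> A" if "a \<in> A" "c \<in> A" "b \<in> K" "h a < h b" "h b < h c" for a b c
    proof (rule ccontr)
      assume nb: "b \<notin> A"
      have ac: "a \<in> X" "c \<in> X" "a \<in> K" "c \<in> K" using that A X by auto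
      have pe: "p a = x0" "p c = x0" using ac by (auto simp: p_def)
      have "f1 (p b) = f1 x0" using hmono[of a b] hmono[of b c] that ac pe by auto
      then have eb: "e a < (if b \<in> X then e b else 0)" "(if b \<in> X then e b else 0) < e c"
        using that(4,5) ac unfolding h_p pe by simp_all
      then have "b \<in> X" using e_range(1)[of a] ac by (auto split: if_splits)
      with eb have ee: "e a < e b" "e b < e c" by auto
      have nz: "f2 u \<noteq> f2 z" if "u \<in> A" "u \<in> K" for u
        using circ_good_twins[OF f2 that(2) z(1)] At[of u z] that A(1) z(2) by blast
      have "f2 b \<noteq> f2 z" using e_eq[of b z] ee(1) e_range(1)[of a] ac(3) that(3) z(1) e_cyc[of b b]
        by (auto simp: e_def split: if_splits)
      then have "cyc f2 z a b" "cyc f2 z b c" using e_cyc ee that ac nz by blast+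
      then have "cyc f2 a b c \<and> cyc f2 a c z" unfolding cyc_def by (smt (verit))
      then show False using is_arcD[OF A(2), of a b c z] that ac nb z A(1) by blast
    qed
    show ?thesis unfolding is_arc_def
    proof (intro ballI impI)
      fix a b c d assume K: "a \<in> K" "b \<in> K" "c \<in> K" "d \<in> K"
      assume *: "cyc h a b c \<and> cyc h a c d \<and> a \<in> A \<and> c \<in> A"
      then have "h a < h b \<and> h b < h c \<or> h a < h d \<and> h d < h c \<or> h c < h b \<and> h b < h a \<or> h c < h d \<and> h d < h a"
        unfolding cyc_def by auto
      then show "b \<in> A \<or> d \<in> A" using int K * by blast
    qed
  qed
  have "circ_good K (F' \<union> F'') h"
  proof (rule circ_goodI)
    show "twins (F' \<union> F'') u v" if "u \<in> K" "v \<in> K" "h u = h v" for u v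
      using tw1[OF that] tw2[OF that] unfolding twins_def by blast
    have arcF'': "is_arc K h (r \<inter> s)" if "r \<in> F''" "s \<in> F''" for r s
      by (rule arc2) (use that F'' circ_good_arc[OF f2] in \<open>auto simp: twins_def\<close>)
    have mixed: "is_arc K h (r \<inter> s)" if "r \<in> F'" "s \<in> F''" for r s
    proof -
      have "r \<inter> s = s \<or> r \<inter> s = {}" using F'[OF that(1)] F''[OF that(2)] by blast
      then show ?thesis
      proof
        assume "r \<inter> s = s"
        then show ?thesis using arcF''[OF that(2,2)] by simp
      next
        assume "r \<inter> s = {}"
        then show ?thesis by (simp add: is_arc_def)
      qed
    qed
    show "is_arc K h (r \<inter> s)" if "r \<in> F' \<union> F''" "s \<in> F' \<union> F''" for r s
      using that arc1 arcF'' mixed[of r s] mixed[of s r] by (auto simp: Int_commute)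
  qed
  then show ?thesis by blast
qed

section \<open>Forbidden configurations\<close>

text \<open>The lists may repeat entries. For the concrete patterns, whose rows and columns are
  distinct, the choices are automatically distinct; \<open>contains_pattern\<close> uses
  this.\<close>

definition has_pattern :: "'v set \<Rightarrow> 'v set set \<Rightarrow> nat list list \<Rightarrow> bool" where
  "has_pattern K F P \<longleftrightarrow> (\<exists>cs rs. set cs \<subseteq> K \<and> set rs \<subseteq> F \<and>
     map (\<lambda>r. map (\<lambda>c. if c \<in> r then 1 else 0) cs) rs = P)"

definition P_IV :: "nat list list" where
  "P_IV = [[1, 1, 0, 0, 0, 0], [0, 0, 1, 1, 0, 0], [0, 0, 0, 0, 1, 1], [0, 1, 0, 1, 0, 1]]"

definition P_V :: "nat list list" where
  "P_V = [[1, 1, 0, 0, 0], [1, 1, 1, 1, 0], [0, 0, 1, 1, 0], [1, 0, 0, 1, 1]]"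

definition P_VI :: "nat list list" where
  "P_VI = [[1, 1, 0, 1], [0, 1, 1, 1], [1, 0, 1, 1]]"

text \<open>This is 0101 \<oplus> M_I*(4) written out, as \<open>M_comp_eq\<close> confirms.\<close>

definition P_comp :: "nat list list" where
  "P_comp = [[1, 1, 0, 0, 0], [1, 0, 0, 1, 1], [0, 0, 1, 1, 0], [0, 1, 1, 0, 1]]"

definition cycle_rows :: "'v set \<Rightarrow> 'v set set \<Rightarrow> nat \<Rightarrow> (nat \<Rightarrow> 'v) \<Rightarrow> (nat \<Rightarrow> 'v set) \<Rightarrow> bool" where
  "cycle_rows K F k c \<rho> \<longleftrightarrow> 3 \<le> k \<and> (\<forall>i<k. c i \<in> K \<and> \<rho> i \<in> F) \<and>
     (\<forall>i<k. \<forall>j<k. c j \<in> \<rho> i \<longleftrightarrow> j = i \<or> j = Suc i mod k)"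

definition obst_cycle :: "'v set \<Rightarrow> 'v set set \<Rightarrow> bool" where
  "obst_cycle K F \<longleftrightarrow> (\<exists>k c \<rho>. cycle_rows K F k c \<rho> \<and> (\<exists>z\<in>K. \<forall>i<k. z \<notin> \<rho> i))"

text \<open>The vertex with neighbourhood \<open>s\<close> is adjacent to every \<open>c j\<close> and to none of the vertices with
  neighbourhoods \<open>\<rho> i\<close>, so it serves as the zero column of \<open>M\<^sub>I\<^sup>*(k)\<close>.\<close>

definition obst_cycle_full :: "'v set \<Rightarrow> 'v set set \<Rightarrow> bool" where
  "obst_cycle_full K F \<longleftrightarrow> (\<exists>k c \<rho>. cycle_rows K F k c \<rho> \<and> (\<exists>s\<in>F. \<forall>j<k. c j \<in> s))"

text \<open>The staircase of rows with two consecutive ones that \<open>M_I\<close>,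
  \<open>M_II\<close> and \<open>M_III\<close> have in common, with indices from 0: \<open>n\<close>
  rows on \<open>n + 1\<close> columns.\<close>

definition path_rows :: "'v set \<Rightarrow> 'v set set \<Rightarrow> nat \<Rightarrow> (nat \<Rightarrow> 'v) \<Rightarrow> (nat \<Rightarrow> 'v set) \<Rightarrow> bool" where
  "path_rows K F n c \<rho> \<longleftrightarrow> (\<forall>i\<le>n. c i \<in> K) \<and> (\<forall>i<n. \<rho> i \<in> F) \<and>
     (\<forall>i<n. \<forall>j\<le>n. c j \<in> \<rho> i \<longleftrightarrow> j = i \<or> j = Suc i)"

text \<open>With \<open>A = B\<close> this is \<open>M\<^sub>I\<^sub>I\<^sub>I(n + 1)\<close>, with \<open>A \<noteq> B\<close> it contains \<open>M\<^sub>I\<^sub>I(n + 2)\<close>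
  or \<open>M\<^sub>I\<^sub>I\<^sub>I(n + 1)\<close>.\<close>

definition obst_path :: "'v set \<Rightarrow> 'v set set \<Rightarrow> bool" where
  "obst_path K F \<longleftrightarrow> (\<exists>n c \<rho> A B z. 2 \<le> n \<and> path_rows K F n c \<rho> \<and> A \<in> F \<and> B \<in> F \<and>
     z \<in> K \<and> z \<in> A \<and> z \<in> B \<and> (\<forall>i<n. z \<notin> \<rho> i) \<and>
     (\<forall>j. 0 < j \<and> j < n \<longrightarrow> c j \<in> A \<and> c j \<in> B) \<and> c 0 \<notin> B \<and> c n \<notin> A)"

definition obst :: "'v set \<Rightarrow> 'v set set \<Rightarrow> bool" where
  "obst K F \<longleftrightarrow> obst_cycle K F \<or> obst_cycle_full K F \<or> obst_path K F \<or> has_pattern K F P_IV \<or>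
     has_pattern K F P_V \<or> has_pattern K F P_VI \<or> has_pattern K F P_comp"

lemma has_pattern_mono: "has_pattern K F P \<Longrightarrow> F \<subseteq> G \<Longrightarrow> has_pattern K G P"
  unfolding has_pattern_def by (elim exE conjE, intro exI conjI) (assumption | rule order_trans)+

lemma cycle_rows_mono: "cycle_rows K F k c \<rho> \<Longrightarrow> F \<subseteq> G \<Longrightarrow> cycle_rows K G k c \<rho>"
  unfolding cycle_rows_def by (meson subsetD)

lemma path_rows_mono: "path_rows K F k c \<rho> \<Longrightarrow> F \<subseteq> G \<Longrightarrow> path_rows K G k c \<rho>"
  unfolding path_rows_def by (meson subsetD)

lemma obst_mono:
  assumes "obst K F" "F \<subseteq> G" shows "obst K G"
proof -
  have "obst_cycle K G" if "obst_cycle K F"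
  proof -
    from that obtain k c \<rho> where "cycle_rows K F k c \<rho>" "\<exists>z\<in>K. \<forall>i<k. z \<notin> \<rho> i"
      unfolding obst_cycle_def by blast
    then show ?thesis unfolding obst_cycle_def using cycle_rows_mono[OF _ assms(2)] by blast
  qed
  moreover have "obst_cycle_full K G" if "obst_cycle_full K F"
  proof -
    from that obtain k c \<rho> s where "cycle_rows K F k c \<rho>" "s \<in> F" "\<forall>j<k. c j \<in> s"
      unfolding obst_cycle_full_def by blast
    then show ?thesis unfolding obst_cycle_full_def using cycle_rows_mono[OF _ assms(2)] assms(2) by blast
  qed
  moreover have "obst_path K G" if "obst_path K F"
  proof -
    from that obtain n c \<rho> A B z where *: "2 \<le> n" "path_rows K F n c \<rho>" "A \<in> F" "B \<in> F"
      "z \<in> K" "z \<in> A" "z \<in> B" "\<forall>i<n. z \<notin> \<rho> i"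
      "\<forall>j. 0 < j \<and> j < n \<longrightarrow> c j \<in> A \<and> c j \<in> B" "c 0 \<notin> B" "c n \<notin> A"
      unfolding obst_path_def by (elim exE conjE) (rule that)
    have "path_rows K G n c \<rho>" "A \<in> G" "B \<in> G" using * path_rows_mono[OF _ assms(2)] assms(2) by auto
    with * show ?thesis unfolding obst_path_def by blast
  qed
  ultimately show ?thesis using assms has_pattern_mono[OF _ assms(2)] unfolding obst_def by metis
qed

section \<open>Introduction rules for the obstructions\<close>

lemma obst_VI:
  assumes "a \<in> K" "b \<in> K" "c \<in> K" "d \<in> K" "r \<in> F" "s \<in> F" "t \<in> F"
    "a \<in> r" "b \<in> r" "c \<notin> r" "d \<in> r" "a \<notin> s" "b \<in> s" "c \<in> s" "d \<in> s" "a \<in> t" "b \<notin> t" "c \<in> t" "d \<in> t"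
  shows "obst K F"
proof -
  have "has_pattern K F P_VI" unfolding has_pattern_def P_VI_def
    by (rule exI[of _ "[a, b, c, d]"], rule exI[of _ "[r, s, t]"]) (use assms in simp)
  then show ?thesis by (simp add: obst_def)
qed

lemma obst_IV:
  assumes "a \<in> K" "b \<in> K" "c \<in> K" "d \<in> K" "e \<in> K" "f \<in> K" "r \<in> F" "s \<in> F" "t \<in> F" "u \<in> F"
    "a \<in> r" "b \<in> r" "c \<notin> r" "d \<notin> r" "e \<notin> r" "f \<notin> r"
    "a \<notin> s" "b \<notin> s" "c \<in> s" "d \<in> s" "e \<notin> s" "f \<notin> s"
    "a \<notin> t" "b \<notin> t" "c \<notin> t" "d \<notin> t" "e \<in> t" "f \<in> t"
    "a \<notin> u" "b \<in> u" "c \<notin> u" "d \<in> u" "e \<notin> u" "f \<in> u"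
  shows "obst K F"
proof -
  have "has_pattern K F P_IV" unfolding has_pattern_def P_IV_def
    by (rule exI[of _ "[a, b, c, d, e, f]"], rule exI[of _ "[r, s, t, u]"]) (use assms in simp)
  then show ?thesis by (simp add: obst_def)
qed

lemma obst_V:
  assumes "a \<in> K" "b \<in> K" "c \<in> K" "d \<in> K" "e \<in> K" "r \<in> F" "s \<in> F" "t \<in> F" "u \<in> F"
    "a \<in> r" "b \<in> r" "c \<notin> r" "d \<notin> r" "e \<notin> r"
    "a \<in> s" "b \<in> s" "c \<in> s" "d \<in> s" "e \<notin> s"
    "a \<notin> t" "b \<notin> t" "c \<in> t" "d \<in> t" "e \<notin> t"
    "a \<in> u" "b \<notin> u" "c \<notin> u" "d \<in> u" "e \<in> u"
  shows "obst K F"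
proof -
  have "has_pattern K F P_V" unfolding has_pattern_def P_V_def
    by (rule exI[of _ "[a, b, c, d, e]"], rule exI[of _ "[r, s, t, u]"]) (use assms in simp)
  then show ?thesis by (simp add: obst_def)
qed

lemma obst_comp:
  assumes "a \<in> K" "b \<in> K" "c \<in> K" "d \<in> K" "e \<in> K" "r \<in> F" "s \<in> F" "t \<in> F" "u \<in> F"
    "a \<in> r" "b \<in> r" "c \<notin> r" "d \<notin> r" "e \<notin> r"
    "a \<in> s" "b \<notin> s" "c \<notin> s" "d \<in> s" "e \<in> s"
    "a \<notin> t" "b \<notin> t" "c \<in> t" "d \<in> t" "e \<notin> t"
    "a \<notin> u" "b \<in> u" "c \<in> u" "d \<notin> u" "e \<in> u"
  shows "obst K F"
proof -
  have "has_pattern K F P_comp" unfolding has_pattern_def P_comp_def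
    by (rule exI[of _ "[a, b, c, d, e]"], rule exI[of _ "[r, s, t, u]"]) (use assms in simp)
  then show ?thesis by (simp add: obst_def)
qed

lemma obst_pathI:
  assumes "2 \<le> n" "path_rows K F n c \<rho>" "A \<in> F" "B \<in> F" "z \<in> K" "z \<in> A" "z \<in> B" "\<And>i. i < n \<Longrightarrow> z \<notin> \<rho> i"
    "\<And>j. 0 < j \<Longrightarrow> j < n \<Longrightarrow> c j \<in> A \<and> c j \<in> B" "c 0 \<notin> B" "c n \<notin> A"
  shows "obst K F"
  using assms unfolding obst_def obst_path_def by blast

lemma all_small_nat:
  "(\<forall>i<2. P i) \<longleftrightarrow> P 0 \<and> P (1::nat)" "(\<forall>i\<le>2. P i) \<longleftrightarrow> P 0 \<and> P 1 \<and> P (2::nat)"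
  "(\<forall>i<3. P i) \<longleftrightarrow> P 0 \<and> P 1 \<and> P (2::nat)"
proof -
  have "i < 2 \<longleftrightarrow> i = 0 \<or> i = 1" "i \<le> 2 \<longleftrightarrow> i = 0 \<or> i = 1 \<or> i = 2"
    "i < 3 \<longleftrightarrow> i = 0 \<or> i = 1 \<or> i = 2" for i :: nat by auto
  then show "(\<forall>i<2. P i) \<longleftrightarrow> P 0 \<and> P (1::nat)" "(\<forall>i\<le>2. P i) \<longleftrightarrow> P 0 \<and> P 1 \<and> P (2::nat)"
    "(\<forall>i<3. P i) \<longleftrightarrow> P 0 \<and> P 1 \<and> P (2::nat)" by metis+
qed

text \<open>This is \<open>M_III 3\<close>: a staircase on the columns \<open>a, m, b\<close> with
  rows \<open>r\<close>, \<open>s\<close>, where \<open>t\<close> plays both long rows and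
  \<open>c\<close> is the last column.\<close>

lemma obst_III3:
  assumes "a \<in> K" "b \<in> K" "c \<in> K" "m \<in> K" "r \<in> F" "s \<in> F" "t \<in> F"
    "a \<in> r" "b \<notin> r" "c \<notin> r" "m \<in> r" "a \<notin> s" "b \<in> s" "c \<notin> s" "m \<in> s" "a \<notin> t" "b \<notin> t" "c \<in> t" "m \<in> t"
  shows "obst K F"
proof (rule obst_pathI[of 2 K F "\<lambda>i. [a, m, b] ! i" "\<lambda>i. [r, s] ! i" t t c])
  show "path_rows K F 2 (\<lambda>i. [a, m, b] ! i) (\<lambda>i. [r, s] ! i)"
    unfolding path_rows_def all_small_nat using assms by simp
  show "c \<notin> [r, s] ! i" if "i < 2" for i using that assms by (auto simp: less_2_cases_iff)
  show "[a, m, b] ! j \<in> t \<and> [a, m, b] ! j \<in> t" if "0 < j" "j < 2" for j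
    using that assms by (auto simp: less_2_cases_iff)
qed (use assms in auto)

lemma obst_cycle3:
  assumes "a \<in> K" "b \<in> K" "c \<in> K" "r \<in> F" "s \<in> F" "t \<in> F"
    "a \<in> r" "b \<in> r" "c \<notin> r" "a \<notin> s" "b \<in> s" "c \<in> s" "a \<in> t" "b \<notin> t" "c \<in> t"
    and z: "z \<in> K \<and> z \<notin> r \<and> z \<notin> s \<and> z \<notin> t \<or> f \<in> F \<and> a \<in> f \<and> b \<in> f \<and> c \<in> f"
  shows "obst K F"
proof -
  have cr: "cycle_rows K F 3 (\<lambda>i. [a, b, c] ! i) (\<lambda>i. [r, s, t] ! i)"
    unfolding cycle_rows_def all_small_nat using assms by simp
  from z have "obst_cycle K F \<or> obst_cycle_full K F"
  proof
    assume "z \<in> K \<and> z \<notin> r \<and> z \<notin> s \<and> z \<notin> t"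
    then have "z \<in> K" "\<forall>i<3. z \<notin> [r, s, t] ! i" by (auto simp: all_small_nat)
    with cr show ?thesis unfolding obst_cycle_def by (intro disjI1 exI conjI) (assumption, rule bexI)
  next
    assume "f \<in> F \<and> a \<in> f \<and> b \<in> f \<and> c \<in> f"
    then have "f \<in> F" "\<forall>i<3. [a, b, c] ! i \<in> f" by (auto simp: all_small_nat)
    with cr show ?thesis unfolding obst_cycle_full_def by (intro disjI2 exI conjI) (assumption, rule bexI)
  qed
  then show ?thesis unfolding obst_def by blast
qed

section \<open>Families of at most three sets\<close>

lemma circ_good_triple_aux:
  assumes no: "\<not> obst K F" and F: "A \<in> F" "B \<in> F" "C \<in> F"
    and K: "A \<subseteq> K" "B \<subseteq> K" "C \<subseteq> K" and BC: "B \<inter> C \<subseteq> A"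
  shows "\<exists>f. circ_good K {A, B, C} f"
proof -
  \<comment> \<open>If all four alternatives fail, each set has a private element and all three
    share one, which is \<open>M_III 3\<close>. In each remaining case some Venn region is empty,
    and the others can be numbered along a line.\<close>
  have "B \<inter> C = {} \<or> A \<subseteq> B \<union> C \<or> B \<subseteq> A \<or> C \<subseteq> A"
  proof (rule ccontr)
    assume "\<not> ?thesis"
    then obtain m a b c where "m \<in> B" "m \<in> C" "a \<in> A" "a \<notin> B" "a \<notin> C" "b \<in> B" "b \<notin> A" "c \<in> C" "c \<notin> A" by blast
    then have "obst K F" using BC K F by (intro obst_III3[of a K b c m A F B C]) blast+
    with no show False by simp
  qed
  have arcs: "circ_good K {A, B, C} f"
    if "\<And>u v. u \<in> K \<Longrightarrow> v \<in> K \<Longrightarrow> f u = f v \<Longrightarrow> twins {A, B, C} u v"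
      "is_arc K f A" "is_arc K f B" "is_arc K f C" "is_arc K f (A \<inter> B)" "is_arc K f (A \<inter> C)" "is_arc K f (B \<inter> C)" for f
    by (rule circ_goodI[OF that(1)]) (use that in \<open>auto simp: Int_commute\<close>)
  consider "B \<inter> C = {}" | "A \<subseteq> B \<union> C" | "B \<subseteq> A" | "C \<subseteq> A"
    using \<open>B \<inter> C = {} \<or> A \<subseteq> B \<union> C \<or> B \<subseteq> A \<or> C \<subseteq> A\<close> by blast
  then show ?thesis
  proof cases
    case 1
    let ?f = "\<lambda>v. if v \<in> A then if v \<in> B then 1 else if v \<in> C then 3 else 2 else if v \<in> B then 0 else if v \<in> C then 4 else 5"
    have "circ_good K {A, B, C} ?f"
    proof (rule arcs)
      show "is_arc K ?f A" by (rule is_arc_interval[of _ _ 1 _ 3]) auto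
      show "is_arc K ?f B" by (rule is_arc_interval[of _ _ 0 _ 1]) auto
      show "is_arc K ?f C" by (rule is_arc_interval[of _ _ 3 _ 4]) (use 1 in auto)
      show "is_arc K ?f (A \<inter> B)" by (rule is_arc_interval[of _ _ 1 _ 1]) auto
      show "is_arc K ?f (A \<inter> C)" by (rule is_arc_interval[of _ _ 3 _ 3]) (use 1 in auto)
      show "is_arc K ?f (B \<inter> C)" by (rule is_arc_interval[of _ _ 6 _ 6]) (use 1 in auto)
    qed (use 1 in \<open>auto simp: twins_def split: if_splits\<close>)
    then show ?thesis by blast
  next
    case 2
    let ?f = "\<lambda>v. if v \<in> A then if v \<in> B then if v \<in> C then 2 else 1 else 3 else if v \<in> B then 0 else if v \<in> C then 4 else 5"
    have "circ_good K {A, B, C} ?f"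
    proof (rule arcs)
      show "is_arc K ?f A" by (rule is_arc_interval[of _ _ 1 _ 3]) auto
      show "is_arc K ?f B" by (rule is_arc_interval[of _ _ 0 _ 2]) auto
      show "is_arc K ?f C" by (rule is_arc_interval[of _ _ 2 _ 4]) (use 2 BC in auto)
      show "is_arc K ?f (A \<inter> B)" by (rule is_arc_interval[of _ _ 1 _ 2]) auto
      show "is_arc K ?f (A \<inter> C)" by (rule is_arc_interval[of _ _ 2 _ 3]) (use 2 in auto)
      show "is_arc K ?f (B \<inter> C)" by (rule is_arc_interval[of _ _ 2 _ 2]) (use 2 BC in auto)
    qed (use 2 BC in \<open>auto simp: twins_def split: if_splits\<close>)
    then show ?thesis by blast
  next
    case 3
    let ?f = "\<lambda>v. if v \<in> A then if v \<in> B then if v \<in> C then 2 else 1 else if v \<in> C then 3 else 0 else if v \<in> C then 4 else 5"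
    have "circ_good K {A, B, C} ?f"
    proof (rule arcs)
      show "is_arc K ?f A" by (rule is_arc_interval[of _ _ 0 _ 3]) auto
      show "is_arc K ?f B" by (rule is_arc_interval[of _ _ 1 _ 2]) (use 3 in auto)
      show "is_arc K ?f C" by (rule is_arc_interval[of _ _ 2 _ 4]) (use 3 BC in auto)
      show "is_arc K ?f (A \<inter> B)" by (rule is_arc_interval[of _ _ 1 _ 2]) (use 3 in auto)
      show "is_arc K ?f (A \<inter> C)" by (rule is_arc_interval[of _ _ 2 _ 3]) (use 3 in auto)
      show "is_arc K ?f (B \<inter> C)" by (rule is_arc_interval[of _ _ 2 _ 2]) (use 3 BC in auto)
    qed (use 3 BC in \<open>auto simp: twins_def split: if_splits\<close>)
    then show ?thesis by blast
  next
    case 4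
    let ?f = "\<lambda>v. if v \<in> A then if v \<in> B then if v \<in> C then 2 else 3 else if v \<in> C then 1 else 0 else if v \<in> B then 4 else 5"
    have "circ_good K {A, B, C} ?f"
    proof (rule arcs)
      show "is_arc K ?f A" by (rule is_arc_interval[of _ _ 0 _ 3]) auto
      show "is_arc K ?f B" by (rule is_arc_interval[of _ _ 2 _ 4]) (use 4 in auto)
      show "is_arc K ?f C" by (rule is_arc_interval[of _ _ 1 _ 2]) (use 4 BC in auto)
      show "is_arc K ?f (A \<inter> B)" by (rule is_arc_interval[of _ _ 2 _ 3]) (use 4 in auto)
      show "is_arc K ?f (A \<inter> C)" by (rule is_arc_interval[of _ _ 1 _ 2]) (use 4 in auto)
      show "is_arc K ?f (B \<inter> C)" by (rule is_arc_interval[of _ _ 2 _ 2]) (use 4 BC in auto)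
    qed (use 4 BC in \<open>auto simp: twins_def split: if_splits\<close>)
    then show ?thesis by blast
  qed
qed

text \<open>If no pairwise intersection lies in the third set, \<open>M_VI\<close> excludes a common
  element and M_I*(3) excludes an uncovered one. The six remaining regions go around the circle,
  each pairwise intersection between the two private parts.\<close>

lemma circ_good_triple:
  assumes no: "\<not> obst K F" and F: "A \<in> F" "B \<in> F" "C \<in> F" and K: "A \<subseteq> K" "B \<subseteq> K" "C \<subseteq> K"
  shows "\<exists>f. circ_good K {A, B, C} f"
proof (cases "B \<inter> C \<subseteq> A \<or> A \<inter> C \<subseteq> B \<or> A \<inter> B \<subseteq> C")
  case True
  have "{B, A, C} = {A, B, C}" "{C, A, B} = {A, B, C}" by auto
  then show ?thesis
    using True circ_good_triple_aux[OF no F K] circ_good_triple_aux[OF no F(2,1,3) K(2,1,3)]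
      circ_good_triple_aux[OF no F(3,1,2) K(3,1,2)] by metis
next
  case False
  then obtain a b c where abc: "a \<in> B" "a \<in> C" "a \<notin> A" "b \<in> A" "b \<in> C" "b \<notin> B" "c \<in> A" "c \<in> B" "c \<notin> C" by blast
  have 1: "A \<inter> B \<inter> C = {}"
  proof (rule ccontr)
    assume "A \<inter> B \<inter> C \<noteq> {}"
    then obtain d where "d \<in> A" "d \<in> B" "d \<in> C" by blast
    then have "obst K F" using abc F K by (intro obst_VI[of b K c a d A F B C]) blast+
    with no show False by simp
  qed
  have 2: "A \<union> B \<union> C = K"
  proof (rule ccontr)
    assume "A \<union> B \<union> C \<noteq> K"
    then obtain z where "z \<in> K \<and> z \<notin> A \<and> z \<notin> B \<and> z \<notin> C" using K by blast
    then have "obst K F" using abc F K by (intro obst_cycle3[of b K c a A F B C z]) blast+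
    with no show False by simp
  qed
  let ?f = "\<lambda>v. if v \<in> A then if v \<in> B then 1 else if v \<in> C then 5 else 0 else if v \<in> B then if v \<in> C then 3 else 2 else 4"
  have "circ_good K {A, B, C} ?f"
  proof (rule circ_goodI)
    have "is_arc K ?f A" by (rule is_arc_cointerval[of _ _ 2 _ 4]) auto
    moreover have "is_arc K ?f B" by (rule is_arc_interval[of _ _ 1 _ 3]) auto
    moreover have "is_arc K ?f C" by (rule is_arc_interval[of _ _ 3 _ 5]) (use 1 2 in auto)
    moreover have "is_arc K ?f (A \<inter> B)" by (rule is_arc_interval[of _ _ 1 _ 1]) auto
    moreover have "is_arc K ?f (A \<inter> C)" by (rule is_arc_interval[of _ _ 5 _ 5]) (use 1 in auto)
    moreover have "is_arc K ?f (B \<inter> C)" by (rule is_arc_interval[of _ _ 3 _ 3]) (use 1 in auto)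
    ultimately show "is_arc K ?f (r \<inter> s)" if "r \<in> {A, B, C}" "s \<in> {A, B, C}" for r s
      using that by (auto simp: Int_commute)
  qed (use 1 2 in \<open>auto simp: twins_def split: if_splits\<close>)
  then show ?thesis by blast
qed

section \<open>Shortest walks through rows\<close>

inductive_set reach :: "'v set set \<Rightarrow> 'v set \<Rightarrow> 'v set" for R A where
  base: "a \<in> A \<Longrightarrow> a \<in> reach R A"
| step: "u \<in> reach R A \<Longrightarrow> r \<in> R \<Longrightarrow> u \<in> r \<Longrightarrow> v \<in> r \<Longrightarrow> v \<in> reach R A"

definition walk :: "'v set set \<Rightarrow> 'v set \<Rightarrow> 'v set \<Rightarrow> nat \<Rightarrow> (nat \<Rightarrow> 'v) \<Rightarrow> (nat \<Rightarrow> 'v set) \<Rightarrow> bool" where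
  "walk R A B m c r \<longleftrightarrow> c 0 \<in> A \<and> c m \<in> B \<and> (\<forall>i<m. r i \<in> R \<and> c i \<in> r i \<and> c (Suc i) \<in> r i)"

text \<open>These are the consequences of minimal length that later arguments use, so minimality is
  exploited only once. The two disjointness conditions also concern elements of \<open>A\<close> and
  \<open>B\<close> that are not on the walk.\<close>

definition geodesic :: "'v set set \<Rightarrow> 'v set \<Rightarrow> 'v set \<Rightarrow> nat \<Rightarrow> (nat \<Rightarrow> 'v) \<Rightarrow> (nat \<Rightarrow> 'v set) \<Rightarrow> bool" where
  "geodesic R A B m c r \<longleftrightarrow> walk R A B m c r \<and>
     (\<forall>i<m. \<forall>j\<le>m. c j \<in> r i \<longleftrightarrow> j = i \<or> j = Suc i) \<and>
     (\<forall>i<m. 0 < i \<longrightarrow> A \<inter> r i = {}) \<and> (\<forall>i<m. Suc i < m \<longrightarrow> B \<inter> r i = {}) \<and>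
     (\<forall>i\<le>m. c i \<in> A \<longrightarrow> i = 0) \<and> (\<forall>i\<le>m. c i \<in> B \<longrightarrow> i = m)"

lemma reach_walk: "v \<in> reach R A \<Longrightarrow> \<exists>m c r. walk R A {v} m c r"
proof (induction rule: reach.induct)
  case (base a)
  then have "walk R A {a} 0 (\<lambda>_. a) (\<lambda>_. {})" by (simp add: walk_def)
  then show ?case by blast
next
  case (step u r v)
  then obtain m c \<rho> where w: "walk R A {u} m c \<rho>" by blast
  have "walk R A {v} (Suc m) (c(Suc m := v)) (\<rho>(m := r))"
    using w step.hyps unfolding walk_def by (auto simp: less_Suc_eq)
  then show ?case by blast
qed

text \<open>The piece from \<open>c j\<close> to \<open>c k\<close> is replaced by one step through
  \<open>r i\<close>, which saves \<open>k - j - 1\<close> steps.\<close>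

lemma walk_skip:
  assumes w: "walk R A B m c r" and ij: "i < m" "j < k" "k \<le> m" "c j \<in> r i" "c k \<in> r i"
  shows "walk R A B (m - (k - j - 1)) (\<lambda>t. if t \<le> j then c t else c (t + (k - j - 1)))
     (\<lambda>t. if t < j then r t else if t = j then r i else r (t + (k - j - 1)))"
  unfolding walk_def
proof (intro conjI allI impI)
  let ?c = "\<lambda>t. if t \<le> j then c t else c (t + (k - j - 1))"
  let ?r = "\<lambda>t. if t < j then r t else if t = j then r i else r (t + (k - j - 1))"
  show "?c 0 \<in> A" using w by (simp add: walk_def)
  show "?c (m - (k - j - 1)) \<in> B" using w ij by (auto simp: walk_def)
  fix t assume t: "t < m - (k - j - 1)"
  consider "t < j" | "t = j" | "t > j" by linarith
  then have "?r t \<in> R \<and> ?c t \<in> ?r t \<and> ?c (Suc t) \<in> ?r t"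
  proof cases
    case 1 then show ?thesis using w ij t by (auto simp: walk_def)
  next
    case 2
    then have "?c (Suc t) = c k" using ij by simp
    with 2 show ?thesis using w ij t by (auto simp: walk_def)
  next
    case 3
    have "t + (k - j - 1) < m" using t by linarith
    with 3 show ?thesis using w ij t by (auto simp: walk_def)
  qed
  then show "?r t \<in> R" "?c t \<in> ?r t" "?c (Suc t) \<in> ?r t" by blast+
qed

lemma walk_drop: "walk R A B m c r \<Longrightarrow> i \<le> m \<Longrightarrow> c i \<in> A \<Longrightarrow> walk R A B (m - i) (\<lambda>t. c (t + i)) (\<lambda>t. r (t + i))"
  unfolding walk_def by (auto simp: less_diff_conv)

lemma walk_take: "walk R A B m c r \<Longrightarrow> i \<le> m \<Longrightarrow> c i \<in> B \<Longrightarrow> walk R A B i c r"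
  unfolding walk_def by auto

text \<open>Every failure of a required property offers a shorter walk: a step through a row with
  two distant vertices, a later start in \<open>A\<close>, or an earlier end in
  \<open>B\<close>.\<close>

lemma geodesic_exists:
  assumes "b \<in> B" "b \<in> reach R A"
  shows "\<exists>m c r. geodesic R A B m c r"
proof -
  let ?P = "\<lambda>m. \<exists>c r. walk R A B m c r"
  from reach_walk[OF assms(2)] obtain m0 c0 r0 where "walk R A {b} m0 c0 r0" by blast
  then have "?P m0" using assms(1) unfolding walk_def by blast
  define m where "m = (LEAST m. ?P m)"
  have "?P m" unfolding m_def by (rule LeastI) fact
  then obtain c r where w: "walk R A B m c r" by blast
  have min: "m \<le> m'" if "walk R A B m' c' r'" for m' c' r'
    unfolding m_def using that by (intro Least_le) blast
  have wr: "r i \<in> R" "c i \<in> r i" "c (Suc i) \<in> r i" if "i < m" for i using w that by (auto simp: walk_def)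
  have sk: "k = Suc j" if "i < m" "j < k" "k \<le> m" "c j \<in> r i" "c k \<in> r i" for i j k
    using min[OF walk_skip[OF w that]] that by linarith
  have mem: "c j \<in> r i \<longleftrightarrow> j = i \<or> j = Suc i" if "i < m" "j \<le> m" for i j
  proof
    assume *: "c j \<in> r i"
    consider "j < i" | "j = i" | "j = Suc i" | "j > Suc i" by linarith
    then show "j = i \<or> j = Suc i"
    proof cases
      case 1
      then show ?thesis using sk[of i j "Suc i"] * wr that by auto
    next
      case 4
      then show ?thesis using sk[of i i j] * wr that by auto
    qed auto
  qed (use wr that in auto)
  have cA: "i = 0" if "i \<le> m" "c i \<in> A" for i using min[OF walk_drop[OF w that]] that by linarith
  have cB: "i = m" if "i \<le> m" "c i \<in> B" for i using min[OF walk_take[OF w that]] that by linarith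
  have "A \<inter> r i = {}" if "i < m" "0 < i" for i
  proof (rule ccontr)
    assume "A \<inter> r i \<noteq> {}"
    then obtain a where a: "a \<in> A" "a \<in> r i" by blast
    have "walk R A B (m - i) (\<lambda>t. if t = 0 then a else c (t + i)) (\<lambda>t. r (t + i))"
      using w a that unfolding walk_def by (auto simp: less_diff_conv)
    from min[OF this] that show False by linarith
  qed
  moreover have "B \<inter> r i = {}" if "i < m" "Suc i < m" for i
  proof (rule ccontr)
    assume "B \<inter> r i \<noteq> {}"
    then obtain b where b: "b \<in> B" "b \<in> r i" by blast
    have "walk R A B (Suc i) (\<lambda>t. if t = Suc i then b else c t) r"
      using w b that unfolding walk_def by (auto simp: less_Suc_eq)
    from min[OF this] that show False by linarith
  qed
  ultimately have "geodesic R A B m c r"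
    unfolding geodesic_def using w mem cA cB by blast
  then show ?thesis by blast
qed

lemma geodesicD:
  assumes "geodesic R A B m c r"
  shows "c 0 \<in> A" "c m \<in> B" "\<And>i. i < m \<Longrightarrow> r i \<in> R"
    "\<And>i j. i < m \<Longrightarrow> j \<le> m \<Longrightarrow> c j \<in> r i \<longleftrightarrow> j = i \<or> j = Suc i"
    "\<And>i. i < m \<Longrightarrow> 0 < i \<Longrightarrow> A \<inter> r i = {}" "\<And>i. i < m \<Longrightarrow> Suc i < m \<Longrightarrow> B \<inter> r i = {}"
    "\<And>i. i \<le> m \<Longrightarrow> 0 < i \<Longrightarrow> c i \<notin> A" "\<And>i. i < m \<Longrightarrow> c i \<notin> B"
  using assms unfolding geodesic_def walk_def by (auto dest: less_imp_le)

lemma reach_trans: "u \<in> reach R A \<Longrightarrow> A \<subseteq> reach R B \<Longrightarrow> u \<in> reach R B"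
  by (induction rule: reach.induct) (auto intro: reach.step)

lemma geodesic_reach:
  assumes g: "geodesic R A B m c r" and "i \<le> m"
  shows "c i \<in> reach R A"
  using assms(2)
proof (induction i)
  case 0 then show ?case using geodesicD(1)[OF g] by (auto intro: reach.base)
next
  case (Suc i)
  then show ?case using geodesicD(3)[OF g, of i] geodesicD(4)[OF g, of i i] geodesicD(4)[OF g, of i "Suc i"]
    by (auto intro: reach.step[of "c i"])
qed

lemma reach_row: "u \<in> reach R A \<Longrightarrow> r \<in> R \<Longrightarrow> u \<in> r \<Longrightarrow> r \<subseteq> reach R A"
  by (auto intro: reach.step)

lemma reach_Un: "reach R A \<subseteq> A \<union> \<Union>R"
proof
  fix u assume "u \<in> reach R A" then show "u \<in> A \<union> \<Union>R" by (induction rule: reach.induct) auto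
qed

lemma geodesic_in:
  assumes g: "geodesic R A B m c r" and "A \<subseteq> K" "\<And>r. r \<in> R \<Longrightarrow> r \<subseteq> K" "i \<le> m"
  shows "c i \<in> K"
  using geodesic_reach[OF g assms(4)] reach_Un[of R A] assms(2,3) by blast

lemma geodesic_path_rows:
  assumes g: "geodesic R A B m c r" and "A \<subseteq> K" "\<And>r. r \<in> R \<Longrightarrow> r \<subseteq> K" "R \<subseteq> F"
  shows "path_rows K F m c r"
  unfolding path_rows_def using geodesic_in[OF assms(1,2,3)] geodesicD[OF g] assms(4) by auto

text \<open>The only twins on a shortest walk are the two ends of a walk with one step.\<close>

lemma geodesic_twins:
  assumes g: "geodesic R A B m c r" and ij: "i < j" "j \<le> m" and t: "twins R (c i) (c j)"
  shows "i = 0 \<and> m = 1"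
proof (rule ccontr)
  assume n: "\<not> ?thesis"
  have t: "c i \<in> r k \<longleftrightarrow> c j \<in> r k" if "k < m" for k using t geodesicD(3)[OF g that] by (auto simp: twins_def)
  show False
  proof (cases i)
    case 0
    with t[of 0] geodesicD(4)[OF g, of 0 i] geodesicD(4)[OF g, of 0 j] ij have "j = 1" by auto
    then have "1 < m" using n 0 ij by auto
    with t[of 1] geodesicD(4)[OF g, of 1 i] geodesicD(4)[OF g, of 1 j] 0 \<open>j = 1\<close> show False by auto
  next
    case (Suc k)
    with t[of k] geodesicD(4)[OF g, of k i] geodesicD(4)[OF g, of k j] ij show False by auto
  qed
qed

section \<open>Assembling staircases and closing them to cycles\<close>

lemma path_rows_prepend:
  assumes "path_rows K F m c r" "x \<in> K" "T \<in> F" "x \<in> T" "\<And>j. j \<le> m \<Longrightarrow> c j \<in> T \<longleftrightarrow> j = 0" "\<And>i. i < m \<Longrightarrow> x \<notin> r i"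
  shows "path_rows K F (Suc m) (case_nat x c) (case_nat T r)"
  using assms unfolding path_rows_def by (auto simp: le_Suc_eq split: nat.splits)

lemma path_rows_rev:
  assumes "path_rows K F m c r"
  shows "path_rows K F m (\<lambda>i. c (m - i)) (\<lambda>i. r (m - Suc i))"
  unfolding path_rows_def
proof (intro conjI allI impI)
  fix i j assume ij: "i < m" "j \<le> m"
  then have "c (m - j) \<in> r (m - Suc i) \<longleftrightarrow> m - j = m - Suc i \<or> m - j = Suc (m - Suc i)"
    using assms unfolding path_rows_def by auto
  then show "c (m - j) \<in> r (m - Suc i) \<longleftrightarrow> j = i \<or> j = Suc i" using ij by auto
qed (use assms in \<open>auto simp: path_rows_def\<close>)

lemma path_rows_join:
  assumes p1: "path_rows K F n1 c1 r1" and p2: "path_rows K F n2 c2 r2" and e: "c1 n1 = c2 0"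
    and x1: "\<And>i j. i < n1 \<Longrightarrow> 0 < j \<Longrightarrow> j \<le> n2 \<Longrightarrow> c2 j \<notin> r1 i"
    and x2: "\<And>i j. i < n2 \<Longrightarrow> j < n1 \<Longrightarrow> c1 j \<notin> r2 i"
  shows "path_rows K F (n1 + n2) (\<lambda>i. if i \<le> n1 then c1 i else c2 (i - n1)) (\<lambda>i. if i < n1 then r1 i else r2 (i - n1))"
  unfolding path_rows_def
proof (intro conjI allI impI)
  fix i j assume i: "i < n1 + n2" and j: "j \<le> n1 + n2"
  consider "i < n1" "j \<le> n1" | "i < n1" "j > n1" | "i \<ge> n1" "j < n1" | "i \<ge> n1" "j = n1" | "i \<ge> n1" "j > n1" by linarith
  then show "(if j \<le> n1 then c1 j else c2 (j - n1)) \<in> (if i < n1 then r1 i else r2 (i - n1)) \<longleftrightarrow> j = i \<or> j = Suc i"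
  proof cases
    case 1 then show ?thesis using p1 by (auto simp: path_rows_def)
  next
    case 2 then show ?thesis using x1[of i "j - n1"] j by auto
  next
    case 3 then show ?thesis using x2[of "i - n1" j] i by auto
  next
    case 4
    then have "c2 0 \<in> r2 (i - n1) \<longleftrightarrow> 0 = i - n1 \<or> 0 = Suc (i - n1)" using p2 i unfolding path_rows_def by auto
    with 4 e show ?thesis by auto
  next
    case 5
    then have "c2 (j - n1) \<in> r2 (i - n1) \<longleftrightarrow> j - n1 = i - n1 \<or> j - n1 = Suc (i - n1)"
      using p2 i j unfolding path_rows_def by auto
    with 5 show ?thesis by auto
  qed
qed (use p1 p2 in \<open>auto simp: path_rows_def\<close>)

lemma path_rows_cycle:
  assumes p: "path_rows K F m c r" and m: "2 \<le> m" and T: "T \<in> F" "\<And>j. j \<le> m \<Longrightarrow> c j \<in> T \<longleftrightarrow> j = 0 \<or> j = m"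
  shows "cycle_rows K F (Suc m) c (\<lambda>i. if i < m then r i else T)"
  unfolding cycle_rows_def
proof (intro conjI allI impI)
  fix i j assume ij: "i < Suc m" "j < Suc m"
  show "c j \<in> (if i < m then r i else T) \<longleftrightarrow> j = i \<or> j = Suc i mod Suc m"
  proof (cases "i < m")
    case True then show ?thesis using p ij by (auto simp: path_rows_def)
  next
    case False
    then have "i = m" using ij by simp
    then show ?thesis using T(2)[of j] ij by auto
  qed
qed (use p m T in \<open>auto simp: path_rows_def\<close>)

lemma obst_cycle_pathI:
  assumes p: "path_rows K F m c r" and m: "2 \<le> m" and T: "T \<in> F" "\<And>j. j \<le> m \<Longrightarrow> c j \<in> T \<longleftrightarrow> j = 0 \<or> j = m"
    and z: "z \<in> K \<and> z \<notin> T \<and> (\<forall>i<m. z \<notin> r i) \<or> f \<in> F \<and> (\<forall>j\<le>m. c j \<in> f)"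
  shows "obst K F"
proof -
  note c = path_rows_cycle[OF p m T]
  from z have "obst_cycle K F \<or> obst_cycle_full K F"
  proof
    assume "z \<in> K \<and> z \<notin> T \<and> (\<forall>i<m. z \<notin> r i)"
    then have "z \<in> K" "\<forall>i<Suc m. z \<notin> (if i < m then r i else T)" by auto
    with c show ?thesis unfolding obst_cycle_def by (intro disjI1 exI conjI) (assumption, rule bexI)
  next
    assume "f \<in> F \<and> (\<forall>j\<le>m. c j \<in> f)"
    then have "f \<in> F" "\<forall>j<Suc m. c j \<in> f" by auto
    with c show ?thesis unfolding obst_cycle_full_def by (intro disjI2 exI conjI) (assumption, rule bexI)
  qed
  then show ?thesis unfolding obst_def by blast
qed

section \<open>Walks in overlap-connected families and the intersection of the two removed
  sets\<close>

lemma reach_conn: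
  assumes "ov_conn F" "a \<in> \<Union>F" shows "\<Union>F \<subseteq> reach F {a}"
proof -
  let ?Q = "{r\<in>F. r \<subseteq> reach F {a}}"
  from assms(2) obtain r where r: "r \<in> F" "a \<in> r" by blast
  then have "r \<in> ?Q" using reach_row[of a F "{a}" r] by (auto intro: reach.base)
  have "?Q = F"
  proof (rule ccontr)
    assume "?Q \<noteq> F"
    then obtain q b where qb: "q \<in> ?Q" "b \<in> F - ?Q" "overlap q b"
      using ov_connD[OF assms(1), of ?Q] \<open>r \<in> ?Q\<close> by blast
    then obtain u where u: "u \<in> q" "u \<in> b" by (auto simp: overlap_def)
    then have "u \<in> reach F {a}" using qb(1) by blast
    then have "b \<subseteq> reach F {a}" using reach_row u qb(2) by (metis Diff_iff)
    with qb show False by blast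
  qed
  then show ?thesis by blast
qed

text \<open>The alternation puts \<open>K - S\<close> on one side of the chord from \<open>p\<close>
  to \<open>q\<close> and \<open>K - T\<close> on the other, so \<open>S\<close> and
  \<open>T\<close> cover \<open>K\<close>. As \<open>F0\<close> is connected and reaches outside
  both sets, there is a shortest walk of its rows from outside \<open>S\<close> to outside
  \<open>T\<close>; its inner vertices lie in \<open>S \<inter> T\<close>.\<close>

lemma inter_arc:
  assumes no: "\<not> obst K F" and F0: "F0 \<subseteq> F" "ov_conn F0" and ST: "S \<in> F" "T \<in> F" "S \<subseteq> K" "T \<subseteq> K"
    and sub: "\<And>r. r \<in> F0 \<Longrightarrow> r \<subseteq> K \<and> r \<noteq> K"
    and ovS: "rS \<in> F0" "overlap rS S" and ovT: "rT \<in> F0" "overlap rT T"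
    and tw: "\<And>u v. u \<in> K \<Longrightarrow> v \<in> K \<Longrightarrow> j u = j v \<Longrightarrow> twins {S, T} u v"
    and arcS: "is_arc K j S" and arcT: "is_arc K j T" and arc: "\<And>r. r \<in> F0 \<Longrightarrow> is_arc K j r"
    and arcrS: "\<And>r. r \<in> F0 \<Longrightarrow> is_arc K j (r \<inter> S)" and arcrT: "\<And>r. r \<in> F0 \<Longrightarrow> is_arc K j (r \<inter> T)"
    and K: "p \<in> K" "a \<in> K" "q \<in> K" "b \<in> K" and c: "cyc j p a q" "cyc j p q b"
    and m: "p \<in> S" "p \<in> T" "q \<in> S" "q \<in> T" "b \<notin> S \<or> b \<notin> T" "a \<notin> S"
  shows False
proof -
  have "b \<in> S" using is_arcD[OF arcS c] m K by blast
  then have bT: "b \<notin> T" using m by blast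
  have neq: "j u \<noteq> j v" if "u \<in> K" "v \<in> K" "(u \<in> S) \<noteq> (v \<in> S) \<or> (u \<in> T) \<noteq> (v \<in> T)" for u v
    using tw[OF that(1,2)] that(3) unfolding twins_def by blast
  have jpq: "j p \<noteq> j q" using cyc_neq[OF c(1)] by simp
  have nS: "cyc j p w q \<and> w \<in> T" if "w \<in> K" "w \<notin> S" for w
  proof -
    have "cyc j p w q \<or> cyc j q w p" using cyc_total[of j p w q] neq[of w p] neq[of w q] that K m jpq by metis
    moreover have "\<not> cyc j q w p"
      using is_arcD[OF arcS c(1), of w] that K m cyc_rotate by metis
    ultimately have "cyc j p w q" by blast
    then show ?thesis using is_arcD[OF arcT _ c(2), of w] that K m bT by blast
  qed
  have nT: "cyc j q w p \<and> w \<in> S" if "w \<in> K" "w \<notin> T" for w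
  proof -
    have "cyc j p w q \<or> cyc j q w p" using cyc_total[of j p w q] neq[of w p] neq[of w q] that K m jpq by metis
    moreover have "\<not> cyc j p w q"
      using is_arcD[OF arcT _ c(2), of w] that K m bT by blast
    ultimately have "cyc j q w p" by blast
    moreover from this have "cyc j p q w" by (simp add: cyc_rotate[of j p])
    ultimately show ?thesis using is_arcD[OF arcS c(1), of w] that K m by blast
  qed
  obtain e1 e2 where e: "e1 \<in> rS" "e1 \<notin> S" "e2 \<in> rT" "e2 \<notin> T" using ovS ovT by (auto simp: overlap_def)
  have eK: "e1 \<in> K" "e2 \<in> K" using e sub ovS ovT by blast+
  have "e2 \<in> reach F0 {e1}" using reach_conn[OF F0(2), of e1] e ovS ovT by blast
  then have "e2 \<in> reach F0 (K - S)" by (rule reach_trans) (use e eK in \<open>auto intro: reach.base\<close>)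
  with geodesic_exists[of e2 "K - T" F0 "K - S"] e eK obtain n d r where g: "geodesic F0 (K - S) (K - T) n d r" by blast
  note gD = geodesicD[OF g]
  have dK: "d i \<in> K" if "i \<le> n" for i using geodesic_in[OF g _ _ that, of K] sub by blast
  have d0: "d 0 \<in> K" "d 0 \<notin> S" "d 0 \<in> T" using gD(1) nS by auto
  have dn: "d n \<in> K" "d n \<notin> T" "d n \<in> S" using gD(2) nT by auto
  have "n \<noteq> 0" using d0 dn by metis
  have c0: "cyc j p (d 0) q" "cyc j p q (d n)" using nS[of "d 0"] nT[of "d n"] d0 dn by (auto simp: cyc_rotate[of j p q])
  have c0': "cyc j (d 0) q (d n)" "cyc j (d 0) (d n) p" using cyc4_rotate[OF c0] by auto
  have inter: "d i \<in> S" "d i \<in> T" if "0 < i" "i < n" for i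
    using gD(7)[of i] gD(8)[of i] dK[of i] that by auto
  show False
  proof (cases "n = 1")
    case True
    \<comment> \<open>One row joins the two complements. As an arc it contains \<open>p\<close> or
      \<open>q\<close>, and \<open>M_VI\<close> then forces all of \<open>S \<inter> T\<close> into
      it. Any element outside the row now makes \<open>?r \<inter> S\<close> or
      \<open>?r \<inter> T\<close> alternate.\<close>
    let ?r = "r 0"
    have r: "?r \<in> F0" "d 0 \<in> ?r" "d 1 \<in> ?r" using gD(3)[of 0] gD(4)[of 0 0] gD(4)[of 0 1] True by auto
    have VI: False if "u \<in> K" "v \<in> K" "u \<in> S" "u \<in> T" "v \<in> S" "v \<in> T" "u \<in> ?r" "v \<notin> ?r" for u v
    proof -
      have "obst K F"
        by (rule obst_VI[of "d 1" K v "d 0" u S F T "?r"]) (use that True d0 dn r ST F0 in auto)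
      with no show False ..
    qed
    have "p \<in> ?r \<or> q \<in> ?r" using is_arcD[OF arc[OF r(1)] c0'] r d0 dn K True by auto
    with VI[of p q] VI[of q p] K m have pq: "p \<in> ?r" "q \<in> ?r" by blast+
    obtain w where w: "w \<in> K" "w \<notin> ?r" using sub[OF r(1)] by blast
    show False
    proof (cases "w \<in> S \<and> w \<in> T")
      case True then show ?thesis using VI[of p w] pq K m w by blast
    next
      case False
      then consider "w \<notin> S" | "w \<notin> T" by blast
      then show ?thesis
      proof cases
        case 1
        then show ?thesis using is_arcD[OF arcrT[OF r(1)], of p w q "d n"] nS[OF w(1)] c0 pq m K w d0 dn by auto
      next
        case 2
        then have "cyc j p q w" using nT[OF w(1)] by (simp add: cyc_rotate[of j p q])
        then show ?thesis using is_arcD[OF arcrS[OF r(1)] c0(1), of w] pq m K w d0 by auto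
      qed
    qed
  next
    case False
    then have n2: "2 \<le> n" using \<open>n \<noteq> 0\<close> by simp
    \<comment> \<open>The chord from \<open>d 0\<close> to \<open>d n\<close> separates
      \<open>p\<close> from \<open>q\<close>. Each row meets \<open>S \<inter> T\<close> on one side
      of it only, because \<open>r i \<inter> S\<close> or \<open>r i \<inter> T\<close> is an arc
      avoiding both ends of the chord. So all inner vertices are on one side, and whichever of
      \<open>p\<close>, \<open>q\<close> is on the other side is avoided by all rows; it becomes the
      column \<open>z\<close> of \<open>obst_path\<close>.\<close>
    let ?s = "\<lambda>u. cyc j (d 0) u (d n)"
    have alt: False if "is_arc K j A" "u \<in> A" "v \<in> A" "d 0 \<notin> A" "d n \<notin> A" "u \<in> K" "v \<in> K"
      "u \<in> S" "u \<in> T" "v \<in> S" "v \<in> T" "?s u" "\<not> ?s v" for A u v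
    proof -
      have "j v \<noteq> j (d 0)" "j v \<noteq> j (d n)" "j (d 0) \<noteq> j (d n)"
        using neq[of v "d 0"] neq[of v "d n"] neq[of "d 0" "d n"] that d0 dn by auto
      with that(13) have "cyc j (d 0) (d n) v" unfolding cyc_def by auto
      from is_arc_outD[OF that(1,12) this] that d0 dn show False by blast
    qed
    have same: "?s u \<longleftrightarrow> ?s v" if "i < n" "u \<in> r i" "v \<in> r i" "u \<in> S" "u \<in> T" "v \<in> S" "v \<in> T" for i u v
    proof -
      have ri: "r i \<in> F0" using gD(3) that by blast
      have uv: "u \<in> K" "v \<in> K" using sub[OF ri] that by blast+
      have "\<exists>A. is_arc K j A \<and> u \<in> A \<and> v \<in> A \<and> d 0 \<notin> A \<and> d n \<notin> A"
      proof (cases "i = 0")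
        case True
        then have "d n \<notin> r i" using gD(4)[of i n] that n2 by auto
        then show ?thesis using arcrS[OF ri] that d0 by (intro exI[of _ "r i \<inter> S"]) auto
      next
        case False
        then have "d 0 \<notin> r i" using gD(4)[of i 0] that by auto
        then show ?thesis using arcrT[OF ri] that dn by (intro exI[of _ "r i \<inter> T"]) auto
      qed
      then show ?thesis using alt[of _ u v] alt[of _ v u] uv that by blast
    qed
    have sd: "?s (d i) \<longleftrightarrow> ?s (d 1)" if "0 < i" "i < n" for i
      using that
    proof (induction i)
      case (Suc i)
      show ?case
      proof (cases "i = 0")
        case False
        then have "?s (d (Suc i)) \<longleftrightarrow> ?s (d i)"
          using same[of i "d (Suc i)" "d i"] gD(4)[of i i] gD(4)[of i "Suc i"] inter[of i] inter[of "Suc i"] Suc.prems by auto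
        with Suc False show ?thesis by auto
      qed simp
    qed simp
    have "?s q" "\<not> ?s p" using c0' unfolding cyc_def by auto
    then obtain z where z: "z \<in> K" "z \<in> S" "z \<in> T" "?s z \<noteq> ?s (d 1)" using K m by metis
    have zr: "z \<notin> r i" if "i < n" for i
    proof
      assume "z \<in> r i"
      let ?k = "if i = 0 then 1 else i"
      have k: "0 < ?k" "?k < n" using that n2 by auto
      have "d ?k \<in> r i" using gD(4)[of i ?k] that n2 by auto
      with same[of i z "d ?k"] sd[OF k] inter[OF k] \<open>z \<in> r i\<close> z that show False by blast
    qed
    have "obst K F"
      by (rule obst_pathI[OF n2 geodesic_path_rows[OF g _ _ F0(1)], of K T S z])
        (use sub ST z zr inter d0 dn in auto)
    with no show False ..
  qed
qed

lemma reach_sym: "v \<in> reach R {u} \<Longrightarrow> u \<in> reach R {v}"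
proof (induction rule: reach.induct)
  case (step w r v)
  then have "w \<in> reach R {v}" by (auto intro: reach.step[of v] reach.base)
  with step.IH show ?case using reach_trans[of u R "{w}" "{v}"] by auto
qed (auto intro: reach.base)

lemma reach_from: "v \<in> reach R A \<Longrightarrow> \<exists>u\<in>A. v \<in> reach R {u}"
  by (induction rule: reach.induct) (auto intro: reach.intros)

lemma obst_cycle4:
  assumes "a \<in> K" "b \<in> K" "c \<in> K" "d \<in> K" "r \<in> F" "s \<in> F" "t \<in> F" "u \<in> F" "z \<in> K"
    "a \<in> r" "b \<in> r" "c \<notin> r" "d \<notin> r" "a \<notin> s" "b \<in> s" "c \<in> s" "d \<notin> s"
    "a \<notin> t" "b \<notin> t" "c \<in> t" "d \<in> t" "a \<in> u" "b \<notin> u" "c \<notin> u" "d \<in> u"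
    "z \<notin> r" "z \<notin> s" "z \<notin> t" "z \<notin> u"
  shows "obst K F"
proof -
  have *: "i \<le> 3 \<longleftrightarrow> i = 0 \<or> i = 1 \<or> i = 2 \<or> i = 3" for i :: nat by auto
  have p: "path_rows K F 3 (\<lambda>i. [a, b, c, d] ! i) (\<lambda>i. [r, s, t] ! i)"
    unfolding path_rows_def all_small_nat * using assms by auto
  show ?thesis
    by (rule obst_cycle_pathI[OF p, of u z]) (use assms in \<open>auto simp: * all_small_nat\<close>)
qed

section \<open>Cutting the circle\<close>

text \<open>The circle of \<open>F0\<close> is cut open at the twin class \<open>X\<close>, and
  \<open>l\<close> orders the other classes. The sets that split \<open>X\<close> are described
  later by \<open>sufrow\<close> and \<open>prerow\<close>; by \<open>sat\<close> they are not in
  \<open>F0\<close>.\<close>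

locale cut =
  fixes K :: "'v set" and F0 F :: "'v set set" and X :: "'v set" and l :: "'v \<Rightarrow> int"
  assumes fin: "finite K" and no: "\<not> obst K F" and F0: "F0 \<subseteq> F" "ov_conn F0" "card F0 \<ge> 2"
    and sub: "\<And>r. r \<in> F0 \<Longrightarrow> r \<subseteq> K \<and> r \<noteq> K" and X: "X \<subseteq> K" "X \<noteq> {}"
    and sat: "\<And>r. r \<in> F0 \<Longrightarrow> X \<subseteq> r \<or> r \<inter> X = {}"
    and cls: "\<And>u v. u \<in> K - X \<Longrightarrow> v \<in> K - X \<Longrightarrow> l u = l v \<longleftrightarrow> twins F0 u v"
    and sepX: "\<And>u v. u \<in> X \<Longrightarrow> v \<in> K - X \<Longrightarrow> \<not> twins F0 u v"
    and int: "\<And>r a b c. r \<in> F0 \<Longrightarrow> r \<inter> X = {} \<Longrightarrow> a \<in> r \<Longrightarrow> c \<in> r \<Longrightarrow> b \<in> K - X \<Longrightarrow> l a < l b \<Longrightarrow> l b < l c \<Longrightarrow> b \<in> r"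
    and coint: "\<And>r a b c. r \<in> F0 \<Longrightarrow> X \<subseteq> r \<Longrightarrow> a \<in> K - r \<Longrightarrow> c \<in> K - r \<Longrightarrow> b \<in> K - X \<Longrightarrow> l a < l b \<Longrightarrow> l b < l c \<Longrightarrow> b \<notin> r"
    and two: "\<exists>u\<in>K - X. \<exists>v\<in>K - X. l u \<noteq> l v"
begin

abbreviation "L \<equiv> K - X"
abbreviation "R \<equiv> {r \<in> F0. r \<inter> X = {}}"

text \<open>The inequality is weak because \<open>A\<close> may split a class of equal
  \<open>l\<close>-values.\<close>

definition suf where "suf A \<longleftrightarrow> (\<forall>u\<in>L \<inter> A. \<forall>v\<in>L - A. l v \<le> l u)"
definition pre where "pre A \<longleftrightarrow> (\<forall>u\<in>L \<inter> A. \<forall>v\<in>L - A. l u \<le> l v)"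

text \<open>These are the arc conditions on a set that splits \<open>X\<close> with its own elements
  first: leaving \<open>X\<close> backwards, the arc occupies the end of the line.
  \<open>prerow\<close> is the mirror image.\<close>

definition sufrow where
  "sufrow S \<longleftrightarrow> S \<in> F \<and> S \<subseteq> K \<and> S \<inter> L \<noteq> {} \<and> suf S \<and> (\<forall>r\<in>F0. X \<subseteq> r \<longrightarrow> suf (r \<inter> S)) \<and> (\<exists>r\<in>F0. overlap r S)"
definition prerow where
  "prerow S \<longleftrightarrow> S \<in> F \<and> S \<subseteq> K \<and> S \<inter> L \<noteq> {} \<and> pre S \<and> (\<forall>r\<in>F0. X \<subseteq> r \<longrightarrow> pre (r \<inter> S)) \<and> (\<exists>r\<in>F0. overlap r S)"

definition Y where "Y = {u\<in>L. \<forall>v\<in>L. l v \<le> l u}"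

lemma cut_rev: "cut K F0 F X (\<lambda>v. - l v)"
proof
  show "finite K" "\<not> obst K F" "F0 \<subseteq> F" "ov_conn F0" "2 \<le> card F0" "X \<subseteq> K" "X \<noteq> {}"
    by (fact fin no F0 X)+
  show "r \<subseteq> K \<and> r \<noteq> K" "X \<subseteq> r \<or> r \<inter> X = {}" if "r \<in> F0" for r using sub sat that by auto
  show "- l u = - l v \<longleftrightarrow> twins F0 u v" if "u \<in> K - X" "v \<in> K - X" for u v
    using cls[OF that] by simp
  show "\<not> twins F0 u v" if "u \<in> X" "v \<in> K - X" for u v using sepX[OF that] .
  show "b \<in> r" if "r \<in> F0" "r \<inter> X = {}" "a \<in> r" "c \<in> r" "b \<in> K - X" "- l a < - l b" "- l b < - l c" for r a b c
    by (rule int[OF that(1,2,4,3,5)]) (use that in simp_all)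
  show "b \<notin> r" if "r \<in> F0" "X \<subseteq> r" "a \<in> K - r" "c \<in> K - r" "b \<in> K - X" "- l a < - l b" "- l b < - l c" for r a b c
    by (rule coint[OF that(1,2,4,3,5)]) (use that in simp_all)
  show "\<exists>u\<in>K - X. \<exists>v\<in>K - X. - l u \<noteq> - l v" using two by simp
qed

lemma ov_ex: "r \<in> F0 \<Longrightarrow> \<exists>s\<in>F0. overlap r s"
  using ov_conn_overlap_exists[OF F0(2,3)] .

lemma twinsD: "u \<in> L \<Longrightarrow> v \<in> L \<Longrightarrow> l u = l v \<Longrightarrow> r \<in> F0 \<Longrightarrow> u \<in> r \<longleftrightarrow> v \<in> r"
  using cls by (auto simp: twins_def)

lemma XD: "r \<in> F0 \<Longrightarrow> x \<in> X \<Longrightarrow> x \<in> r \<longleftrightarrow> X \<subseteq> r"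
  using sat by blast

lemma sep_row:
  assumes "p \<in> L" obtains f where "f \<in> F0" "X \<subseteq> f" "p \<notin> f" | f where "f \<in> F0" "f \<inter> X = {}" "p \<in> f"
proof -
  obtain x where "x \<in> X" using X by blast
  with sepX[OF this assms] obtain f where "f \<in> F0" "(x \<in> f) \<noteq> (p \<in> f)" by (auto simp: twins_def)
  with sat[of f] \<open>x \<in> X\<close> that show thesis by blast
qed

lemma Y_nonempty: "Y \<noteq> {}"
proof -
  have "L \<noteq> {}" "finite L" using two fin by auto
  then have "Max (l ` L) \<in> l ` L" by simp
  then obtain u where "u \<in> L" "l u = Max (l ` L)" by auto
  then have "u \<in> Y" using \<open>finite L\<close> by (auto simp: Y_def)
  then show ?thesis by blast
qed

lemma Y_L: "u \<in> Y \<Longrightarrow> u \<in> L" and Y_le: "u \<in> Y \<Longrightarrow> v \<in> L \<Longrightarrow> l v \<le> l u"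
  by (auto simp: Y_def)

lemma Y_eq: "u \<in> Y \<Longrightarrow> v \<in> Y \<Longrightarrow> l u = l v"
  by (auto simp: Y_def intro: antisym)

lemma Y_I: "u \<in> Y \<Longrightarrow> v \<in> L \<Longrightarrow> l u \<le> l v \<Longrightarrow> v \<in> Y"
  unfolding Y_def by (blast intro: order_trans)

lemma Y_row: "u \<in> Y \<Longrightarrow> v \<in> Y \<Longrightarrow> r \<in> F0 \<Longrightarrow> u \<in> r \<longleftrightarrow> v \<in> r"
  using twinsD Y_L Y_eq by blast

lemma sufD: "suf A \<Longrightarrow> u \<in> L \<Longrightarrow> u \<in> A \<Longrightarrow> v \<in> L \<Longrightarrow> v \<notin> A \<Longrightarrow> l v \<le> l u"
  unfolding suf_def by blast
lemma preD: "pre A \<Longrightarrow> u \<in> L \<Longrightarrow> u \<in> A \<Longrightarrow> v \<in> L \<Longrightarrow> v \<notin> A \<Longrightarrow> l u \<le> l v"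
  unfolding pre_def by blast

lemma suf_meets_Y: "suf A \<Longrightarrow> A \<inter> L \<noteq> {} \<Longrightarrow> \<exists>p\<in>Y. p \<in> A"
  using Y_nonempty sufD Y_I Y_L by blast

text \<open>The complements of both rows are intervals of the line that contain its last class;
  hence they are final segments, and final segments are nested.\<close>

lemma nested_co:
  assumes "f \<in> F0" "h \<in> F0" "X \<subseteq> f" "X \<subseteq> h" "p \<in> Y" "p \<notin> f" "p \<notin> h"
  shows "\<not> overlap f h"
proof
  assume "overlap f h"
  then obtain c e where ce: "c \<in> f" "c \<notin> h" "e \<in> h" "e \<notin> f" by (auto simp: overlap_def)
  have L: "c \<in> L" "e \<in> L" "p \<in> L" using ce assms sub Y_L by blast+
  have *: "l c \<noteq> l e" "l c \<noteq> l p" "l e \<noteq> l p" "l c \<le> l p" "l e \<le> l p"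
    using twinsD[OF L(1,2) _ assms(1)] twinsD[OF L(1,3) _ assms(1)] twinsD[OF L(2,3) _ assms(2)] ce assms(5-7)
      Y_le[OF assms(5)] L by auto
  then show False
    using coint[OF assms(1,3), of e p c] coint[OF assms(2,4), of c p e] ce assms L by fastforce
qed

lemma nested_suf:
  assumes "f \<in> F0" "h \<in> F0" "f \<inter> X = {}" "h \<inter> X = {}" "p \<in> Y" "p \<in> f" "p \<in> h"
  shows "\<not> overlap f h"
proof
  assume "overlap f h"
  then obtain c e where ce: "c \<in> f" "c \<notin> h" "e \<in> h" "e \<notin> f" by (auto simp: overlap_def)
  have L: "c \<in> L" "e \<in> L" "p \<in> L" using ce assms sub Y_L by blast+
  have *: "l c \<noteq> l e" "l c \<noteq> l p" "l e \<noteq> l p" "l c \<le> l p" "l e \<le> l p"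
    using twinsD[OF L(1,2) _ assms(1)] twinsD[OF L(1,3) _ assms(2)] twinsD[OF L(2,3) _ assms(1)] ce assms(5-7)
      Y_le[OF assms(5)] L by auto
  then show False
    using int[OF assms(1,3), of c p e] int[OF assms(2,4), of e p c] ce assms L by fastforce
qed

lemma R_sub: "r \<in> R \<Longrightarrow> r \<subseteq> L"
  using sub by blast

lemma reach_L: "A \<subseteq> L \<Longrightarrow> reach R A \<subseteq> L"
  using reach_Un[of R A] R_sub by blast

text \<open>The rows of \<open>R\<close> inside the reachable part form a proper subfamily of
  \<open>F0\<close>, since \<open>g0\<close> is not among them. A set overlapping this subfamily
  from outside cannot belong to \<open>R\<close>, because it would be reachable too.\<close>

lemma leave:
  assumes p: "r0 \<in> R" "u0 \<in> r0" "u0 \<in> reach R A" and g: "g0 \<in> F0" "X \<subseteq> g0"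
  shows "\<exists>g\<in>F0. X \<subseteq> g \<and> g \<inter> reach R A \<noteq> {} \<and> \<not> reach R A \<subseteq> g"
proof -
  let ?Q = "{r \<in> R. r \<subseteq> reach R A}"
  have "r0 \<in> ?Q" using p reach_row[OF p(3,1,2)] by blast
  moreover have "g0 \<notin> ?Q" using g X by blast
  ultimately have "?Q \<noteq> {}" "?Q \<subseteq> F0" "?Q \<noteq> F0" using g(1) by auto
  from ov_connD[OF F0(2) this] obtain a b where ab: "a \<in> ?Q" "b \<in> F0 - ?Q" "overlap a b" by auto
  then obtain u where u: "u \<in> a" "u \<in> b" by (auto simp: overlap_def)
  have "\<not> b \<inter> X = {}"
  proof
    assume "b \<inter> X = {}"
    then have "b \<in> R" using ab by blast
    with u ab reach_row[of u R A b] show False by blast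
  qed
  then have "X \<subseteq> b" using sat ab by blast
  moreover have "\<not> a \<subseteq> b" using ab by (simp add: overlap_def)
  ultimately show ?thesis using ab u by blast
qed

lemma leave1:
  assumes "p \<in> L" "g0 \<in> F0" "X \<subseteq> g0" "p \<in> A"
  shows "\<exists>g\<in>F0. X \<subseteq> g \<and> \<not> reach R A \<subseteq> g"
proof (rule sep_row[OF assms(1)])
  fix f assume "f \<in> F0" "X \<subseteq> f" "p \<notin> f"
  then show ?thesis using reach.base[of p A R] assms(4) by blast
next
  fix f assume "f \<in> F0" "f \<inter> X = {}" "p \<in> f"
  then show ?thesis using leave[of f p A g0] reach.base[of p A R] assms by blast
qed

lemma geo_L:
  assumes "geodesic R A B m c r" "A \<subseteq> L" "i \<le> m" shows "c i \<in> L"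
  using geodesic_in[OF assms(1,2) R_sub assms(3)] by blast

lemma geo_path:
  assumes "geodesic R A B m c r" "A \<subseteq> L" shows "path_rows K F m c r"
  by (rule geodesic_path_rows[OF assms(1)]) (use assms(2) sub F0 in auto)

lemma geo_X: "geodesic R A B m c r \<Longrightarrow> i < m \<Longrightarrow> x \<in> X \<Longrightarrow> x \<notin> r i"
  using geodesicD(3)[of R A B m c r i] by blast

text \<open>Equal \<open>l\<close>-values mean twins, and by \<open>geodesic_twins\<close> a
  shortest walk has no twins after its start.\<close>

lemma geo_twins:
  assumes g: "geodesic R A B m c r" "A \<subseteq> L" and ij: "0 < i" "0 < j" "i \<le> m" "j \<le> m" "i \<noteq> j"
  shows "l (c i) \<noteq> l (c j)"
proof
  assume "l (c i) = l (c j)"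
  then have "twins F0 (c i) (c j)" using cls geo_L[OF g] ij by blast
  then have "twins R (c i) (c j)" "twins R (c j) (c i)" by (auto simp: twins_def)
  then show False using geodesic_twins[OF g(1), of i j] geodesic_twins[OF g(1), of j i] ij by (cases "i < j") auto
qed

text \<open>By \<open>mix\<close> an element of kind \<open>P\<close> and one of kind
  \<open>Q\<close> always share a class, whereas the walk visits no class twice after its
  start.\<close>

lemma geo_uniform:
  assumes g: "geodesic R A B m c r" "A \<subseteq> L" and n: "n \<le> m"
    and P: "\<And>i. 0 < i \<Longrightarrow> i \<le> n \<Longrightarrow> P (c i) \<or> Q (c i)"
    and mix: "\<And>u v. u \<in> L \<Longrightarrow> v \<in> L \<Longrightarrow> P u \<Longrightarrow> Q v \<Longrightarrow> l u = l v"
  shows "(\<forall>i. 0 < i \<and> i \<le> n \<longrightarrow> P (c i)) \<or> (\<forall>i. 0 < i \<and> i \<le> n \<longrightarrow> Q (c i))"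
proof (rule ccontr)
  assume "\<not> ?thesis"
  then obtain i j where i: "0 < i" "i \<le> n" "\<not> P (c i)" and j: "0 < j" "j \<le> n" "\<not> Q (c j)" by blast
  then have "Q (c i)" "P (c j)" using P by blast+
  then have "l (c j) = l (c i)" using mix geo_L[OF g] i j n by (meson order_trans)
  moreover have "i \<noteq> j" using i j P by blast
  ultimately show False using geo_twins[OF g, of j i] i j n by auto
qed

end

section \<open>Two sets leaving the class on the same side\<close>

context cut begin

text \<open>A row through \<open>X\<close> that misses \<open>p\<close> closes
  \<open>x, p, y\<close> to a triangle. Otherwise consider a shortest walk from
  \<open>S \<inter> T\<close> through rows avoiding \<open>X\<close>. While it stays in
  \<open>S \<union> T\<close> it lies, after its start, in one of \<open>S - T\<close> and
  \<open>T - S\<close>. An element of \<open>X\<close> prolongs it backwards to a staircase, whose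
  long rows are found among \<open>S\<close>, \<open>T\<close> and a row through
  \<open>X\<close>.\<close>

lemma same_side_common:
  assumes S: "sufrow S" and T: "sufrow T" and x: "x \<in> X" "x \<in> S" "x \<notin> T" and y: "y \<in> X" "y \<in> T" "y \<notin> S"
    and p: "p \<in> Y" "p \<in> S" "p \<in> T"
  shows False
proof -
  have pL: "p \<in> L" and xK: "x \<in> K" and yK: "y \<in> K" and pK: "p \<in> K" using p Y_L x y X by blast+
  have F: "S \<in> F" "T \<in> F" and sS: "suf S" and sT: "suf T"
    using S T by (auto simp: sufrow_def)
  have inF: "r \<in> F" if "r \<in> F0" for r using that F0 by blast
  show False
  proof (cases "\<exists>f\<in>F0. X \<subseteq> f \<and> p \<notin> f")
    case True
    then obtain f where f: "f \<in> F0" "X \<subseteq> f" "p \<notin> f" by blast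
    \<comment> \<open>\<open>f \<inter> V\<close> is a final segment that misses the last class, so
      it is empty outside \<open>X\<close>.\<close>
    have disj: "u \<notin> V" if V: "V = S \<or> V = T" and u: "u \<in> f" "u \<in> L" for u V
    proof
      assume "u \<in> V"
      have "suf (f \<inter> V)" using V S T f by (auto simp: sufrow_def)
      then have "l p \<le> l u" using sufD[of "f \<inter> V" u p] u \<open>u \<in> V\<close> pL f by blast
      then show False using Y_I[OF p(1)] Y_row[OF p(1) _ f(1), of u] u f by blast
    qed
    \<comment> \<open>\<open>x, p, y\<close> form a triangle under \<open>S\<close>,
      \<open>T\<close>, \<open>f\<close>. Hence neither an uncovered element nor, in
      \<open>nog\<close>, a row containing all three can exist.\<close>
    have K: "K \<subseteq> S \<union> T \<union> f"
    proof
      fix z assume z: "z \<in> K"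
      show "z \<in> S \<union> T \<union> f"
      proof (rule ccontr)
        assume "\<not> ?thesis"
        then have "obst K F"
          using obst_cycle3[of x K p y S F T f z] F inF[OF f(1)] xK yK pK x y p f z by auto
        with no show False ..
      qed
    qed
    have nog: "p \<notin> g" if "g \<in> F0" "X \<subseteq> g" for g
    proof
      assume "p \<in> g"
      then have "obst K F"
        using obst_cycle3[of x K p y S F T f p g] F inF[OF f(1)] inF[OF that(1)] xK yK pK x y p f that by auto
      with no show False ..
    qed
    from ov_ex[OF f(1)] obtain h where h: "h \<in> F0" "overlap f h" by blast
    then have "\<not> X \<subseteq> h" using nested_co[OF f(1) h(1) f(2) _ p(1) f(3)] nog by blast
    then have hX: "h \<inter> X = {}" using sat h by blast
    from h(2) obtain c d where c: "c \<in> f" "c \<in> h" and d: "d \<in> h" "d \<notin> f" by (auto simp: overlap_def)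
    have L: "c \<in> L" "d \<in> L" using c d h hX sub by blast+
    have c': "c \<notin> S" "c \<notin> T" using disj c L by blast+
    have ih: "h \<in> F" "f \<in> F" using inF h f by auto
    have xh: "x \<notin> h" "y \<notin> h" "x \<in> f" "y \<in> f" using hX x y f by blast+
    have III: "obst K F" if "m \<in> L" "m \<in> S" "m \<in> T" "m \<in> h" for m
      by (rule obst_III3[of x K y c m S F T h]) (use that F ih x y c c' L xK yK xh in auto)
    consider "d \<in> S" "d \<in> T" | "p \<in> h" | "p \<notin> h" "d \<in> S" "d \<notin> T" | "p \<notin> h" "d \<notin> S" "d \<in> T"
      using K d L by blast
    then have "obst K F"
    proof cases
      case 1 then show ?thesis using III d L by blast
    next
      case 2 then show ?thesis using III p pL by blast
    next
      case 3
      show ?thesis by (rule obst_comp[of p K y c d x T F S h f]) (use 3 F ih x y c c' d p f L xK yK pK xh in auto)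
    next
      case 4
      show ?thesis by (rule obst_comp[of p K x c d y S F T h f]) (use 4 F ih x y c c' d p f L xK yK pK xh in auto)
    qed
    with no show False ..
  next
    case False
    then have pg: "p \<in> g" if "g \<in> F0" "X \<subseteq> g" for g using that by blast
    let ?Rp = "reach R {p}"
    let ?A = "S \<inter> T \<inter> ?Rp"
    have RpL: "?Rp \<subseteq> L" using reach_L pL by blast
    then have AL: "?A \<subseteq> L" by blast
    have pA: "p \<in> ?A" using p by (auto intro: reach.base)
    have RpA: "u \<in> reach R ?A" if "u \<in> ?Rp" for u
      by (rule reach_trans[OF that]) (use pA in \<open>auto intro: reach.base\<close>)
    have ARp: "u \<in> ?Rp" if "u \<in> reach R ?A" for u by (rule reach_trans[OF that]) blast
    \<comment> \<open>Two final segments are nested up to a single class, in which both differences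
      must lie.\<close>
    have mix: "l u = l v" if "u \<in> L" "v \<in> L" "u \<in> S" "u \<notin> T" "v \<in> T" "v \<notin> S" for u v
      using sufD[OF sS, of u v] sufD[OF sT, of v u] that by (intro antisym) auto
    have uni: "(\<forall>i. 0 < i \<and> i \<le> n \<longrightarrow> c i \<in> S \<and> c i \<notin> T) \<or> (\<forall>i. 0 < i \<and> i \<le> n \<longrightarrow> c i \<in> T \<and> c i \<notin> S)"
      if g: "geodesic R ?A B m c r" and n: "n \<le> m" and P: "\<And>i. 0 < i \<Longrightarrow> i \<le> n \<Longrightarrow> c i \<in> S \<or> c i \<in> T" for B m c r n
    proof -
      have "c i \<notin> S \<or> c i \<notin> T" if "0 < i" "i \<le> n" for i
        using geodesicD(7)[OF g, of i] geodesic_reach[OF g, of i] ARp that n by auto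
      then show ?thesis
        using geo_uniform[OF g AL n, of "\<lambda>u. u \<in> S \<and> u \<notin> T" "\<lambda>u. u \<in> T \<and> u \<notin> S"] P mix by blast
    qed
    show False
    proof (cases "?Rp \<subseteq> S \<union> T")
      case out: False
      then obtain w where w: "w \<in> ?Rp" "w \<notin> S" "w \<notin> T" by blast
      then have "w \<in> L - S - T" using RpL by blast
      with geodesic_exists[OF this RpA[OF w(1)]] obtain m c r where g: "geodesic R ?A (L - S - T) m c r" by blast
      note gD = geodesicD[OF g]
      have m: "m \<noteq> 0" using gD(1,2) by (cases "m = 0") auto
      have inner: "c i \<in> S \<or> c i \<in> T" if "i < m" for i
        using gD(8)[OF that] geo_L[OF g AL, of i] that by auto
      \<comment> \<open>The staircase is \<open>y', c 0, ..., c m\<close> with first row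
        \<open>V'\<close>. The set \<open>V\<close> contains its inner columns and \<open>x'\<close>
        but neither end, which is \<open>M_III\<close>.\<close>
      have key: "obst K F" if V: "V \<in> F" "V' \<in> F" "x' \<in> X" "y' \<in> X" "x' \<in> V" "x' \<notin> V'" "y' \<in> V'" "y' \<notin> V"
        and VST: "V \<union> V' = S \<union> T" "V \<inter> V' = S \<inter> T" and all: "\<And>i. 0 < i \<Longrightarrow> i < m \<Longrightarrow> c i \<in> V \<and> c i \<notin> V'" for V V' x' y'
      proof -
        have xy': "x' \<in> K" "y' \<in> K" using V X by auto
        have c0: "c 0 \<in> V" "c 0 \<in> V'" using gD(1) VST by auto
        have cm: "c m \<notin> V" "c m \<notin> V'" using gD(2) VST by auto
        have "path_rows K F (Suc m) (case_nat y' c) (case_nat V' r)"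
        proof (rule path_rows_prepend[OF geo_path[OF g AL] xy'(2) V(2,7)])
          show "c j \<in> V' \<longleftrightarrow> j = 0" if "j \<le> m" for j
            using all[of j] c0 cm that by (cases "j = 0"; cases "j = m") auto
        qed (use geo_X[OF g] V in auto)
        then show ?thesis
        proof (rule obst_pathI[of "Suc m" K F _ _ V V x', rotated])
          show "x' \<notin> case_nat V' r i" if "i < Suc m" for i
            using that V geo_X[OF g] by (auto split: nat.split)
          show "case_nat y' c j \<in> V \<and> case_nat y' c j \<in> V" if "0 < j" "j < Suc m" for j
            using that all c0 by (cases j; cases "j = 1") auto
        qed (use m V cm xy' in auto)
      qed
      have "m - 1 \<le> m" by simp
      note u = uni[OF g this]
      have lt: "i \<le> m - 1 \<longleftrightarrow> i < m" for i using m by auto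
      have "(\<forall>i. 0 < i \<and> i < m \<longrightarrow> c i \<in> S \<and> c i \<notin> T) \<or> (\<forall>i. 0 < i \<and> i < m \<longrightarrow> c i \<in> T \<and> c i \<notin> S)"
        by (rule u[unfolded lt]) (rule inner)
      then have "obst K F"
      proof
        assume "\<forall>i. 0 < i \<and> i < m \<longrightarrow> c i \<in> S \<and> c i \<notin> T"
        then show ?thesis using key[of S T x y] F x y by auto
      next
        assume "\<forall>i. 0 < i \<and> i < m \<longrightarrow> c i \<in> T \<and> c i \<notin> S"
        then show ?thesis using key[of T S y x] F x y by auto
      qed
      with no show False ..
    next
      case cover: True
      show False
      proof (cases "\<exists>g\<in>F0. X \<subseteq> g")
        case True
        then obtain g0 where "g0 \<in> F0" "X \<subseteq> g0" by blast
        from leave1[OF pL this, of "{p}"] obtain g where g: "g \<in> F0" "X \<subseteq> g" "\<not> ?Rp \<subseteq> g" by blast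
        have pg': "p \<in> g" using pg g by blast
        have gF: "g \<in> F" using inF g by blast
        have xyg: "x \<in> g" "y \<in> g" using g x y by auto
        have noq: False if "q \<in> ?Rp" "q \<notin> g" "q \<in> S" "q \<in> T" for q
        proof -
          have "q \<in> K" using that RpL by blast
          then have "obst K F" by (intro obst_VI[of x K q y p S F T g]) (use that F gF x y p xK yK pK xyg pg' in auto)
          with no show False ..
        qed
        from g(3) obtain w where w: "w \<in> ?Rp - g" by blast
        then have "w \<in> reach R ?A" using RpA by blast
        from geodesic_exists[OF w this] obtain m c r where geo: "geodesic R ?A (?Rp - g) m c r" by blast
        note gD = geodesicD[OF geo]
        have m: "m \<noteq> 0" using gD(1,2) noq by (metis DiffD2 Int_iff)
        have cRp: "c i \<in> ?Rp" if "i \<le> m" for i using ARp geodesic_reach[OF geo that] by blast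
        have cg: "c i \<in> g" if "i < m" for i using gD(8)[OF that] cRp[of i] that by auto
        have cm: "c m \<notin> g" using gD(2) by auto
        \<comment> \<open>The staircase is built in the same way but stays in \<open>V\<close> up to
          its end, which lies outside \<open>g\<close>. Now \<open>V\<close> misses only the first
          column and \<open>g\<close> only the last one; with the column \<open>x'\<close> this is
          \<open>M_II\<close>.\<close>
        have key: "obst K F" if V: "V \<in> F" "V' \<in> F" "x' \<in> X" "y' \<in> X" "x' \<in> V" "x' \<notin> V'" "y' \<in> V'" "y' \<notin> V"
          and VST: "V \<inter> V' = S \<inter> T" and all: "\<And>i. 0 < i \<Longrightarrow> i \<le> m \<Longrightarrow> c i \<in> V \<and> c i \<notin> V'" for V V' x' y'
        proof -
          have xy': "x' \<in> K" "y' \<in> K" "x' \<in> g" "y' \<in> g" using V X g by auto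
          have c0: "c 0 \<in> V" "c 0 \<in> V'" using gD(1) VST by auto
          have "path_rows K F (Suc m) (case_nat y' c) (case_nat V' r)"
          proof (rule path_rows_prepend[OF geo_path[OF geo AL] xy'(2) V(2,7)])
            show "c j \<in> V' \<longleftrightarrow> j = 0" if "j \<le> m" for j
              using all[of j] c0 that by (cases "j = 0") auto
          qed (use geo_X[OF geo] V in auto)
          then show ?thesis
          proof (rule obst_pathI[of "Suc m" K F _ _ g V x', rotated])
            show "x' \<notin> case_nat V' r i" if "i < Suc m" for i
              using that V geo_X[OF geo] by (auto split: nat.split)
            show "case_nat y' c j \<in> g \<and> case_nat y' c j \<in> V" if "0 < j" "j < Suc m" for j
              using that all c0 cg by (cases j; cases "j = 1") auto
          qed (use m V cm xy' gF in auto)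
        qed
        from uni[OF geo order_refl] cRp cover
        have "(\<forall>i. 0 < i \<and> i \<le> m \<longrightarrow> c i \<in> S \<and> c i \<notin> T) \<or> (\<forall>i. 0 < i \<and> i \<le> m \<longrightarrow> c i \<in> T \<and> c i \<notin> S)" by blast
        then have "obst K F"
        proof
          assume "\<forall>i. 0 < i \<and> i \<le> m \<longrightarrow> c i \<in> S \<and> c i \<notin> T"
          then show ?thesis using key[of S T x y] F x y by auto
        next
          assume "\<forall>i. 0 < i \<and> i \<le> m \<longrightarrow> c i \<in> T \<and> c i \<notin> S"
          then show ?thesis using key[of T S y x] F x y by auto
        qed
        with no show False ..
      next
        case none: False
        then have RF: "R = F0" using sat by blast
        have inU: "\<exists>r\<in>F0. u \<in> r" if "u \<in> L" for u
          using sep_row[OF that] none by metis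
        have LRp: "L \<subseteq> ?Rp"
        proof
          fix u assume "u \<in> L"
          from inU[OF this] inU[OF pL] have "u \<in> \<Union>F0" "p \<in> \<Union>F0" by auto
          then show "u \<in> ?Rp" using reach_conn[OF F0(2), of p] unfolding RF by blast
        qed
        obtain s t where st: "s \<in> L" "s \<notin> T" "t \<in> L" "t \<notin> S"
        proof -
          have "\<exists>u\<in>L. u \<notin> V" if "sufrow V" for V
          proof -
            from that obtain r where r: "r \<in> F0" "overlap r V" by (auto simp: sufrow_def)
            then have "r \<in> R" using RF by simp
            with r R_sub show ?thesis unfolding overlap_def by blast
          qed
          with S T that show thesis by blast
        qed
        have st': "s \<in> S" "t \<in> T" using st LRp cover by blast+
        have lst: "l s = l t" using mix[of s t] st st' by blast
        from inU[OF st(1)] obtain r where r: "r \<in> F0" "s \<in> r" by blast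
        then have tr: "t \<in> r" using twinsD[of s t r] lst st by blast
        have rL: "r \<subseteq> L" using R_sub r RF by blast
        \<comment> \<open>\<open>S\<close> and \<open>T\<close> cover \<open>L\<close>, and each
          element of \<open>L\<close> is at or after \<open>t\<close> or \<open>s\<close>; so these
          two lie in the first class. A row through the first and the last class would be all of
          \<open>L\<close>, which no row can be; hence \<open>p \<notin> r\<close> next.\<close>
        have min: "l s \<le> l v" if "v \<in> L" for v
          using sufD[OF sS, of v t] sufD[OF sT, of v s] st lst that LRp cover by force
        have pr: "p \<notin> r"
        proof
          assume "p \<in> r"
          have "v \<in> r" if "v \<in> L" for v
          proof (cases "l v = l s \<or> l v = l p")
            case True then show ?thesis using twinsD[of v s r] twinsD[of v p r] that st pL r \<open>p \<in> r\<close> by blast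
          next
            case False
            then have "l s < l v" "l v < l p" using min[OF that] Y_le[OF p(1) that] by auto
            moreover have "r \<inter> X = {}" using rL by blast
            ultimately show ?thesis using int[of r s p v] r \<open>p \<in> r\<close> that by blast
          qed
          moreover obtain q where q: "q \<in> F0" "overlap r q" using ov_ex r by blast
          moreover have "q \<subseteq> L" using R_sub q RF by blast
          ultimately show False unfolding overlap_def by blast
        qed
        from ov_ex[OF r(1)] obtain q where q: "q \<in> F0" "overlap r q" by blast
        obtain e where e: "e \<in> r" "\<not> twins F0 s e"
        proof -
          from q obtain a b where "a \<in> r" "a \<in> q" "b \<in> r" "b \<notin> q" by (auto simp: overlap_def)
          then have "\<not> twins F0 s a \<or> \<not> twins F0 s b" using q by (auto simp: twins_def)
          then show thesis using that \<open>a \<in> r\<close> \<open>b \<in> r\<close> by blast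
        qed
        have eL: "e \<in> L" using e rL by blast
        have les: "l e \<noteq> l s" using cls[of s e] e eL st by auto
        have "e \<in> S \<or> e \<in> T" using LRp cover eL by blast
        then have eST: "e \<in> S" "e \<in> T"
          using mix[of e t] mix[of s e] les lst eL st st' by metis+
        have "obst K F"
          by (rule obst_VI[of s K p t e S F T r]) (use F inF r st st' e eST p pr tr eL pK in auto)
        with no show False ..
      qed
    qed
  qed
qed

text \<open>By \<open>same_side_common\<close> the sets share no element of the last class, which
  confines them to \<open>X\<close> and that class. There \<open>S\<close> contains
  \<open>x, p\<close> and \<open>T\<close> contains \<open>y, q\<close>, while no row of
  \<open>F0\<close> tells \<open>x\<close> from \<open>y\<close> or \<open>p\<close> from
  \<open>q\<close>. Rows separating \<open>X\<close> from the last class, with sets overlapping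
  them, complete a pattern with four rows.\<close>

lemma same_side:
  assumes S: "sufrow S" and T: "sufrow T" and x: "x \<in> X" "x \<in> S" "x \<notin> T" and y: "y \<in> X" "y \<in> T" "y \<notin> S"
  shows False
proof -
  have F: "S \<in> F" "T \<in> F" and sS: "suf S" and sT: "suf T"
    and SL: "S \<inter> L \<noteq> {}" "T \<inter> L \<noteq> {}" using S T by (auto simp: sufrow_def)
  from suf_meets_Y[OF sS SL(1)] obtain p where p: "p \<in> Y" "p \<in> S" by blast
  from suf_meets_Y[OF sT SL(2)] obtain q where q: "q \<in> Y" "q \<in> T" by blast
  have pT: "p \<notin> T" and qS: "q \<notin> S" using same_side_common[OF S T x y] p q by blast+
  have SY: "u \<in> Y" if "u \<in> S" "u \<in> L" for u using sufD[OF sS that(2,1), of q] qS q Y_L Y_I that by blast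
  have TY: "u \<in> Y" if "u \<in> T" "u \<in> L" for u using sufD[OF sT that(2,1), of p] pT p Y_L Y_I that by blast
  have inF: "r \<in> F" if "r \<in> F0" for r using that F0 by blast
  have K: "x \<in> K" "y \<in> K" "p \<in> K" "q \<in> K" using x y p q X Y_L by blast+
  have mem: "q \<in> r \<longleftrightarrow> p \<in> r" "x \<in> r \<longleftrightarrow> X \<subseteq> r" "y \<in> r \<longleftrightarrow> X \<subseteq> r" if "r \<in> F0" for r
    using Y_row[OF p(1) q(1) that] XD[OF that] x y by blast+
  have out: "u \<notin> S" "u \<notin> T" if "u \<in> L" "u \<notin> Y" for u using SY TY that by blast+
  have comp: False if "f \<in> F0" "f' \<in> F0" "p \<in> f" "f \<inter> X = {}" "X \<subseteq> f'" "p \<notin> f'" "u \<in> f" "u \<in> f'" for f f' u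
  proof -
    have "u \<in> L" "u \<notin> Y" using that sub Y_row[OF p(1)] by blast+
    then have "obst K F"
      by (intro obst_comp[of p K x y q u S F f T f']) (use that F inF x y p q pT qS K mem out x in auto)
    with no show False ..
  qed
  have V: False if "g \<in> F0" "X \<subseteq> g" "p \<in> g" "f \<in> F0" "u \<in> f" "u \<notin> g" "(p \<in> f) \<noteq> (X \<subseteq> f)" for f g u
  proof -
    have u: "u \<in> L" "u \<notin> Y" using that sub Y_row[OF p(1)] by blast+
    have "obst K F"
    proof (cases "p \<in> f")
      case True
      show ?thesis
        by (rule obst_V[of p K x y q u S F g T f]) (use True that F inF x y p q pT qS K mem out u in auto)
    next
      case False
      show ?thesis
        by (rule obst_V[of x K p q y u S F g T f]) (use False that F inF x y p q pT qS K mem out u in auto)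
    qed
    with no show False ..
  qed
  have IV: False if "f \<in> F0" "h \<in> F0" "c \<in> f" "c \<in> h" "d \<in> h" "d \<notin> f" "p \<notin> h" "\<not> X \<subseteq> h" "(p \<in> f) \<noteq> (X \<subseteq> f)" for f h c d
  proof -
    have "h \<inter> X = {}" using sat that by blast
    then have L: "c \<in> L" "d \<in> L" "c \<notin> Y" "d \<notin> Y" using that sub Y_row[OF p(1)] by blast+
    have "obst K F"
    proof (cases "p \<in> f")
      case True
      show ?thesis
        by (rule obst_IV[of x K p y q d c S F T h f]) (use True that F inF x y p q pT qS K mem out L in auto)
    next
      case False
      show ?thesis
        by (rule obst_IV[of p K x q y d c S F T h f]) (use False that F inF x y p q pT qS K mem out L in auto)
    qed
    with no show False ..
  qed
  have ovD: "\<exists>h c d e. h \<in> F0 \<and> overlap f h \<and> c \<in> f \<and> c \<in> h \<and> d \<in> h \<and> d \<notin> f \<and> e \<in> f \<and> e \<notin> h" if "f \<in> F0" for f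
    using ov_ex[OF that] by (auto simp: overlap_def)
  consider (both) f f' where "f \<in> F0" "p \<in> f" "f \<inter> X = {}" "f' \<in> F0" "X \<subseteq> f'" "p \<notin> f'"
    | (left) f where "f \<in> F0" "p \<in> f" "f \<inter> X = {}" "\<And>g. g \<in> F0 \<Longrightarrow> X \<subseteq> g \<Longrightarrow> p \<in> g"
    | (right) f where "f \<in> F0" "p \<notin> f" "X \<subseteq> f" "\<And>g. g \<in> F0 \<Longrightarrow> p \<in> g \<Longrightarrow> X \<subseteq> g"
    using sep_row[OF Y_L[OF p(1)]] sat by metis
  then show False
  proof cases
    case both
    have fx: "x \<notin> f" "y \<notin> f" using both x y by blast+
    \<comment> \<open>\<open>p, x, y, q\<close> under \<open>S, f', T, f\<close> form a cycle of
      length four, for which an uncovered \<open>u\<close> would be the zero column.\<close>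
    have KK: "u \<in> f \<or> u \<in> f'" if "u \<in> K" for u
    proof (rule ccontr)
      assume n: "\<not> ?thesis"
      then have "u \<in> L" "u \<notin> Y" using that both Y_row[OF p(1)] by blast+
      then have "obst K F"
        by (intro obst_cycle4[of p K x y q S F f' T f u]) (use both F inF x y p q pT qS K mem out n fx in auto)
      with no show False ..
    qed
    have nog: "p \<notin> g" if g: "g \<in> F0" "X \<subseteq> g" for g
    proof
      assume "p \<in> g"
      obtain u where "u \<in> K" "u \<notin> g" using sub g by blast
      then show False using KK[of u] V[of g f u] V[of g f' u] g \<open>p \<in> g\<close> both fx mem by blast
    qed
    from ovD[OF both(1)] obtain h c d where h: "h \<in> F0" "overlap f h" "c \<in> f" "c \<in> h" "d \<in> h" "d \<notin> f" by blast
    have df: "d \<in> f'" using KK[of d] h sub by blast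
    show False
    proof (cases "X \<subseteq> h")
      case True
      then show False using comp[of f h c] nog[of h] h both by blast
    next
      case False
      then have "h \<inter> X = {}" using sat h by blast
      then show False using comp[of h f' d] IV[of f h c d] False h both df fx mem by blast
    qed
  next
    case left
    have fx: "x \<notin> f" "\<not> X \<subseteq> f" using left x by blast+
    from ovD[OF left(1)] obtain h c d e where h: "h \<in> F0" "overlap f h" "c \<in> f" "c \<in> h" "d \<in> h" "d \<notin> f" "e \<in> f" "e \<notin> h" by blast
    show False
    proof (cases "X \<subseteq> h")
      case True
      then show False using V[of h f e] left h fx by blast
    next
      case False
      then have "h \<inter> X = {}" using sat h by blast
      then show False using nested_suf[OF left(1) h(1) left(3) _ p(1) left(2)] IV[of f h c d] False h left fx by blast
    qed
  next
    case right
    from ovD[OF right(1)] obtain h c d e where h: "h \<in> F0" "overlap f h" "c \<in> f" "c \<in> h" "d \<in> h" "d \<notin> f" "e \<in> f" "e \<notin> h" by blast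
    show False
    proof (cases "p \<in> h")
      case True
      then show False using V[of h f e] right h by blast
    next
      case False
      then show False using nested_co[OF right(1) h(1) right(3) _ p(1) right(2)] IV[of f h c d] h right by blast
    qed
  qed
qed

end

section \<open>Two sets leaving the class on opposite sides\<close>

context cut begin

text \<open>By \<open>mix\<close> the walk lies, after its start, entirely in
  \<open>S \<inter> T\<close> or entirely outside \<open>S \<union> T\<close>. In the first case it
  is a staircase with long rows \<open>g\<close> and \<open>T\<close> and column \<open>x\<close>,
  or, for a single step, part of a triangle.\<close>

lemma opposite_side_geodesic:
  assumes S: "S \<in> F" and T: "T \<in> F" and x: "x \<in> X" "x \<in> S" "x \<in> T"
    and mix: "\<And>u v. u \<in> L \<Longrightarrow> v \<in> L \<Longrightarrow> u \<in> S \<Longrightarrow> u \<in> T \<Longrightarrow> v \<notin> S \<Longrightarrow> v \<notin> T \<Longrightarrow> l u = l v"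
    and A: "A = L \<inter> S - T" and sep: "reach R A \<inter> (T - S) = {}"
    and g: "g \<in> F0" "X \<subseteq> g" "\<not> reach R A \<subseteq> g"
  shows "\<exists>m c r. geodesic R A (reach R A - g) m c r \<and> (\<forall>i. 0 < i \<and> i \<le> m \<longrightarrow> c i \<notin> S \<and> c i \<notin> T)"
proof -
  from g(3) obtain w where w: "w \<in> reach R A - g" "w \<in> reach R A" by blast
  from geodesic_exists[OF this] obtain m c r where geo: "geodesic R A (reach R A - g) m c r" by blast
  note gD = geodesicD[OF geo]
  have AL: "A \<subseteq> L" using A by blast
  have cL: "c i \<in> L" and cr: "c i \<in> reach R A" if "i \<le> m" for i
    using geo_L[OF geo AL that] geodesic_reach[OF geo that] by auto
  have c0: "c 0 \<in> S" "c 0 \<notin> T" using gD(1) A by auto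
  have cm: "c m \<notin> g" using gD(2) by auto
  have cg: "c i \<in> g" if "i < m" for i using gD(8)[OF that] cr[of i] that by auto
  have alt: "c i \<in> S \<and> c i \<in> T \<or> c i \<notin> S \<and> c i \<notin> T" if "0 < i" "i \<le> m" for i
    using gD(7)[of i] cL[OF that(2)] cr[OF that(2)] sep that A by blast
  have gF: "g \<in> F" and xg: "x \<in> g" and xK: "x \<in> K" using g F0 x X by auto
  have "(\<forall>i. 0 < i \<and> i \<le> m \<longrightarrow> c i \<in> S \<and> c i \<in> T) \<or> (\<forall>i. 0 < i \<and> i \<le> m \<longrightarrow> c i \<notin> S \<and> c i \<notin> T)"
    by (rule geo_uniform[OF geo AL order_refl, of "\<lambda>u. u \<in> S \<and> u \<in> T" "\<lambda>u. u \<notin> S \<and> u \<notin> T"])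
      (use alt mix in auto)
  moreover have "m = 0" if both: "\<forall>i. 0 < i \<and> i \<le> m \<longrightarrow> c i \<in> S \<and> c i \<in> T"
  proof (rule ccontr)
    assume "m \<noteq> 0"
    have "obst K F"
    proof (cases "m = 1")
      case True
      have r0: "r 0 \<in> F" "c 0 \<in> r 0" "c 1 \<in> r 0" "x \<notin> r 0"
        using True gD(3)[of 0] gD(4)[of 0 0] gD(4)[of 0 1] F0 geo_X[OF geo] x by auto
      \<comment> \<open>\<open>c 0, c 1, x\<close> form a triangle under \<open>r 0\<close>,
        \<open>T\<close>, \<open>g\<close>, and the row \<open>S\<close> contains all three.
        \<open>undefined\<close> fills the slot of the zero column, the other alternative of
        \<open>obst_cycle3\<close>.\<close>
      show ?thesis
        by (rule obst_cycle3[of "c 0" K "c 1" x "r 0" F T g undefined S])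
          (use True r0 S T x both c0 cm cg[of 0] gF xg xK cL[of 0] cL[of 1] in auto)
    next
      case False
      then have m: "2 \<le> m" using \<open>m \<noteq> 0\<close> by simp
      show ?thesis
        by (rule obst_pathI[OF m geo_path[OF geo AL], of g T x])
          (use m T x both c0 cm cg gF xg xK geo_X[OF geo] in auto)
    qed
    with no show False ..
  qed
  ultimately have "\<forall>i. 0 < i \<and> i \<le> m \<longrightarrow> c i \<notin> S \<and> c i \<notin> T" by auto
  with geo show ?thesis by blast
qed

text \<open>The walks are joined through \<open>x\<close> by the rows \<open>S\<close> and
  \<open>T\<close>, giving the staircase \<open>c m, ..., c 0, x, d 0, ..., d n\<close>. The rows
  \<open>g\<close> and \<open>h\<close> contain its inner columns and \<open>y\<close>, while
  \<open>g\<close> misses the first column and \<open>h\<close> the last: \<open>M_II\<close>, or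
  \<open>M_III\<close> if \<open>g = h\<close>.\<close>

lemma opposite_side_join:
  assumes S: "S \<in> F" and T: "T \<in> F" and x: "x \<in> X" "x \<in> S" "x \<in> T" and y: "y \<in> X" "y \<notin> S" "y \<notin> T"
    and A: "A = L \<inter> S - T" and B: "B = L \<inter> T - S" and sep: "reach R A \<inter> reach R B = {}"
    and g: "g \<in> F0" "X \<subseteq> g" and h: "h \<in> F0" "X \<subseteq> h"
    and p: "geodesic R A (reach R A - g) m c r" "\<And>i. 0 < i \<Longrightarrow> i \<le> m \<Longrightarrow> c i \<notin> S \<and> c i \<notin> T"
    and q: "geodesic R B (reach R B - h) n d s" "\<And>i. 0 < i \<Longrightarrow> i \<le> n \<Longrightarrow> d i \<notin> S \<and> d i \<notin> T"
    and gh: "g = h \<or> reach R A \<subseteq> h \<and> reach R B \<subseteq> g"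
  shows False
proof -
  note pD = geodesicD[OF p(1)] and qD = geodesicD[OF q(1)]
  have AL: "A \<subseteq> L" "B \<subseteq> L" using A B by auto
  have K: "x \<in> K" "y \<in> K" using x y X by auto
  have in_gh: "g \<in> F" "h \<in> F" "x \<in> g" "x \<in> h" "y \<in> g" "y \<in> h" using g h F0 x y by auto
  have cR: "c i \<in> reach R A" if "i \<le> m" for i using geodesic_reach[OF p(1) that] .
  have dR: "d i \<in> reach R B" if "i \<le> n" for i using geodesic_reach[OF q(1) that] .
  have rA: "r i \<subseteq> reach R A" if "i < m" for i
    using reach_row[OF cR[of i], of "r i"] pD(3)[OF that] pD(4)[of i i] that by auto
  have sB: "s i \<subseteq> reach R B" if "i < n" for i
    using reach_row[OF dR[of i], of "s i"] qD(3)[OF that] qD(4)[of i i] that by auto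
  have c0: "c 0 \<in> S" "c 0 \<notin> T" using pD(1) A by auto
  have d0: "d 0 \<in> T" "d 0 \<notin> S" using qD(1) B by auto
  have cS: "c j \<in> S \<longleftrightarrow> j = 0" if "j \<le> m" for j using p(2)[of j] c0 that by (cases "j = 0") auto
  have dT: "d j \<in> T \<longleftrightarrow> j = 0" if "j \<le> n" for j using q(2)[of j] d0 that by (cases "j = 0") auto
  have left: "path_rows K F (Suc m) (case_nat x c) (case_nat S r)"
    by (rule path_rows_prepend[OF geo_path[OF p(1) AL(1)] K(1) S x(2) cS]) (use geo_X[OF p(1)] x in auto)
  have right: "path_rows K F (Suc n) (case_nat x d) (case_nat T s)"
    by (rule path_rows_prepend[OF geo_path[OF q(1) AL(2)] K(1) T x(3) dT]) (use geo_X[OF q(1)] x in auto)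
  let ?c1 = "\<lambda>i. case_nat x c (Suc m - i)" and ?r1 = "\<lambda>i. case_nat S r (Suc m - Suc i)"
  let ?c2 = "case_nat x d" and ?r2 = "case_nat T s"
  let ?c = "\<lambda>i. if i \<le> Suc m then ?c1 i else ?c2 (i - Suc m)"
  let ?r = "\<lambda>i. if i < Suc m then ?r1 i else ?r2 (i - Suc m)"
  have dS: "d i \<notin> S" if "i \<le> n" for i using q(2)[of i] d0 that by (cases i) auto
  have cT: "c i \<notin> T" if "i \<le> m" for i using p(2)[of i] c0 that by (cases i) auto
  have P: "path_rows K F (Suc m + Suc n) ?c ?r"
  proof (rule path_rows_join[OF path_rows_rev[OF left] right])
    show "?c2 j \<notin> ?r1 i" if "i < Suc m" "0 < j" "j \<le> Suc n" for i j
    proof -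
      obtain j' where j': "j = Suc j'" "j' \<le> n" using \<open>0 < j\<close> \<open>j \<le> Suc n\<close> by (auto simp: gr0_conv_Suc)
      show ?thesis
      proof (cases "Suc m - Suc i")
        case 0 then show ?thesis using dS j' by auto
      next
        case (Suc k)
        then have "k < m" by auto
        then show ?thesis using Suc j' rA[of k] dR[of j'] sep by auto
      qed
    qed
    show "?c1 j \<notin> ?r2 i" if "i < Suc n" "j < Suc m" for i j
    proof -
      have j': "Suc m - j = Suc (m - j)" "m - j \<le> m" using \<open>j < Suc m\<close> by auto
      show ?thesis
      proof (cases i)
        case 0 then show ?thesis using cT j' by auto
      next
        case (Suc k)
        then have "k < n" using that by auto
        then show ?thesis using Suc j' sB[of k] cR[of "m - j"] sep by auto
      qed
    qed
  qed simp
  have cgh: "c i \<in> g" "c i \<in> h" if "i < m" for i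
    using pD(8)[OF that] cR[of i] that gh by auto
  have dgh: "d i \<in> g" "d i \<in> h" if "i < n" for i
    using qD(8)[OF that] dR[of i] that gh by auto
  have "obst K F"
  proof (rule obst_pathI[OF _ P, of h g y])
    show "y \<notin> ?r i" if "i < Suc m + Suc n" for i
    proof (cases "i < Suc m")
      case True
      show ?thesis
      proof (cases "m - i")
        case 0 then show ?thesis using True y(2) by simp
      next
        case (Suc k) then show ?thesis using True geo_X[OF p(1), of k y] y(1) by simp
      qed
    next
      case False
      then show ?thesis using geo_X[OF q(1), of "i - Suc m - 1" y] y(1,3) that
        by (cases "i - Suc m") auto
    qed
    show "?c j \<in> h \<and> ?c j \<in> g" if j: "0 < j" "j < Suc m + Suc n" for j
    proof (cases "j < Suc m")
      case True
      then have "Suc m - j = Suc (m - j)" "m - j < m" using j(1) by auto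
      then show ?thesis using True cgh[of "m - j"] by auto
    next
      case False
      show ?thesis
      proof (cases "j - Suc m")
        case 0 then show ?thesis using False in_gh by auto
      next
        case (Suc k)
        then have "k < n" using j by auto
        then show ?thesis using Suc False dgh[of k] by auto
      qed
    qed
  qed (use in_gh K pD(2) qD(2) in auto)
  with no show False ..
qed

text \<open>If rows avoiding \<open>X\<close> lead from \<open>S - T\<close> to
  \<open>T - S\<close>, a shortest walk closes through \<open>x\<close> to a cycle with zero column
  \<open>y\<close>, or it is a staircase inside \<open>S \<inter> T\<close> with column
  \<open>x\<close>. Otherwise each difference reaches a part that some row through \<open>X\<close>
  does not contain, as \<open>opposite_side_join\<close> requires.\<close>

lemma opposite_side_diff:
  assumes S: "sufrow S" and T: "prerow T" and x: "x \<in> X" "x \<in> S" "x \<in> T" and y: "y \<in> X" "y \<notin> S" "y \<notin> T"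
    and u0: "u0 \<in> L" "u0 \<in> S" "u0 \<notin> T" and v0: "v0 \<in> L" "v0 \<in> T" "v0 \<notin> S"
  shows False
proof -
  have F: "S \<in> F" "T \<in> F" and sS: "suf S" and sT: "pre T"
    using S T by (auto simp: sufrow_def prerow_def)
  have K: "x \<in> K" "y \<in> K" using x y X by auto
  define A where "A = L \<inter> S - T"
  define B where "B = L \<inter> T - S"
  have AL: "A \<subseteq> L" "B \<subseteq> L" by (auto simp: A_def B_def)
  have mix: "l u = l v" if "u \<in> L" "v \<in> L" "u \<in> S" "u \<in> T" "v \<notin> S" "v \<notin> T" for u v
    using sufD[OF sS, of u v] preD[OF sT, of u v] that by (intro antisym) auto
  show False
  proof (cases "reach R A \<inter> B = {}")
    case False
    then obtain b where "b \<in> B" "b \<in> reach R A" by blast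
    from geodesic_exists[OF this] obtain m c r where g: "geodesic R A B m c r" by blast
    note gD = geodesicD[OF g]
    have c0: "c 0 \<in> S" "c 0 \<notin> T" and cm: "c m \<in> T" "c m \<notin> S" using gD(1,2) by (auto simp: A_def B_def)
    then have m: "m \<noteq> 0" by (cases "m = 0") auto
    have alt: "c i \<in> S \<and> c i \<in> T \<or> c i \<notin> S \<and> c i \<notin> T" if "0 < i" "i \<le> m - 1" for i
      using gD(7)[of i] gD(8)[of i] geo_L[OF g AL(1), of i] that by (auto simp: A_def B_def)
    have "m - 1 \<le> m" by simp
    from geo_uniform[OF g AL(1) this, of "\<lambda>u. u \<in> S \<and> u \<in> T" "\<lambda>u. u \<notin> S \<and> u \<notin> T"] alt mix
    have "(\<forall>i. 0 < i \<and> i \<le> m - 1 \<longrightarrow> c i \<in> S \<and> c i \<in> T) \<or> (\<forall>i. 0 < i \<and> i \<le> m - 1 \<longrightarrow> c i \<notin> S \<and> c i \<notin> T)" by auto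
    moreover have "i \<le> m - 1 \<longleftrightarrow> i < m" for i using m by auto
    ultimately consider (none) "\<And>i. 0 < i \<Longrightarrow> i < m \<Longrightarrow> c i \<notin> S \<and> c i \<notin> T"
      | (both) "2 \<le> m" "\<And>i. 0 < i \<Longrightarrow> i < m \<Longrightarrow> c i \<in> S \<and> c i \<in> T"
      using m by (cases "m = 1") auto
    then have "obst K F"
    proof cases
      case none
      have cS: "c j \<in> S \<longleftrightarrow> j = 0" if "j \<le> m" for j
        using none[of j] c0 cm that by (cases "j = 0"; cases "j = m") auto
      have cT: "c j \<in> T \<longleftrightarrow> j = m" if "j \<le> m" for j
        using none[of j] c0 cm that by (cases "j = 0"; cases "j = m") auto
      have P: "path_rows K F (Suc m) (case_nat x c) (case_nat S r)"
        by (rule path_rows_prepend[OF geo_path[OF g AL(1)] K(1) F(1) x(2) cS]) (use geo_X[OF g] x in auto)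
      show ?thesis
      proof (rule obst_cycle_pathI[OF P _ F(2), of y])
        show "case_nat x c j \<in> T \<longleftrightarrow> j = 0 \<or> j = Suc m" if "j \<le> Suc m" for j
          using that cT x by (cases j) auto
        show "y \<in> K \<and> y \<notin> T \<and> (\<forall>i<Suc m. y \<notin> case_nat S r i) \<or> {} \<in> F \<and> (\<forall>j\<le>Suc m. case_nat x c j \<in> {})"
          using K y geo_X[OF g] by (auto split: nat.split)
      qed (use m in simp)
    next
      case both
      show ?thesis
        by (rule obst_pathI[OF both(1) geo_path[OF g AL(1)], of S T x])
          (use both F x K geo_X[OF g] c0 cm in auto)
    qed
    with no show False ..
  next
    case sepB: True
    have sep: "reach R A \<inter> reach R B = {}"
    proof (rule ccontr)
      assume "\<not> ?thesis"
      then obtain w where w: "w \<in> reach R A" "w \<in> reach R B" by blast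
      from reach_from[OF w(2)] obtain b where b: "b \<in> B" "w \<in> reach R {b}" by blast
      have "b \<in> reach R A" by (rule reach_trans[OF reach_sym[OF b(2)]]) (use w in simp)
      with b sepB show False by blast
    qed
    have sepA: "reach R A \<inter> (T - S) = {}" using sepB reach_L[OF AL(1)] by (auto simp: B_def)
    have sepB': "reach R B \<inter> (S - T) = {}"
    proof -
      have "u \<in> reach R A" if "u \<in> L \<inter> S - T" for u using that by (auto simp: A_def intro: reach.base)
      then show ?thesis using sep reach_L[OF AL(2)] by blast
    qed
    obtain g0 where g0: "g0 \<in> F0" "X \<subseteq> g0"
    proof (rule ccontr)
      assume n: "\<not> thesis"
      then have RF: "R = F0" using sat that by blast
      have "\<exists>r\<in>F0. u \<in> r" if "u \<in> L" for u using sep_row[OF that] n \<open>\<And>g0. g0 \<in> F0 \<Longrightarrow> X \<subseteq> g0 \<Longrightarrow> thesis\<close> by metis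
      then have "v0 \<in> reach F0 {u0}" using reach_conn[OF F0(2), of u0] u0 v0 by blast
      then have "v0 \<in> reach R A" unfolding RF by (rule reach_trans) (use u0 in \<open>auto simp: A_def intro: reach.base\<close>)
      then show False using sepB v0 by (auto simp: B_def)
    qed
    have uA: "u0 \<in> A" and vB: "v0 \<in> B" using u0 v0 by (auto simp: A_def B_def)
    from leave1[OF u0(1) g0 uA] obtain g where g: "g \<in> F0" "X \<subseteq> g" "\<not> reach R A \<subseteq> g" by blast
    from leave1[OF v0(1) g0 vB] obtain h where h: "h \<in> F0" "X \<subseteq> h" "\<not> reach R B \<subseteq> h" by blast
    \<comment> \<open>If one of the two rows also fails to contain the other reachable part, it
      serves as both \<open>g'\<close> and \<open>h'\<close>.\<close>
    obtain g' h' where gh: "g' \<in> F0" "X \<subseteq> g'" "\<not> reach R A \<subseteq> g'" "h' \<in> F0" "X \<subseteq> h'" "\<not> reach R B \<subseteq> h'"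
      "g' = h' \<or> reach R A \<subseteq> h' \<and> reach R B \<subseteq> g'"
    proof (cases "reach R B \<subseteq> g")
      case True
      show thesis
      proof (cases "reach R A \<subseteq> h")
        case True with \<open>reach R B \<subseteq> g\<close> show thesis using that[of g h] g h by blast
      next
        case False then show thesis using that[of h h] h by blast
      qed
    next
      case False then show thesis using that[of g g] g by blast
    qed
    from opposite_side_geodesic[OF F x mix A_def sepA gh(1,2,3)]
    obtain m c r where p: "geodesic R A (reach R A - g') m c r" "\<forall>i. 0 < i \<and> i \<le> m \<longrightarrow> c i \<notin> S \<and> c i \<notin> T" by blast
    have "l u = l v" if "u \<in> L" "v \<in> L" "u \<in> T" "u \<in> S" "v \<notin> T" "v \<notin> S" for u v using mix that by blast
    from opposite_side_geodesic[OF F(2,1) x(1,3,2) this B_def sepB' gh(4,5,6)]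
    obtain n d s where q: "geodesic R B (reach R B - h') n d s" "\<forall>i. 0 < i \<and> i \<le> n \<longrightarrow> d i \<notin> T \<and> d i \<notin> S" by blast
    show False
      by (rule opposite_side_join[OF F x y A_def B_def sep gh(1,2,4,5) p(1) _ q(1) _ gh(7)]) (use p q in auto)
  qed
qed

text \<open>\<open>T\<close> is an initial segment containing an element \<open>p\<close> of the
  last class, so it lacks at most elements of that class. This makes \<open>T\<close> large enough
  to be the full row of a cycle or the long row of \<open>M_V\<close>.\<close>

lemma opposite_side_sub:
  assumes S: "sufrow S" and T: "prerow T" and x: "x \<in> X" "x \<in> S" "x \<in> T" and y: "y \<in> X" "y \<notin> S" "y \<notin> T"
    and ST: "S \<inter> L \<subseteq> T"
  shows False
proof -
  have F: "S \<in> F" "T \<in> F" and sS: "suf S" and sT: "pre T" and SL: "S \<inter> L \<noteq> {}"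
    using S T by (auto simp: sufrow_def prerow_def)
  have K: "x \<in> K" "y \<in> K" using x y X by auto
  have inF: "r \<in> F" if "r \<in> F0" for r using that F0 by blast
  from suf_meets_Y[OF sS SL] obtain p where p: "p \<in> Y" "p \<in> S" by blast
  have pL: "p \<in> L" using p Y_L by blast
  have pT: "p \<in> T" using p pL ST by blast
  have TY: "w \<in> Y" if "w \<in> L" "w \<notin> T" for w using preD[OF sT pL pT that] Y_I[OF p(1) that(1)] by blast
  \<comment> \<open>If \<open>p\<close> lay in \<open>g\<close>, then, as
    \<open>g \<inter> T\<close> is an initial segment, an element missing from \<open>g\<close>
    would lie in the last class, which no row of \<open>F0\<close> splits.\<close>
  have nog: "p \<notin> g" if g: "g \<in> F0" "X \<subseteq> g" for g
  proof
    assume pg: "p \<in> g"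
    obtain w where w: "w \<in> K" "w \<notin> g" using sub g by blast
    then have wL: "w \<in> L" using g by blast
    have "pre (g \<inter> T)" using T g by (auto simp: prerow_def)
    then have "w \<in> Y" using preD[of "g \<inter> T" p w] pL pg pT wL w Y_I[OF p(1) wL] by blast
    then show False using Y_row[OF p(1)] g pg w by blast
  qed
  show False
  proof (cases "\<exists>g\<in>F0. X \<subseteq> g")
    case False
    then have RF: "R = F0" using sat by blast
    from T obtain r0 where r0: "r0 \<in> F0" "overlap r0 T" by (auto simp: prerow_def)
    then obtain p' where p': "p' \<in> L" "p' \<notin> T" using R_sub RF unfolding overlap_def by blast
    have p'Y: "p' \<in> Y" using TY p' by blast
    have p'S: "p' \<notin> S" using p' ST by blast
    have SY: "u \<in> Y" if "u \<in> S" "u \<in> L" for u using sufD[OF sS that(2,1) p'(1) p'S] Y_I[OF p'Y that(2)] by blast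
    obtain f where f: "f \<in> F0" "p \<in> f" using sep_row[OF pL] False by metis
    from ov_ex[OF f(1)] obtain h where h: "h \<in> F0" "overlap f h" by blast
    then obtain c d where cd: "c \<in> f" "c \<in> h" "d \<in> h" "d \<notin> f" by (auto simp: overlap_def)
    have fh: "f \<inter> X = {}" "h \<inter> X = {}" using RF f h by blast+
    have ph: "p \<notin> h" using nested_suf[OF f(1) h(1) fh p(1) f(2)] h by blast
    have L: "c \<in> L" "d \<in> L" using cd sub f h fh by blast+
    have nY: "c \<notin> Y" "d \<notin> Y" using Y_row[OF p(1)] ph h cd by blast+
    have nS: "c \<notin> S" "d \<notin> S" "c \<in> T" "d \<in> T" using SY TY L nY by blast+
    have "p' \<in> f" "p' \<notin> h" using Y_row[OF p(1) p'Y] f h ph by blast+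
    then have "obst K F"
      by (intro obst_V[of p K x d c p' S F T h f]) (use F inF f h x p pT cd L nS p' p'S ph fh K pL in auto)
    with no show False ..
  next
    case True
    then obtain g0 where g0: "g0 \<in> F0" "X \<subseteq> g0" by blast
    define GU where "GU = {u\<in>L. \<exists>g\<in>F0. X \<subseteq> g \<and> u \<in> g}"
    define A where "A = S \<inter> L"
    have AL: "A \<subseteq> L" by (auto simp: A_def)
    have GUY: "u \<notin> Y" if "u \<in> GU" for u using that nog Y_row[OF p(1)] by (auto simp: GU_def)
    show False
    proof (cases "GU \<inter> reach R A = {}")
      case False
      then obtain b where "b \<in> GU" "b \<in> reach R A" by blast
      from geodesic_exists[OF this] obtain m c r where geo: "geodesic R A GU m c r" by blast
      note gD = geodesicD[OF geo]
      obtain g where g: "g \<in> F0" "X \<subseteq> g" "c m \<in> g" using gD(2) by (auto simp: GU_def)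
      have cL: "c i \<in> L" if "i \<le> m" for i using geo_L[OF geo AL that] .
      have c0: "c 0 \<in> S" "c 0 \<in> L" using gD(1) by (auto simp: A_def)
      have m: "m \<noteq> 0"
      proof
        assume m0: "m = 0"
        have "suf (g \<inter> S)" using S g by (auto simp: sufrow_def)
        then have "l p \<le> l (c 0)" using sufD[of "g \<inter> S" "c 0" p] c0 g m0 pL nog[OF g(1,2)] by auto
        then have "c 0 \<in> Y" using Y_I[OF p(1) c0(2)] by blast
        then show False using GUY[OF gD(2)] m0 by auto
      qed
      have cg: "c j \<in> g \<longleftrightarrow> j = m" if "j \<le> m" for j
        using gD(8)[of j] cL[OF that] g that by (cases "j = m") (auto simp: GU_def)
      have cS: "c j \<in> S \<longleftrightarrow> j = 0" if "j \<le> m" for j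
        using gD(7)[of j] cL[OF that] c0 that by (cases "j = 0") (auto simp: A_def)
      have cT: "c j \<in> T" if "j \<le> m" for j
      proof (rule ccontr)
        assume n: "c j \<notin> T"
        then have cY: "c j \<in> Y" using TY cL that by blast
        have "j \<noteq> m" using GUY[OF gD(2)] cY by blast
        then have jm: "j < m" using that by simp
        have j0: "0 < j" using n c0 ST by (cases "j = 0") auto
        have "r j \<in> F0" "c j \<in> r j" using gD(3)[OF jm] gD(4)[of j j] jm by auto
        then have "p \<in> A \<inter> r j" using Y_row[OF p(1) cY] p pL by (auto simp: A_def)
        with gD(5)[OF jm j0] show False by blast
      qed
      have P: "path_rows K F (Suc m) (case_nat x c) (case_nat S r)"
        by (rule path_rows_prepend[OF geo_path[OF geo AL] K(1) F(1) x(2) cS]) (use geo_X[OF geo] x in auto)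
      \<comment> \<open>The cycle \<open>x, c 0, ..., c m\<close> is closed by \<open>g\<close>, and
        \<open>T\<close> contains all its columns. \<open>undefined\<close> fills the slot of the
        zero column.\<close>
      have "obst K F"
      proof (rule obst_cycle_pathI[OF P _ inF[OF g(1)], of undefined T])
        show "case_nat x c j \<in> g \<longleftrightarrow> j = 0 \<or> j = Suc m" if "j \<le> Suc m" for j
          using that cg g x by (cases j) auto
        show "undefined \<in> K \<and> undefined \<notin> g \<and> (\<forall>i<Suc m. undefined \<notin> case_nat S r i) \<or> T \<in> F \<and> (\<forall>j\<le>Suc m. case_nat x c j \<in> T)"
          using F cT x by (auto split: nat.split)
      qed (use m in simp)
      with no show False ..
    next
      case sep: True
      \<comment> \<open>An element of \<open>S\<close> outside \<open>X\<close> lies in no row of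
        \<open>F0\<close>: a row through \<open>X\<close> would put it into \<open>GU\<close>, and
        by \<open>leave\<close> any other row would lead to an element of \<open>GU\<close>.\<close>
      have nU: "u \<notin> r" if u: "u \<in> A" and r: "r \<in> F0" for u r
      proof
        assume ur: "u \<in> r"
        have uL: "u \<in> L" using u by (simp add: A_def)
        show False
        proof (cases "X \<subseteq> r")
          case True
          then have "u \<in> GU" using uL r ur by (auto simp: GU_def)
          then show False using sep reach.base[OF u, of R] by blast
        next
          case False
          then have "r \<in> R" using sat r by blast
          from leave[OF this ur reach.base[OF u] g0] reach_L[OF AL] sep show False by (auto simp: GU_def)
        qed
      qed
      have pA: "p \<in> A" using p pL by (simp add: A_def)
      from ov_ex[OF g0(1)] obtain h where h: "h \<in> F0" "overlap g0 h" by blast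
      then obtain c d where cd: "c \<in> g0" "c \<in> h" "d \<in> h" "d \<notin> g0" by (auto simp: overlap_def)
      have "\<not> X \<subseteq> h" using nested_co[OF g0(1) h(1) g0(2) _ p(1)] nog g0 h by blast
      then have hX: "h \<inter> X = {}" using sat h by blast
      have L: "c \<in> L" "d \<in> L" using cd h hX sub by blast+
      have nS: "c \<notin> S" "d \<notin> S" using nU[of c h] nU[of d h] h cd L by (auto simp: A_def)
      have ph: "p \<notin> h" "p \<notin> g0" using nU pA h g0 by blast+
      have "c \<notin> Y" "d \<notin> Y" using Y_row[OF p(1)] ph h cd by blast+
      then have cdT: "c \<in> T" "d \<in> T" using TY L by blast+
      have xy: "x \<in> g0" "y \<in> g0" "x \<notin> h" "y \<notin> h" using g0 x y hX by auto
      have "obst K F"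
        by (rule obst_V[of x K p d c y S F T h g0]) (use F inF g0 h x y p pT cd L nS cdT ph K pL xy in auto)
      with no show False ..
    qed
  qed
qed

lemma rev:
  "cut.sufrow K F0 F X (\<lambda>v. - l v) A \<longleftrightarrow> prerow A" "cut.prerow K F0 F X (\<lambda>v. - l v) A \<longleftrightarrow> sufrow A"
proof -
  interpret rev: cut K F0 F X "\<lambda>v. - l v" by (rule cut_rev)
  have "rev.suf B \<longleftrightarrow> pre B" "rev.pre B \<longleftrightarrow> suf B" for B
    unfolding rev.suf_def rev.pre_def suf_def pre_def by auto
  then show "rev.sufrow A \<longleftrightarrow> prerow A" "rev.prerow A \<longleftrightarrow> sufrow A"
    unfolding rev.sufrow_def rev.prerow_def sufrow_def prerow_def by simp_all
qed

lemma opposite_side: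
  assumes S: "sufrow S" and T: "prerow T" and x: "x \<in> X" "x \<in> S" "x \<in> T" and y: "y \<in> X" "y \<notin> S" "y \<notin> T"
  shows False
proof -
  interpret rev: cut K F0 F X "\<lambda>v. - l v" by (rule cut_rev)
  consider "S \<inter> L \<subseteq> T" | "T \<inter> L \<subseteq> S"
    | u0 v0 where "u0 \<in> L" "u0 \<in> S" "u0 \<notin> T" "v0 \<in> L" "v0 \<in> T" "v0 \<notin> S" by blast
  then show False
  proof cases
    case 1 then show ?thesis using opposite_side_sub[OF S T x y] by blast
  next
    case 2
    then show ?thesis using rev.opposite_side_sub[of T S x y] S T x y rev by blast
  next
    case 3 then show ?thesis using opposite_side_diff[OF S T x y] by blast
  qed
qed

lemma same_side_pre:
  assumes "prerow S" "prerow T" "x \<in> X" "x \<in> S" "x \<notin> T" "y \<in> X" "y \<in> T" "y \<notin> S"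
  shows False
proof -
  interpret rev: cut K F0 F X "\<lambda>v. - l v" by (rule cut_rev)
  show False by (rule rev.same_side[of S T x y]) (use assms rev in auto)
qed

end

section \<open>Existence of circular orders\<close>

lemma bounded_int_fun:
  fixes h :: "'v \<Rightarrow> int"
  assumes "finite K" obtains N where "\<And>v. v \<in> K \<Longrightarrow> \<bar>h v\<bar> < N"
proof -
  have "\<bar>h v\<bar> \<le> (\<Sum>v\<in>K. \<bar>h v\<bar>)" if "v \<in> K" for v
    using assms that by (intro member_le_sum) auto
  then show thesis by (intro that[of "(\<Sum>v\<in>K. \<bar>h v\<bar>) + 1"]) force
qed

text \<open>Cutting the circle at the class of \<open>x\<close> turns \<open>h\<close> into a linear order on the other classes.\<close>

lemma cut_exists:
  assumes fin: "finite K" and no: "\<not> obst K F" and F0: "F0 \<subseteq> F" "ov_conn F0" "card F0 \<ge> 2"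
    and sub: "\<And>r. r \<in> F0 \<Longrightarrow> r \<subseteq> K \<and> r \<noteq> K" and ex: "exact K F0 h" and good: "circ_good K F0 h"
    and x: "x \<in> K"
  obtains l where "cut K F0 F {v\<in>K. h v = h x} l"
    "\<And>u v. u \<in> K \<Longrightarrow> v \<in> K \<Longrightarrow> h u \<noteq> h x \<Longrightarrow> h v \<noteq> h x \<Longrightarrow> l u < l v \<Longrightarrow> cyc h x u v"
proof -
  obtain N where N: "\<And>v. v \<in> K \<Longrightarrow> \<bar>h v\<bar> < N" using bounded_int_fun[OF fin] by blast
  define l where "l v = (if h v \<ge> h x then h v - h x else h v - h x + 2 * N)" for v
  let ?X = "{v\<in>K. h v = h x}"
  have l_cyc: "cyc h x u v" if "u \<in> K" "v \<in> K" "h u \<noteq> h x" "h v \<noteq> h x" "l u < l v" for u v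
    using that N[of u] N[of v] N[OF x] unfolding l_def cyc_def by (auto split: if_splits)
  have l_eq: "l u = l v \<longleftrightarrow> h u = h v" if "u \<in> K" "v \<in> K" for u v
    using that N[of u] N[of v] N[OF x] unfolding l_def by auto
  have mem: "v \<in> r \<longleftrightarrow> x \<in> r" if "v \<in> ?X" "r \<in> F0" for v r
    using exactD[OF ex _ x, of v] that by (auto simp: twins_def)
  have "cut K F0 F ?X l"
  proof
    show "finite K" "\<not> obst K F" "F0 \<subseteq> F" "ov_conn F0" "2 \<le> card F0" by fact+
    show "r \<subseteq> K \<and> r \<noteq> K" if "r \<in> F0" for r using sub that .
    show "?X \<subseteq> K" "?X \<noteq> {}" using x by auto
    show "?X \<subseteq> r \<or> r \<inter> ?X = {}" if "r \<in> F0" for r using mem[OF _ that] by blast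
    show "l u = l v \<longleftrightarrow> twins F0 u v" if "u \<in> K - ?X" "v \<in> K - ?X" for u v
      using l_eq exactD[OF ex] that by simp
    show "\<not> twins F0 u v" if "u \<in> ?X" "v \<in> K - ?X" for u v
      using exactD[OF ex, of u v] that by auto
    fix r a b c assume r: "r \<in> F0"
    note arc = circ_good_arc1[OF good r]
    show "b \<in> r" if "r \<inter> ?X = {}" "a \<in> r" "c \<in> r" "b \<in> K - ?X" "l a < l b" "l b < l c"
    proof (rule ccontr)
      assume "b \<notin> r"
      have "a \<in> K" "c \<in> K" "x \<notin> r" "h a \<noteq> h x" "h c \<noteq> h x" using that sub[OF r] x by blast+
      then show False
        using is_arc_outD[OF arc l_cyc[of a b] l_cyc[of b c]] that \<open>b \<notin> r\<close> x by auto
    qed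
    show "b \<notin> r" if "?X \<subseteq> r" "a \<in> K - r" "c \<in> K - r" "b \<in> K - ?X" "l a < l b" "l b < l c"
    proof
      assume "b \<in> r"
      have "x \<in> r" "h a \<noteq> h x" "h c \<noteq> h x" using that x by auto
      then show False
        using is_arcD[OF arc l_cyc[of a b] l_cyc[of b c]] that \<open>b \<in> r\<close> x by auto
    qed
  next
    from F0(2) obtain r where r: "r \<in> F0" by (auto simp: ov_conn_def)
    with ov_conn_overlap_exists[OF F0(2,3)] obtain s where s: "s \<in> F0" "overlap r s" by blast
    then obtain a b c where abc: "a \<in> r - s" "b \<in> r \<inter> s" "c \<in> s - r" by (auto simp: overlap_def)
    then have K: "a \<in> K" "b \<in> K" "c \<in> K" using r s sub by blast+
    have "h a \<noteq> h b" "h b \<noteq> h c" "h a \<noteq> h c"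
      using exactD[OF ex] K abc r s by (auto simp: twins_def)
    then show "\<exists>u\<in>K - ?X. \<exists>v\<in>K - ?X. l u \<noteq> l v"
      using K l_eq by (metis (mono_tags, lifting) DiffI mem_Collect_eq)
  qed
  with l_cyc that show thesis by blast
qed

lemma cyc_lift:
  assumes "cyc h u a b" "h x = h u" and s: "\<And>v. s v = 0 \<or> s v = (1::int)"
  shows "cyc (\<lambda>v. 2 * h v + s v) x a b"
  using assms(1,2) s[of a] s[of b] s[of x] unfolding cyc_def by (smt (verit))

lemma cyc_lift1:
  assumes "h x = h y" "h a \<noteq> h y" "s x < s y" and s: "\<And>v. s v = 0 \<or> s v = (1::int)"
  shows "cyc (\<lambda>v. 2 * h v + s v) x y a"
  using assms(1-3) s[of a] s[of y] s[of x] unfolding cyc_def by (smt (verit))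

text \<open>The circle is cut at the class of \<open>u\<close> and \<open>v\<close>. Each of
  \<open>S\<close>, \<open>T\<close> becomes a final or an initial segment according to whether its
  element of the pair comes first or second in its own refinement. As the two refinements order the
  pair oppositely, the sets are on opposite sides if they contain the same element of the pair, and
  on the same side otherwise.\<close>

lemma clash:
  assumes fin: "finite K" and no: "\<not> obst K F" and F0: "F0 \<subseteq> F" "ov_conn F0" "card F0 \<ge> 2"
    and sub: "\<And>r. r \<in> F0 \<Longrightarrow> r \<subseteq> K \<and> r \<noteq> K" and ex: "exact K F0 h" and good: "circ_good K F0 h"
    and S: "S \<in> F" "S \<subseteq> K" "\<exists>r\<in>F0. overlap r S" and T: "T \<in> F" "T \<subseteq> K" "\<exists>r\<in>F0. overlap r T"
    and sg: "\<And>v. sS v = 0 \<or> sS v = (1::int)" "\<And>v. sT v = 0 \<or> sT v = (1::int)"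
    and gS: "circ_good K (insert S F0) (\<lambda>v. 2 * h v + sS v)" and gT: "circ_good K (insert T F0) (\<lambda>v. 2 * h v + sT v)"
    and uv: "u \<in> K" "v \<in> K" "h u = h v" "sS u < sS v" "sT v < sT u" "(u \<in> S) \<noteq> (v \<in> S)" "(u \<in> T) \<noteq> (v \<in> T)"
  shows False
proof -
  let ?X = "{w\<in>K. h w = h u}"
  obtain l where cut: "cut K F0 F ?X l"
    and lc: "\<And>a b. a \<in> K \<Longrightarrow> b \<in> K \<Longrightarrow> h a \<noteq> h u \<Longrightarrow> h b \<noteq> h u \<Longrightarrow> l a < l b \<Longrightarrow> cyc h u a b"
    using cut_exists[OF fin no F0 sub ex good uv(1)] by blast
  interpret cut K F0 F ?X l by fact
  have mono: "cyc (\<lambda>v. 2 * h v + s v) x a b"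
    if "\<And>v. s v = 0 \<or> s v = (1::int)" "a \<in> K" "b \<in> K" "h a \<noteq> h u" "h b \<noteq> h u" "l a < l b" "h x = h u" for s x a b
    by (rule cyc_lift[OF lc[OF that(2-6)] that(7,1)])
  have mono1: "cyc (\<lambda>v. 2 * h v + s v) x y a"
    if "\<And>v. s v = 0 \<or> s v = (1::int)" "a \<in> K" "h a \<noteq> h u" "h x = h u" "h y = h u" "s x < s y" for s x y a
    by (rule cyc_lift1[OF _ _ that(6,1)]) (use that in auto)
  \<comment> \<open>On the circle \<open>x\<close> comes first, then \<open>y\<close>, then the
    line. An element of \<open>A\<close> preceding one outside \<open>A\<close> on the line would
    alternate with \<open>x\<close> and \<open>y\<close>.\<close>
  have sufI: "suf A" if "is_arc K (\<lambda>v. 2 * h v + s v) A" "\<And>v. s v = 0 \<or> s v = (1::int)"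
    "x \<in> ?X" "y \<in> ?X" "s x < s y" "x \<in> A" "y \<notin> A" for A s x y
    unfolding suf_def
  proof (intro ballI, rule ccontr)
    fix a b assume ab: "a \<in> L \<inter> A" "b \<in> L - A" "\<not> l b \<le> l a"
    then have "a \<in> K" "b \<in> K" "h a \<noteq> h u" "h b \<noteq> h u" "l a < l b" "h x = h u" "h y = h u" using that by auto
    from is_arcD[OF that(1) mono1[OF that(2) this(1,3,6,7) that(5)] mono[OF that(2) this(1-6)]] that ab
    show False by auto
  qed
  have preI: "pre A" if "is_arc K (\<lambda>v. 2 * h v + s v) A" "\<And>v. s v = 0 \<or> s v = (1::int)"
    "x \<in> ?X" "y \<in> ?X" "s y < s x" "x \<in> A" "y \<notin> A" for A s x y
    unfolding pre_def
  proof (intro ballI, rule ccontr)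
    fix a b assume ab: "a \<in> L \<inter> A" "b \<in> L - A" "\<not> l a \<le> l b"
    then have "b \<in> K" "a \<in> K" "h b \<noteq> h u" "h a \<noteq> h u" "l b < l a" "h y = h u" "h x = h u" using that by auto
    from is_arc_outD[OF that(1) mono1[OF that(2) this(1,3,6,7) that(5)] mono[OF that(2) this(1-6)]] that ab
    show False by auto
  qed
  have VL: "V \<inter> L \<noteq> {}" if "\<exists>r\<in>F0. overlap r V" "V \<subseteq> K" for V
  proof -
    from that obtain r s1 s2 where "r \<in> F0" "s1 \<in> r" "s1 \<in> V" "s2 \<notin> r" "s2 \<in> V" by (auto simp: overlap_def)
    then show ?thesis using sat[of r] that(2) by blast
  qed
  have srow: "sufrow V" if "V \<in> F" "V \<subseteq> K" "\<exists>r\<in>F0. overlap r V" "circ_good K (insert V F0) (\<lambda>v. 2 * h v + s v)"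
    "\<And>v. s v = 0 \<or> s v = (1::int)" "x \<in> ?X" "y \<in> ?X" "s x < s y" "x \<in> V" "y \<notin> V" for V s x y
  proof -
    have "suf V" using sufI[OF circ_good_arc1[OF that(4)] that(5-10)] by blast
    moreover have "suf (r \<inter> V)" if r: "r \<in> F0" "?X \<subseteq> r" for r
    proof -
      have "is_arc K (\<lambda>v. 2 * h v + s v) (r \<inter> V)" using circ_good_arc[OF \<open>circ_good K (insert V F0) _\<close>] r by blast
      from sufI[OF this \<open>\<And>v. s v = 0 \<or> s v = 1\<close> \<open>x \<in> ?X\<close> \<open>y \<in> ?X\<close> \<open>s x < s y\<close>] \<open>x \<in> V\<close> \<open>y \<notin> V\<close> \<open>x \<in> ?X\<close> r show ?thesis by blast
    qed
    ultimately show ?thesis unfolding sufrow_def using that VL by blast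
  qed
  have prow: "prerow V" if "V \<in> F" "V \<subseteq> K" "\<exists>r\<in>F0. overlap r V" "circ_good K (insert V F0) (\<lambda>v. 2 * h v + s v)"
    "\<And>v. s v = 0 \<or> s v = (1::int)" "x \<in> ?X" "y \<in> ?X" "s y < s x" "x \<in> V" "y \<notin> V" for V s x y
  proof -
    have "pre V" using preI[OF circ_good_arc1[OF that(4)] that(5-10)] by blast
    moreover have "pre (r \<inter> V)" if r: "r \<in> F0" "?X \<subseteq> r" for r
    proof -
      have "is_arc K (\<lambda>v. 2 * h v + s v) (r \<inter> V)" using circ_good_arc[OF \<open>circ_good K (insert V F0) _\<close>] r by blast
      from preI[OF this \<open>\<And>v. s v = 0 \<or> s v = 1\<close> \<open>x \<in> ?X\<close> \<open>y \<in> ?X\<close> \<open>s y < s x\<close>] \<open>x \<in> V\<close> \<open>y \<notin> V\<close> \<open>x \<in> ?X\<close> r show ?thesis by blast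
    qed
    ultimately show ?thesis unfolding prerow_def using that VL by blast
  qed
  have X: "u \<in> ?X" "v \<in> ?X" using uv by auto
  show False
  proof (cases "u \<in> S")
    case uS: True
    then have vS: "v \<notin> S" using uv by blast
    have s: "sufrow S" by (rule srow[OF S gS sg(1) X uv(4) uS vS])
    show False
    proof (cases "u \<in> T")
      case True
      then have "prerow T" using prow[OF T gT sg(2) X uv(5)] uv by blast
      then show False using opposite_side[OF s _ X(1) uS True X(2) vS] True uv by blast
    next
      case False
      then have "sufrow T" using srow[OF T gT sg(2) X(2,1) uv(5)] uv by blast
      then show False using same_side[OF s _ X(1) uS False X(2)] False vS uv by blast
    qed
  next
    case uS: False
    then have vS: "v \<in> S" using uv by blast
    have s: "prerow S" by (rule prow[OF S gS sg(1) X(2,1) uv(4) vS uS])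
    show False
    proof (cases "u \<in> T")
      case True
      then have "prerow T" using prow[OF T gT sg(2) X uv(5)] uv by blast
      then show False using same_side_pre[OF s _ X(2) vS _ X(1) True uS] True uv by blast
    next
      case False
      then have "sufrow T" using srow[OF T gT sg(2) X(2,1) uv(5)] uv by blast
      then show False using opposite_side[OF _ s X(2) _ vS X(1) False uS] False uv by blast
    qed
  qed
qed

lemma circ_good_connected:
  assumes fin: "finite K" "finite F" and no: "\<not> obst K F" and sub: "\<And>r. r \<in> F \<Longrightarrow> r \<subseteq> K \<and> r \<noteq> K"
    and conn: "ov_conn F" and card: "card F \<ge> 4" and IH: "\<And>G. G \<subset> F \<Longrightarrow> \<exists>f. circ_good K G f"
  shows "\<exists>f. circ_good K F f"
proof -
  have "card F \<ge> 3" using card by simp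
  from ov_conn_two_removable[OF conn fin(2) this] obtain S T a b where
    ST: "S \<in> F" "T \<in> F" "S \<noteq> T" and c0: "ov_conn (F - {S, T})" and
    ab: "a \<in> F - {S, T}" "overlap a S" "b \<in> F - {S, T}" "overlap b T" by metis
  define F0 where "F0 = F - {S, T}"
  have F0: "F0 \<subseteq> F" "ov_conn F0" and F: "F = insert S (insert T F0)" and SF: "S \<notin> F0" "T \<notin> F0"
    using c0 ST by (auto simp: F0_def)
  have cF0: "card F0 \<ge> 2" using card ST fin by (simp add: F0_def card_Diff_subset)
  have sub0: "r \<subseteq> K \<and> r \<noteq> K" if "r \<in> F0" for r using sub that F0 by blast
  have SK: "S \<subseteq> K" "T \<subseteq> K" using sub ST by auto
  have ovs: "\<exists>r\<in>F0. overlap r S" "\<exists>r\<in>F0. overlap r T" using ab by (auto simp: F0_def)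
  obtain gS where gS: "circ_good K (insert S F0) gS" using IH[of "insert S F0"] F SF ST by auto
  obtain gT where gT: "circ_good K (insert T F0) gT" using IH[of "insert T F0"] F SF ST by auto
  have "finite F0" using fin F0 finite_subset by blast
  from rigid_exists[OF this F0(2) cF0 sub0 circ_good_subset[OF gS]] obtain h where h: "rigid K F0 h" by blast
  then have ex: "exact K F0 h" and good: "circ_good K F0 h" by (auto simp: rigid_def)
  have extS: "rigid_ext K F0 S h" and extT: "rigid_ext K F0 T h"
    using F0 cF0 sub0 SK ex ovs by unfold_locales auto
  obtain sS where sS: "\<And>v. sS v = 0 \<or> sS v = (1::int)"
    "\<And>u v. u \<in> K \<Longrightarrow> v \<in> K \<Longrightarrow> h u = h v \<Longrightarrow> sS u = sS v \<longleftrightarrow> (u \<in> S \<longleftrightarrow> v \<in> S)"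
    and gS': "circ_good K (insert S F0) (\<lambda>v. 2 * h v + sS v)"
    by (rule rigid_ext.side_exists[OF extS h gS]) (rule that)
  obtain sT where sT: "\<And>v. sT v = 0 \<or> sT v = (1::int)"
    "\<And>u v. u \<in> K \<Longrightarrow> v \<in> K \<Longrightarrow> h u = h v \<Longrightarrow> sT u = sT v \<longleftrightarrow> (u \<in> T \<longleftrightarrow> v \<in> T)"
    and gT': "circ_good K (insert T F0) (\<lambda>v. 2 * h v + sT v)"
    by (rule rigid_ext.side_exists[OF extT h gT]) (rule that)
  define j where "j v = 3 * h v + sS v + sT v" for v
  have j_eq: "h u = h v \<and> sS u + sT u = sS v + sT v" if "j u = j v" for u v
    using that sS(1)[of u] sS(1)[of v] sT(1)[of u] sT(1)[of v] unfolding j_def by presburger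
  have tw: "twins F u v" if uv: "u \<in> K" "v \<in> K" "j u = j v" for u v
  proof -
    note je = j_eq[OF uv(3)]
    have "twins F0 u v" using exactD[OF ex uv(1,2)] je by simp
    moreover have "sS u = sS v \<and> sT u = sT v"
    proof (rule ccontr)
      assume "\<not> ?thesis"
      then consider "sS u < sS v" "sT v < sT u" | "sS v < sS u" "sT u < sT v"
        using je by linarith
      then show False
      proof cases
        case 1
        show False
          by (rule clash[OF fin(1) no F0 cF0 sub0 ex good ST(1) SK(1) ovs(1) ST(2) SK(2) ovs(2) sS(1) sT(1) gS' gT' uv(1,2)])
            (use 1 je sS(2)[OF uv(1,2)] sT(2)[OF uv(1,2)] in auto)
      next
        case 2
        show False
          by (rule clash[OF fin(1) no F0 cF0 sub0 ex good ST(1) SK(1) ovs(1) ST(2) SK(2) ovs(2) sS(1) sT(1) gS' gT' uv(2,1)])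
            (use 2 je sS(2)[OF uv(1,2)] sT(2)[OF uv(1,2)] in auto)
      qed
    qed
    ultimately show ?thesis using sS(2)[OF uv(1,2)] sT(2)[OF uv(1,2)] je by (auto simp: F twins_def)
  qed
  \<comment> \<open>\<open>j\<close> is at least as fine as both refinements and monotone over each,
    so it inherits their arcs. Only \<open>S \<inter> T\<close> is not covered by this.\<close>
  have monoS: "2 * h u + sS u \<le> 2 * h v + sS v" and monoT: "2 * h u + sT u \<le> 2 * h v + sT v" if "j u < j v" for u v
    using that sS(1)[of u] sS(1)[of v] sT(1)[of u] sT(1)[of v] unfolding j_def by presburger+
  have arcS: "is_arc K j (r \<inter> s)" if rs: "r \<in> insert S F0" "s \<in> insert S F0" for r s
  proof (rule is_arc_coarsen[OF circ_good_arc[OF gS' rs], of id])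
    show "id u \<in> r \<inter> s \<longleftrightarrow> id v \<in> r \<inter> s" if "u \<in> K" "v \<in> K" "2 * h (id u) + sS (id u) = 2 * h (id v) + sS (id v)" for u v
      using circ_good_twins[OF gS' that(1,2)] that(3) rs by (auto simp: twins_def)
  qed (use monoS in auto)
  have arcT: "is_arc K j (r \<inter> s)" if rs: "r \<in> insert T F0" "s \<in> insert T F0" for r s
  proof (rule is_arc_coarsen[OF circ_good_arc[OF gT' rs], of id])
    show "id u \<in> r \<inter> s \<longleftrightarrow> id v \<in> r \<inter> s" if "u \<in> K" "v \<in> K" "2 * h (id u) + sT (id u) = 2 * h (id v) + sT (id v)" for u v
      using circ_good_twins[OF gT' that(1,2)] that(3) rs by (auto simp: twins_def)
  qed (use monoT in auto)
  have arc1: "is_arc K j S" "is_arc K j T" using arcS[of S S] arcT[of T T] by simp_all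
  have arc2: "is_arc K j r" if "r \<in> F0" for r using arcS[of r r] that by simp
  have twS: "twins {S, T} u v" "twins {T, S} u v" if "u \<in> K" "v \<in> K" "j u = j v" for u v
    using tw[OF that] ST by (auto simp: twins_def)
  obtain rS rT where ov: "rS \<in> F0" "overlap rS S" "rT \<in> F0" "overlap rT T" using ovs by blast
  have arcST: "is_arc K j (S \<inter> T)"
    unfolding is_arc_def
  proof (intro ballI impI, rule ccontr)
    fix p a q b assume K: "p \<in> K" "a \<in> K" "q \<in> K" "b \<in> K"
    assume *: "cyc j p a q \<and> cyc j p q b \<and> p \<in> S \<inter> T \<and> q \<in> S \<inter> T" and n: "\<not> (a \<in> S \<inter> T \<or> b \<in> S \<inter> T)"
    show False
    proof (cases "a \<in> S")
      case False
      show False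
        by (rule inter_arc[OF no F0 ST(1,2) SK sub0 ov twS(1) arc1 arc2 _ _ K])
          (use * n False arcS arcT in auto)
    next
      case True
      show False
        by (rule inter_arc[OF no F0 ST(2,1) SK(2,1) sub0 ov(3,4,1,2) twS(2) arc1(2,1) arc2 _ _ K])
          (use * n True arcS arcT in auto)
    qed
  qed
  have "circ_good K F j"
  proof (rule circ_goodI)
    show "is_arc K j (r \<inter> s)" if "r \<in> F" "s \<in> F" for r s
      using that arcST arcS[of r s] arcT[of r s] arcS[of s r] arcT[of s r] by (auto simp: F Int_commute)
  qed (rule tw)
  then show ?thesis by blast
qed

text \<open>\<open>C\<close> is a component of the overlap graph, so any other set is comparable
  with or disjoint from each member. By connectivity it contains all members, or each member
  contains or avoids it. If some other set contains or avoids the whole union of \<open>C\<close>,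
  that union is a module at which the family is split; otherwise a class of twins with respect to
  \<open>C\<close> serves as the module.\<close>

lemma circ_good_disconnected:
  assumes fin: "finite K" "finite F" and sub: "\<And>r. r \<in> F \<Longrightarrow> r \<subseteq> K \<and> r \<noteq> K" and ne: "{} \<notin> F" "F \<noteq> {}"
    and conn: "\<not> ov_conn F" and IH: "\<And>G. G \<subset> F \<Longrightarrow> \<exists>f. circ_good K G f"
  shows "\<exists>f. circ_good K F f"
proof -
  obtain r0 where r0: "r0 \<in> F" using ne by blast
  let ?P = "\<lambda>C. ov_conn C \<and> C \<subseteq> F"
  have "?P {r0}" using r0 ov_conn_singleton by auto
  moreover have "\<forall>C. ?P C \<longrightarrow> card C < Suc (card F)" using fin(2) by (simp add: card_mono less_Suc_eq_le)
  ultimately obtain C where C: "?P C" and max: "\<And>D. ?P D \<Longrightarrow> card D \<le> card C"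
    using ex_has_greatest_nat[of ?P "{r0}" card "Suc (card F)"] by blast
  have noov: "\<not> overlap c r" if "c \<in> C" "r \<in> F - C" for c r
  proof
    assume "overlap c r"
    then have "?P (insert r C)" using ov_conn_insert[of C c r] C that by blast
    from max[OF this] that C fin(2) show False
      by (metis Diff_iff card_insert_disjoint finite_subset not_less_eq_eq order_refl)
  qed
  have tri: "(\<forall>c\<in>C. c \<subseteq> r) \<or> (\<forall>c\<in>C. r \<subseteq> c \<or> r \<inter> c = {})" if r: "r \<in> F - C" for r
  proof (cases "{c\<in>C. c \<subseteq> r} = {} \<or> {c\<in>C. c \<subseteq> r} = C")
    case True then show ?thesis using noov[OF _ r] unfolding overlap_def by blast
  next
    case False
    then obtain a b where "a \<in> C" "a \<subseteq> r" "b \<in> C" "\<not> b \<subseteq> r" "overlap a b"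
      using ov_connD[of C "{c\<in>C. c \<subseteq> r}"] C by blast
    then show ?thesis using noov[OF _ r, of b] unfolding overlap_def by blast
  qed
  have Cne: "C \<noteq> {}" "C \<noteq> F" "C \<subseteq> F" using C conn by (auto simp: ov_conn_def)
  let ?U = "\<Union>C"
  define F1 where "F1 = {r\<in>F - C. ?U \<subseteq> r \<or> r \<inter> ?U = {}}"
  show ?thesis
  proof (cases "F1 = {}")
    case False
    then obtain r where r: "r \<in> F - C" "?U \<subseteq> r \<or> r \<inter> ?U = {}" by (auto simp: F1_def)
    have UK: "?U \<subseteq> K" using sub Cne by blast
    have "r \<subseteq> K" "r \<noteq> K" "r \<noteq> {}" using sub[of r] r(1) ne by auto
    then have "?U \<noteq> K" using r(2) by auto
    have s2: "s \<subseteq> ?U" if "s \<in> F - F1" for s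
    proof (cases "s \<in> C")
      case False
      then have "s \<in> F - C" "\<not> ?U \<subseteq> s" "s \<inter> ?U \<noteq> {}" using that by (auto simp: F1_def)
      then show ?thesis using tri[of s] by blast
    qed auto
    obtain f1 where f1: "circ_good K F1 f1" using IH[of F1] Cne by (auto simp: F1_def)
    obtain f2 where f2: "circ_good K (F - F1) f2" using IH[of "F - F1"] False by (auto simp: F1_def)
    have "\<exists>f. circ_good K (F1 \<union> (F - F1)) f"
      by (rule circ_good_module[OF fin(1) UK \<open>?U \<noteq> K\<close> _ s2 f1 f2]) (auto simp: F1_def)
    moreover have "F1 \<union> (F - F1) = F" by (auto simp: F1_def)
    ultimately show ?thesis by simp
  next
    case True
    then have in2: "\<forall>c\<in>C. r \<subseteq> c \<or> r \<inter> c = {}" if "r \<in> F - C" for r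
      using tri[OF that] that by (auto simp: F1_def)
    obtain r where r: "r \<in> F - C" using Cne by blast
    then obtain u where u: "u \<in> r" using ne by (metis DiffE equals0I)
    define X where "X = {v\<in>K. twins C v u}"
    have inX: "s \<subseteq> X" if s: "s \<in> F - C" "s \<inter> X \<noteq> {}" for s
    proof -
      from s(2) obtain w where w: "w \<in> s" "twins C w u" by (auto simp: X_def)
      have "twins C v u" if "v \<in> s" for v using in2[OF \<open>s \<in> F - C\<close>] w that unfolding twins_def by blast
      then show ?thesis using sub s(1) by (auto simp: X_def)
    qed
    have uX: "u \<in> X" using u r sub by (auto simp: X_def twins_def)
    then have rX: "r \<subseteq> X" using inX[OF r] u by blast
    obtain c where c: "c \<in> C" "r \<subseteq> c"
    proof -
      have "\<not> r \<inter> ?U = {}" using True r by (auto simp: F1_def)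
      then show thesis using that in2[OF r] by blast
    qed
    have Xc: "X \<subseteq> c" using c u by (auto simp: X_def twins_def)
    define F2 where "F2 = {s\<in>F - C. s \<subseteq> X}"
    have "r \<in> F2" using r rX by (simp add: F2_def)
    have F1': "X \<subseteq> s \<or> s \<inter> X = {}" if "s \<in> F - F2" for s
    proof (cases "s \<in> C")
      case True then show ?thesis using uX by (auto simp: X_def twins_def)
    next
      case False then show ?thesis using that inX[of s] by (auto simp: F2_def)
    qed
    obtain f1 where f1: "circ_good K (F - F2) f1" using IH[of "F - F2"] \<open>r \<in> F2\<close> r by auto
    obtain f2 where f2: "circ_good K F2 f2" using IH[of F2] Cne by (auto simp: F2_def)
    have "X \<subseteq> K" "X \<noteq> K" using Xc sub[of c] c Cne by (auto simp: X_def)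
    then have "\<exists>f. circ_good K ((F - F2) \<union> F2) f"
      by (intro circ_good_module[OF fin(1) _ _ F1' _ f1 f2]) (auto simp: F2_def)
    moreover have "(F - F2) \<union> F2 = F" by (auto simp: F2_def)
    ultimately show ?thesis by simp
  qed
qed

theorem circ_good_exists:
  assumes "finite K" "finite F" "\<not> obst K F" "\<And>r. r \<in> F \<Longrightarrow> r \<subseteq> K \<and> r \<noteq> K"
  shows "\<exists>f. circ_good K F f"
  using assms(2-4)
proof (induction "card F" arbitrary: F rule: less_induct)
  case less
  have IH: "\<exists>f. circ_good K G f" if "G \<subset> F" for G
  proof (rule less.hyps)
    show "card G < card F" using that less.prems(1) by (rule psubset_card_mono[rotated])
    show "finite G" using that less.prems(1) finite_subset by blast
    show "\<not> obst K G" using obst_mono[of K G F] less.prems(2) that by blast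
  qed (use that less.prems(3) in blast)
  show ?case
  proof (cases "{} \<in> F")
    case True
    then obtain f where f: "circ_good K (F - {{}}) f" using IH[of "F - {{}}"] by blast
    have e: "is_arc K f {}" by (simp add: is_arc_def)
    have "circ_good K F f"
    proof (rule circ_goodI)
      show "twins F u v" if "u \<in> K" "v \<in> K" "f u = f v" for u v
        using circ_good_twins[OF f that] unfolding twins_def by blast
      show "is_arc K f (r \<inter> s)" if "r \<in> F" "s \<in> F" for r s
      proof (cases "r = {} \<or> s = {}")
        case True then show ?thesis using e by auto
      next
        case False then show ?thesis using circ_good_arc[OF f, of r s] that by simp
      qed
    qed
    then show ?thesis by blast
  next
    case ne: False
    show ?thesis
    proof (cases "card F \<le> 3")
      case True
      show ?thesis
      proof (cases "F = {}")
        case True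
        then have "circ_good K F (\<lambda>_. 0)" by (simp add: circ_good_def twins_def)
        then show ?thesis by blast
      next
        case False
        then have "card F \<noteq> 0" using less.prems(1) by simp
        then consider "card F = 1" | "card F = 2" | "card F = 3" using True by linarith
        then obtain A B C where F: "F = {A, B, C}"
          by cases (metis card_1_singletonE insert_absorb2, metis card_2_iff insert_absorb2, metis card_3_iff)
        show ?thesis unfolding F
          by (rule circ_good_triple[OF less.prems(2)]) (use less.prems(3) F in auto)
      qed
    next
      case False
      then have c4: "card F \<ge> 4" by simp
      show ?thesis
      proof (cases "ov_conn F")
        case True
        show ?thesis by (rule circ_good_connected[OF assms(1) less.prems(1,2,3) True c4 IH])
      next
        case False
        have "F \<noteq> {}" using c4 by auto
        show ?thesis by (rule circ_good_disconnected[OF assms(1) less.prems(1,3) ne \<open>F \<noteq> {}\<close> False IH])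
      qed
    qed
  qed
qed

section \<open>Semi-transitive orientations and circular orders\<close>

text \<open>In a pair digraph heads and tails are the projections, so the vertex map determines the
  arc map of an isomorphism. Containment thus reduces to an injection that preserves and reflects
  arcs.\<close>

lemma contains_inducedD:
  assumes "contains_induced G H"
  obtains \<phi> where "inj_on \<phi> (pverts H)" "\<phi> ` pverts H \<subseteq> pverts G"
    "\<And>u v. u \<in> pverts H \<Longrightarrow> v \<in> pverts H \<Longrightarrow> (u, v) \<in> parcs H \<longleftrightarrow> (\<phi> u, \<phi> v) \<in> parcs G"
proof -
  from assms obtain S f where S: "S \<subseteq> pverts G"
    and iso: "pre_digraph.digraph_isomorphism (with_proj H) f" and eq: "with_proj G \<restriction> S = app_iso f (with_proj H)"
    unfolding contains_induced_def digraph_iso_def by blast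
  let ?\<phi> = "iso_verts f"
  have V: "S = ?\<phi> ` pverts H" using arg_cong[OF eq, of verts] by simp
  have A: "{e \<in> parcs G. fst e \<in> S \<and> snd e \<in> S} = iso_arcs f ` parcs H" using arg_cong[OF eq, of arcs] by simp
  have T: "iso_tail f = fst" "iso_head f = snd" using arg_cong[OF eq, of tail] arg_cong[OF eq, of head] by (simp_all add: induce_subgraph_def)
  have wf: "wf_digraph (with_proj H)" and inj: "inj_on ?\<phi> (pverts H)"
    and E: "\<And>e. e \<in> parcs H \<Longrightarrow> iso_arcs f e = (?\<phi> (fst e), ?\<phi> (snd e))"
    using iso unfolding pre_digraph.digraph_isomorphism_def by (auto simp: T prod_eq_iff)
  have ends: "fst e \<in> pverts H" "snd e \<in> pverts H" if "e \<in> parcs H" for e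
    using wf_digraph.tail_in_verts[OF wf, of e] wf_digraph.head_in_verts[OF wf, of e] that by auto
  show thesis
  proof (rule that[OF inj])
    show "?\<phi> ` pverts H \<subseteq> pverts G" using V S by simp
    fix u v assume uv: "u \<in> pverts H" "v \<in> pverts H"
    show "(u, v) \<in> parcs H \<longleftrightarrow> (?\<phi> u, ?\<phi> v) \<in> parcs G"
    proof
      assume "(u, v) \<in> parcs H"
      then have "(?\<phi> u, ?\<phi> v) \<in> iso_arcs f ` parcs H" using E by force
      then show "(?\<phi> u, ?\<phi> v) \<in> parcs G" using A by blast
    next
      assume "(?\<phi> u, ?\<phi> v) \<in> parcs G"
      then have "(?\<phi> u, ?\<phi> v) \<in> iso_arcs f ` parcs H" using A V uv by force
      then obtain e where e: "e \<in> parcs H" "(?\<phi> u, ?\<phi> v) = (?\<phi> (fst e), ?\<phi> (snd e))" using E by force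
      then have "u = fst e" "v = snd e" using inj_onD[OF inj] uv ends by auto
      with e show "(u, v) \<in> parcs H" by simp
    qed
  qed
qed

lemma contains_inducedI:
  assumes wf: "pair_wf_digraph H" and inj: "inj_on \<phi> (pverts H)" and sub: "\<phi> ` pverts H \<subseteq> pverts G"
    and arcs: "\<And>u v. u \<in> pverts H \<Longrightarrow> v \<in> pverts H \<Longrightarrow> (u, v) \<in> parcs H \<longleftrightarrow> (\<phi> u, \<phi> v) \<in> parcs G"
  shows "contains_induced G H"
proof -
  interpret pair_wf_digraph H by fact
  let ?f = "\<lparr> iso_verts = \<phi>, iso_arcs = (\<lambda>e. (\<phi> (fst e), \<phi> (snd e))), iso_head = snd, iso_tail = fst \<rparr>"
  have "inj_on (\<lambda>e. (\<phi> (fst e), \<phi> (snd e))) (parcs H)"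
    using inj arc_fst_in_verts arc_snd_in_verts by (auto simp: inj_on_def prod_eq_iff)
  then have 1: "pre_digraph.digraph_isomorphism (with_proj H) ?f"
    using inj wf wf_digraph_wp_iff by (auto simp: pre_digraph.digraph_isomorphism_def)
  have "{e \<in> parcs G. fst e \<in> \<phi> ` pverts H \<and> snd e \<in> \<phi> ` pverts H} = (\<lambda>e. (\<phi> (fst e), \<phi> (snd e))) ` parcs H"
    (is "?L = ?R")
  proof
    show "?L \<subseteq> ?R"
    proof
      fix e assume "e \<in> ?L"
      then obtain u v where "u \<in> pverts H" "v \<in> pverts H" "e = (\<phi> u, \<phi> v)" "e \<in> parcs G" by (auto simp: prod_eq_iff)
      then show "e \<in> ?R" using arcs by force
    qed
    show "?R \<subseteq> ?L"
    proof
      fix e assume "e \<in> ?R"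
      then obtain u v where uv: "(u, v) \<in> parcs H" "e = (\<phi> u, \<phi> v)" by force
      then have "u \<in> pverts H" "v \<in> pverts H" using in_arcsD1 in_arcsD2 by blast+
      then show "e \<in> ?L" using arcs[of u v] uv by simp
    qed
  qed
  then have 2: "with_proj G \<restriction> (\<phi> ` pverts H) = app_iso ?f (with_proj H)"
    by (simp add: induce_subgraph_def app_iso_def with_proj_def)
  show ?thesis unfolding contains_induced_def digraph_iso_def using sub 1 2 by blast
qed

lemma vpath_with_proj_iff:
  "vpath p (with_proj D) \<longleftrightarrow> p \<noteq> [] \<and> distinct p \<and> set p \<subseteq> pverts D \<and> (\<forall>i. Suc i < length p \<longrightarrow> (p ! i, p ! Suc i) \<in> parcs D)"
proof -
  have "set (vwalk_arcs p) \<subseteq> A \<longleftrightarrow> (\<forall>i. Suc i < length p \<longrightarrow> (p ! i, p ! Suc i) \<in> A)" for A :: "('a \<times> 'a) set"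
  proof (induction p rule: vwalk_arcs.induct)
    case (3 x y xs)
    have "(\<forall>i. Suc i < length (x # y # xs) \<longrightarrow> ((x # y # xs) ! i, (x # y # xs) ! Suc i) \<in> A) \<longleftrightarrow>
      (x, y) \<in> A \<and> (\<forall>i. Suc i < length (y # xs) \<longrightarrow> ((y # xs) ! i, (y # xs) ! Suc i) \<in> A)"
      by (auto simp: nth_Cons split: nat.splits)
    with 3 show ?case by simp
  qed auto
  then show ?thesis unfolding vpath_def vwalk_def by auto
qed

section \<open>From a semi-transitive orientation to a circular order\<close>

locale st_orientation =
  fixes G D :: "'a pair_pre_digraph"
  assumes G: "pair_graph G" and st: "semi_transitive_orientation G D"
begin

interpretation pair_graph G by (rule G)

lemma pverts_D: "pverts D = pverts G" and D_sub: "parcs D \<subseteq> parcs G"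
  and D_iff: "(u, v) \<in> parcs G \<Longrightarrow> (u, v) \<in> parcs D \<longleftrightarrow> (v, u) \<notin> parcs D"
  and acyc: "acyclic (parcs D)"
  using st unfolding semi_transitive_orientation_def orientation_def by auto

lemma no_cycle3: "(a, b) \<in> parcs D \<Longrightarrow> (b, c) \<in> parcs D \<Longrightarrow> (c, a) \<notin> parcs D"
  using acyc unfolding acyclic_def by (meson trancl.intros trancl_trans)

lemma no_cycle2: "(a, b) \<in> parcs D \<Longrightarrow> (b, a) \<notin> parcs D"
  using acyc unfolding acyclic_def by (meson trancl.intros trancl_trans)

lemma no_loop: "(a, a) \<notin> parcs D"
  using acyc unfolding acyclic_def by blast

lemma D_verts: "(a, b) \<in> parcs D \<Longrightarrow> a \<in> pverts D \<and> b \<in> pverts D"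
  using D_sub in_arcsD1 in_arcsD2 pverts_D by blast

lemma shortcut:
  assumes "vpath p (with_proj D)" "length p \<ge> 3" "(hd p, last p) \<in> parcs D"
  shows "\<forall>i j. i < j \<and> j < length p \<longrightarrow> (p ! i, p ! j) \<in> parcs D"
  using st assms unfolding semi_transitive_orientation_def by blast

text \<open>Together with acyclicity, this four-vertex instance of the shortcut condition is what
  \<open>circular_order_exists\<close> rests on.\<close>

lemma path3:
  assumes "(a, b) \<in> parcs D" "(b, c) \<in> parcs D" "(c, d) \<in> parcs D" "(a, d) \<in> parcs D"
  shows "(a, c) \<in> parcs D" "(b, d) \<in> parcs D"
proof -
  have ne: "a \<noteq> b" "b \<noteq> c" "c \<noteq> d" "a \<noteq> d" using assms no_loop by auto
  have ne': "a \<noteq> c" "b \<noteq> d" using assms no_cycle2 by blast+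
  let ?p = "[a, b, c, d]"
  have "vpath ?p (with_proj D)"
    unfolding vpath_with_proj_iff using assms ne ne' D_verts by (auto simp: nth_Cons less_Suc_eq split: nat.splits)
  then have "\<forall>i j. i < j \<and> j < length ?p \<longrightarrow> (?p ! i, ?p ! j) \<in> parcs D"
    using shortcut[of ?p] assms(4) by simp
  from this[rule_format, of 0 2] this[rule_format, of 1 3] show "(a, c) \<in> parcs D" "(b, d) \<in> parcs D" by auto
qed

lemma edge_cases: "(u, v) \<in> parcs G \<Longrightarrow> (u, v) \<in> parcs D \<or> (v, u) \<in> parcs D"
  using D_iff by blast

text \<open>\<open>f\<close> is the rank in the transitive tournament on the clique. A vertex
  \<open>x\<close> of \<open>I\<close> that skips a clique vertex between neighbours
  \<open>a\<close> and \<open>c\<close> satisfies \<open>a -> x -> c\<close> and is then adjacent to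
  everything before \<open>a\<close> and after \<open>c\<close>. An alternation for two vertices
  would force exactly one of them into this position, which \<open>cross\<close> excludes.\<close>

lemma circular_order_exists:
  assumes C: "C \<subseteq> pverts G" and clique: "\<And>u v. u \<in> C \<Longrightarrow> v \<in> C \<Longrightarrow> u \<noteq> v \<Longrightarrow> (u, v) \<in> parcs G"
    and ind: "\<And>x y. x \<in> I \<Longrightarrow> y \<in> I \<Longrightarrow> (x, y) \<notin> parcs G"
  shows "\<exists>f. inj_on f C \<and> (\<forall>x\<in>I. \<forall>y\<in>I. is_arc C f ({v\<in>C. (x, v) \<in> parcs G} \<inter> {v\<in>C. (y, v) \<in> parcs G}))"
proof -
  have finC: "finite C" using C pair_finite_verts finite_subset by blast
  define f where "f v = int (card {u\<in>C. (u, v) \<in> parcs D})" for v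
  have trans: "(a, c) \<in> parcs D" if "(a, b) \<in> parcs D" "(b, c) \<in> parcs D" "a \<in> C" "b \<in> C" "c \<in> C" for a b c
  proof -
    have "a \<noteq> c" using that no_cycle2 by blast
    then show ?thesis using edge_cases[OF clique[of a c]] that no_cycle3 by blast
  qed
  have f_less: "f a < f b" if "(a, b) \<in> parcs D" "a \<in> C" "b \<in> C" for a b
  proof -
    have "{u\<in>C. (u, a) \<in> parcs D} \<subset> {u\<in>C. (u, b) \<in> parcs D}"
      using trans that no_loop by blast
    then show ?thesis using finC unfolding f_def by (simp add: psubset_card_mono)
  qed
  have f_iff: "(a, b) \<in> parcs D \<longleftrightarrow> f a < f b" if "a \<in> C" "b \<in> C" for a b
  proof
    assume "f a < f b"
    then have "a \<noteq> b" by auto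
    then show "(a, b) \<in> parcs D" using edge_cases[OF clique[OF that]] f_less[of b a] that \<open>f a < f b\<close> by fastforce
  qed (use f_less that in blast)
  have inj: "inj_on f C"
  proof (rule inj_onI, rule ccontr)
    fix a b assume "a \<in> C" "b \<in> C" "f a = f b" "a \<noteq> b"
    then show False using edge_cases[OF clique[of a b]] f_less by fastforce
  qed
  have sym: "(v, x) \<in> parcs G" if "(x, v) \<in> parcs G" for x v using arcs_symmetric that .
  have thru: "(a, x) \<in> parcs D \<and> (x, c) \<in> parcs D"
    if "a \<in> C" "b \<in> C" "c \<in> C" "f a < f b" "f b < f c" "(x, a) \<in> parcs G" "(x, c) \<in> parcs G" "(x, b) \<notin> parcs G" for x a b c
  proof -
    have D: "(a, b) \<in> parcs D" "(b, c) \<in> parcs D" "(a, c) \<in> parcs D" using f_iff that by auto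
    have nb: "(x, b) \<notin> parcs D" "(b, x) \<notin> parcs D" using that(8) D_sub sym by blast+
    have "\<not> ((x, a) \<in> parcs D \<and> (x, c) \<in> parcs D)" using path3(1)[of x a b c] D nb by blast
    moreover have "\<not> ((a, x) \<in> parcs D \<and> (c, x) \<in> parcs D)" using path3(2)[of a b c x] D nb by blast
    moreover have "\<not> ((x, a) \<in> parcs D \<and> (c, x) \<in> parcs D)" using no_cycle3 D by blast
    ultimately show ?thesis using edge_cases that(6,7) by blast
  qed
  have low: "(x, u) \<in> parcs G" if "u \<in> C" "a \<in> C" "c \<in> C" "(a, x) \<in> parcs D" "(x, c) \<in> parcs D" "f u < f a" for x u a c
  proof -
    have "(a, c) \<in> parcs D"
    proof -
      have "a \<noteq> c" using that no_cycle2 by blast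
      then show ?thesis using edge_cases[OF clique[OF that(2,3)]] no_cycle3[OF that(4,5)] by blast
    qed
    then have "(u, a) \<in> parcs D" "(u, c) \<in> parcs D" using f_iff that by auto
    from path3(1)[OF this(1) that(4,5) this(2)] show ?thesis using D_sub sym by blast
  qed
  have high: "(x, u) \<in> parcs G" if "u \<in> C" "a \<in> C" "c \<in> C" "(a, x) \<in> parcs D" "(x, c) \<in> parcs D" "f c < f u" for x u a c
  proof -
    have "(a, c) \<in> parcs D"
    proof -
      have "a \<noteq> c" using that no_cycle2 by blast
      then show ?thesis using edge_cases[OF clique[OF that(2,3)]] no_cycle3[OF that(4,5)] by blast
    qed
    then have "(c, u) \<in> parcs D" "(a, u) \<in> parcs D" using f_iff that by auto
    from path3(2)[OF that(4,5) this] show ?thesis using D_sub by blast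
  qed
  have noadj: "(x, y) \<notin> parcs D" if "x \<in> I" "y \<in> I" for x y using ind[OF that] D_sub by blast
  \<comment> \<open>If \<open>a -> y -> c\<close>, any other position of \<open>x\<close> relative
    to \<open>a\<close> and \<open>c\<close> gives a directed cycle or a four-vertex path with
    joined ends, which would force an arc between \<open>x\<close> and \<open>y\<close>.\<close>
  have cross: False
    if x: "x \<in> I" and y: "y \<in> I" and ac: "a \<in> C" "c \<in> C" "(x, a) \<in> parcs G" "(x, c) \<in> parcs G"
      and t: "(a, y) \<in> parcs D" "(y, c) \<in> parcs D" and nt: "\<not> ((a, x) \<in> parcs D \<and> (x, c) \<in> parcs D)" for x y a c
  proof -
    have ac': "(a, c) \<in> parcs D"
    proof -
      have "a \<noteq> c" using t no_cycle2 by blast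
      then show ?thesis using edge_cases[OF clique[OF ac(1,2)]] no_cycle3[OF t] by blast
    qed
    have "\<not> ((x, a) \<in> parcs D \<and> (x, c) \<in> parcs D)" using path3(1)[of x a y c] t noadj[OF x y] by blast
    moreover have "\<not> ((a, x) \<in> parcs D \<and> (c, x) \<in> parcs D)" using path3(2)[of a y c x] t noadj[OF y x] by blast
    moreover have "\<not> ((x, a) \<in> parcs D \<and> (c, x) \<in> parcs D)" using no_cycle3 ac' by blast
    ultimately show False using edge_cases ac nt by blast
  qed
  have key: False
    if x: "x \<in> I" and y: "y \<in> I" and K: "a \<in> C" "b \<in> C" "c \<in> C" "d \<in> C" and lt: "f a < f b" "f b < f c"
      and out: "f d < f a \<or> f c < f d" and a: "(x, a) \<in> parcs G" "(y, a) \<in> parcs G"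
      and c: "(x, c) \<in> parcs G" "(y, c) \<in> parcs G" and b: "(x, b) \<notin> parcs G \<or> (y, b) \<notin> parcs G" and d: "(x, d) \<notin> parcs G" for x y a b c d
  proof -
    have nt: "\<not> ((a, x) \<in> parcs D \<and> (x, c) \<in> parcs D)" using low[of d a c x] high[of d a c x] out K d by blast
    then have "(x, b) \<in> parcs G" using thru[of a b c x] K lt a c by blast
    then have "(a, y) \<in> parcs D \<and> (y, c) \<in> parcs D" using thru[of a b c y] K lt a c b by blast
    then show False using cross[OF x y K(1,3) a(1) c(1)] nt by blast
  qed
  have key': False
    if "x \<in> I" "y \<in> I" and K: "a \<in> C" "b \<in> C" "c \<in> C" "d \<in> C" and "f a < f b" "f b < f c"
      and "f d < f a \<or> f c < f d" and "(x, a) \<in> parcs G \<and> (y, a) \<in> parcs G"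
      and "(x, c) \<in> parcs G \<and> (y, c) \<in> parcs G" and "\<not> ((x, b) \<in> parcs G \<and> (y, b) \<in> parcs G)"
      and "\<not> ((x, d) \<in> parcs G \<and> (y, d) \<in> parcs G)" for x y a b c d
    using that key[of x y a b c d] key[of y x a b c d] by blast
  have "is_arc C f ({v\<in>C. (x, v) \<in> parcs G} \<inter> {v\<in>C. (y, v) \<in> parcs G})" if xy: "x \<in> I" "y \<in> I" for x y
    unfolding is_arc_def
  proof (intro ballI impI, rule ccontr)
    fix a b c d assume K: "a \<in> C" "b \<in> C" "c \<in> C" "d \<in> C"
    let ?A = "{v\<in>C. (x, v) \<in> parcs G} \<inter> {v\<in>C. (y, v) \<in> parcs G}"
    assume *: "cyc f a b c \<and> cyc f a c d \<and> a \<in> ?A \<and> c \<in> ?A" and n: "\<not> (b \<in> ?A \<or> d \<in> ?A)"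
    then consider "f a < f b" "f b < f c" "f d < f a \<or> f c < f d" | "f a < f d" "f d < f c" "f b < f a \<or> f c < f b"
      | "f c < f b" "f b < f a" "f d < f c \<or> f a < f d" | "f c < f d" "f d < f a" "f b < f c \<or> f a < f b"
      unfolding cyc_def by linarith
    then show False
    proof cases
      case 1 show False by (rule key'[OF xy K(1,2,3,4) 1]) (use * n K in auto)
    next
      case 2 show False by (rule key'[OF xy K(1,4,3,2) 2]) (use * n K in auto)
    next
      case 3 show False by (rule key'[OF xy K(3,2,1,4) 3]) (use * n K in auto)
    next
      case 4 show False by (rule key'[OF xy K(3,4,1,2) 4]) (use * n K in auto)
    qed
  qed
  with inj show ?thesis by blast
qed

end

text \<open>Tied elements are twins, so an arbitrary injection \<open>e\<close> may break the ties;
  \<open>Suc n\<close> exceeds all its values, which keeps the classes in order.\<close>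

lemma circ_good_injective:
  assumes fin: "finite K" and f: "circ_good K F f"
  shows "\<exists>q. inj_on q K \<and> (\<forall>r\<in>F. \<forall>s\<in>F. is_arc K q (r \<inter> s))"
proof -
  obtain e :: "'a \<Rightarrow> nat" and n where e: "e ` K = {i. i < n}" "inj_on e K"
    using finite_imp_inj_to_nat_seg[OF fin] by blast
  define q where "q v = int (Suc n) * f v + int (e v)" for v
  have en: "0 \<le> int (e v)" "int (e v) < int (Suc n)" if "v \<in> K" for v
  proof -
    have "e v < n" using e(1) that by blast
    then show "0 \<le> int (e v)" "int (e v) < int (Suc n)" by auto
  qed
  have q_div: "q v div int (Suc n) = f v" and q_mod: "q v mod int (Suc n) = int (e v)" if "v \<in> K" for v
    using en[OF that] unfolding q_def by (simp_all add: div_pos_pos_trivial)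
  have inj: "inj_on q K"
    using q_mod e(2) by (metis inj_onD inj_onI of_nat_eq_iff)
  have mono: "f u \<le> f v" if "u \<in> K" "v \<in> K" "q u < q v" for u v
    using zdiv_mono1[of "q u" "q v" "int (Suc n)"] q_div that by simp
  have "is_arc K q (r \<inter> s)" if rs: "r \<in> F" "s \<in> F" for r s
  proof (rule is_arc_coarsen[OF circ_good_arc[OF f rs], of id])
    show "id u \<in> r \<inter> s \<longleftrightarrow> id v \<in> r \<inter> s" if "u \<in> K" "v \<in> K" "f (id u) = f (id v)" for u v
      using circ_good_twins[OF f that(1,2)] that(3) rs by (simp add: twins_def)
  qed (use mono in auto)
  with inj show ?thesis by blast
qed

section \<open>From a circular order to a semi-transitive orientation\<close>

locale circular_split =
  fixes G :: "'a pair_pre_digraph" and I K :: "'a set" and q :: "'a \<Rightarrow> int"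
  assumes G: "pair_graph G" and IK: "I \<union> K = pverts G" "I \<inter> K = {}"
    and ind: "\<And>x y. x \<in> I \<Longrightarrow> y \<in> I \<Longrightarrow> (x, y) \<notin> parcs G"
    and clique: "\<And>u v. u \<in> K \<Longrightarrow> v \<in> K \<Longrightarrow> u \<noteq> v \<Longrightarrow> (u, v) \<in> parcs G"
    and nonfull: "\<And>x. x \<in> I \<Longrightarrow> \<exists>v\<in>K. (x, v) \<notin> parcs G"
    and inj: "inj_on q K"
    and arcs: "\<And>x y. x \<in> I \<Longrightarrow> y \<in> I \<Longrightarrow> is_arc K q ({v\<in>K. (x, v) \<in> parcs G} \<inter> {v\<in>K. (y, v) \<in> parcs G})"
begin

interpretation pair_graph G by (rule G)

definition "N x = {v\<in>K. (x, v) \<in> parcs G}"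
definition "split_type x \<longleftrightarrow> (\<exists>a\<in>N x. \<exists>c\<in>N x. \<exists>b\<in>K - N x. q a < q b \<and> q b < q c)"
definition "gap x = Min (q ` (K - N x))"

text \<open>Arcs increase the potential \<open>pot\<close>: a vertex of \<open>I\<close> whose neighbourhood is not an interval
  sits at its first non-neighbour, and every other vertex of \<open>I\<close> is a source.\<close>

definition "pot v = (if v \<in> K then q v else if split_type v then gap v else Min (q ` K) - 1)"
definition "D = \<lparr>pverts = pverts G,
  parcs = {(u, v). (u, v) \<in> parcs G \<and> pot u < pot v}\<rparr>"

lemma finK: "finite K" using IK pair_finite_verts finite_subset by (metis Un_upper2)

lemma q_neq: "u \<in> K \<Longrightarrow> v \<in> K \<Longrightarrow> u \<noteq> v \<Longrightarrow> q u \<noteq> q v" using inj by (auto dest: inj_onD)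

lemma gap_ex: "x \<in> I \<Longrightarrow> \<exists>b\<in>K - N x. q b = gap x \<and> (\<forall>v\<in>K. q v < gap x \<longrightarrow> v \<in> N x)"
proof -
  assume "x \<in> I"
  then have "K - N x \<noteq> {}" using nonfull by (auto simp: N_def)
  then have "gap x \<in> q ` (K - N x)" unfolding gap_def using finK by (intro Min_in) auto
  moreover have "v \<in> N x" if "v \<in> K" "q v < gap x" for v
    using that finK unfolding gap_def by (metis (no_types, lifting) DiffI Min_le finite_Diff finite_imageI imageI not_less)
  ultimately show ?thesis by auto
qed

lemma pot_K: "v \<in> K \<Longrightarrow> pot v = q v" by (simp add: pot_def)

lemma pot_I: "x \<in> I \<Longrightarrow> pot x = (if split_type x then gap x else Min (q ` K) - 1)"
  using IK by (auto simp: pot_def)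

lemma N_I: "(x, v) \<in> parcs G \<Longrightarrow> x \<in> I \<Longrightarrow> v \<in> N x"
  using ind in_arcsD2 IK by (fastforce simp: N_def)

lemma pot_neq:
  assumes "(u, v) \<in> parcs G" shows "pot u \<noteq> pot v"
proof -
  have *: "pot x \<noteq> pot v" if xv: "(x, v) \<in> parcs G" "x \<in> I" for x v
  proof -
    have v: "v \<in> N x" "v \<in> K" using N_I[OF xv] by (auto simp: N_def)
    obtain b where "b \<in> K - N x" "q b = gap x" using gap_ex[OF xv(2)] by blast
    then have "q v \<noteq> gap x" using q_neq[of v b] v by auto
    moreover have "Min (q ` K) \<le> q v" using v finK by simp
    ultimately show ?thesis using pot_K[OF v(2)] pot_I[OF xv(2)] by auto
  qed
  have "u \<in> I \<or> u \<in> K" "v \<in> I \<or> v \<in> K" using in_arcsD1[OF assms] in_arcsD2[OF assms] IK by blast+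
  moreover have "u \<noteq> v" using assms no_loops by fastforce
  ultimately show ?thesis
    using *[of u v] *[of v u] assms arcs_symmetric[OF assms] q_neq[of u v] pot_K by metis
qed

lemma D_iff: "(u, v) \<in> parcs D \<longleftrightarrow> (u, v) \<in> parcs G \<and> pot u < pot v"
  by (simp add: D_def)

lemma D_orientation: "orientation G D"
proof -
  have "(u, v) \<in> parcs D \<longleftrightarrow> (v, u) \<notin> parcs D" if "(u, v) \<in> parcs G" for u v
    using pot_neq[OF that] that arcs_symmetric[OF that] unfolding D_iff by auto
  then show ?thesis unfolding orientation_def by (auto simp: D_def)
qed

lemma D_acyclic: "acyclic (parcs D)"
  by (rule acyclicI_order[where f = "\<lambda>v. - pot v"]) (auto simp: D_iff)

text \<open>Suppose \<open>u\<close> is a non-neighbour above \<open>v\<close>. If the first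
  non-neighbour comes after \<open>a\<close>, then \<open>a\<close>, it, \<open>v\<close> and
  \<open>u\<close> alternate; if it comes before \<open>a\<close>, then it, \<open>a\<close>,
  \<open>b\<close> and \<open>c\<close> alternate.\<close>

lemma N_above:
  assumes x: "x \<in> I" "split_type x" and v: "v \<in> N x" "gap x < q v" and u: "u \<in> K" "q v \<le> q u"
  shows "u \<in> N x"
proof (rule ccontr)
  assume nu: "u \<notin> N x"
  from gap_ex[OF x(1)] obtain b0 where b0: "b0 \<in> K" "b0 \<notin> N x" "q b0 = gap x" by blast
  from x(2) obtain a b c where abc: "a \<in> N x" "c \<in> N x" "b \<in> K" "b \<notin> N x" "q a < q b" "q b < q c"
    unfolding split_type_def by blast
  have K: "a \<in> K" "c \<in> K" "v \<in> K" using abc v by (auto simp: N_def)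
  have arc: "is_arc K q (N x)" using arcs[OF x(1) x(1)] by (simp add: N_def)
  have vu: "q v < q u" using u nu v(1) q_neq[of u v] K by (metis order_le_less)
  show False
  proof (cases "q a < q b0")
    case True
    have "cyc q a b0 v" "cyc q a v u" using True vu v b0 unfolding cyc_def by auto
    from is_arcD[OF arc this] abc v b0 nu K u show False by blast
  next
    case False
    then have "q b0 < q a" using q_neq[of a b0] K b0 abc by (metis linorder_neqE_linordered_idom)
    then have "cyc q b0 a b" "cyc q b0 b c" using abc unfolding cyc_def by auto
    from is_arc_outD[OF arc this] abc b0 K show False by blast
  qed
qed

text \<open>The two arcs \<open>N x\<close> and \<open>N y\<close> would cover all edges of the circle.\<close>

lemma no_cover:
  assumes xy: "x \<in> I" "y \<in> I" and a: "a \<in> N x" "a \<in> N y" and c: "c \<in> N x" "c \<in> N y"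
    and b: "b \<in> K" "b \<notin> N x" "q a < q b" "q b < q c" and d: "d \<in> K" "d \<notin> N y" "q d < q a \<or> q c < q d"
  shows False
proof -
  have arc: "is_arc K q (N x \<inter> N y)" using arcs[OF xy] by (simp add: N_def)
  have "a \<in> K" "c \<in> K" using a c by (auto simp: N_def)
  moreover have "cyc q a b c" "cyc q a c d" using b d unfolding cyc_def by auto
  ultimately show False using is_arcD[OF arc, of a b c d] a b c d by blast
qed

text \<open>An inner path vertex \<open>x\<close> in \<open>I\<close> is adjacent to all clique
  vertices up to its predecessor and from its successor on. Another vertex of \<open>I\<close> on
  the path would be adjacent to both of these and miss something beyond them, contradicting
  \<open>no_cover\<close>. The other pairs follow because \<open>q\<close> increases along the
  clique vertices of the path.\<close>

lemma D_semi_transitive: "semi_transitive_orientation G D"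
  unfolding semi_transitive_orientation_def
proof (intro conjI allI impI D_orientation D_acyclic)
  fix p assume p: "vpath p (with_proj D) \<and> 3 \<le> length p"
  define m where "m = length p - 1"
  have len: "length p = Suc m" "2 \<le> m" using p by (auto simp: m_def)
  have step: "(p ! i, p ! Suc i) \<in> parcs D" if "i < m" for i
    using p that len unfolding vpath_with_proj_iff by auto
  have inV: "p ! i \<in> I \<or> p ! i \<in> K" if "i \<le> m" for i
  proof -
    have "p ! i \<in> pverts G" using p that len unfolding vpath_with_proj_iff by (auto simp: D_def)
    then show ?thesis using IK by blast
  qed
  have pot_le: "pot (p ! i) \<le> pot (p ! j)" if "i \<le> j" "j \<le> m" for i j
    using that
  proof (induction rule: dec_induct)
    case (step n)
    then show ?case using \<open>\<And>i. i < m \<Longrightarrow> (p ! i, p ! Suc i) \<in> parcs D\<close>[of n] by (auto simp: D_iff)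
  qed simp
  have pot_less: "pot (p ! i) < pot (p ! j)" if "i < j" "j \<le> m" for i j
    using pot_le[of "Suc i" j] step[of i] that by (auto simp: D_iff)
  have hl: "hd p = p ! 0" "last p = p ! m"
    using len by (auto simp: hd_conv_nth last_conv_nth simp flip: length_greater_0_conv)
  show "((hd p, last p) \<notin> parcs D \<and> (last p, hd p) \<notin> parcs D) \<or>
     (\<forall>i j. i < j \<and> j < length p \<longrightarrow> (p ! i, p ! j) \<in> parcs D)"
  proof (cases "(p ! 0, p ! m) \<in> parcs D")
    case False
    moreover have "(p ! m, p ! 0) \<notin> parcs D" using pot_less[of 0 m] len by (auto simp: D_iff)
    ultimately show ?thesis using hl by simp
  next
    case e: True
    \<comment> \<open>A vertex of \<open>I\<close> with an incoming arc is not a source, so it is of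
      split type and sits at its gap.\<close>
    have below: "split_type (p ! i) \<and> p ! (i - 1) \<in> N (p ! i) \<and> p ! (i - 1) \<in> K \<and> q (p ! (i - 1)) < gap (p ! i)"
      if i: "0 < i" "i \<le> m" "p ! i \<in> I" for i
    proof -
      have "(p ! (i - 1), p ! i) \<in> parcs D" using step[of "i - 1"] i by simp
      moreover from this have "p ! (i - 1) \<in> N (p ! i)" using N_I[OF arcs_symmetric] i by (auto simp: D_iff)
      moreover from this have "p ! (i - 1) \<in> K" by (simp add: N_def)
      moreover from this have "Min (q ` K) \<le> q (p ! (i - 1))" using finK by simp
      ultimately show ?thesis using pot_I[OF i(3)] pot_K by (auto simp: D_iff split: if_splits)
    qed
    have low: "v \<in> N (p ! i)" if i: "0 < i" "i \<le> m" "p ! i \<in> I" and v: "v \<in> K" "q v \<le> q (p ! (i - 1))" for i v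
      using below[OF i] gap_ex[OF i(3)] v by auto
    have above: "p ! Suc i \<in> N (p ! i) \<and> p ! Suc i \<in> K \<and> (split_type (p ! i) \<longrightarrow> gap (p ! i) < q (p ! Suc i))"
      if i: "i < m" "p ! i \<in> I" for i
    proof -
      have "(p ! i, p ! Suc i) \<in> parcs D" using step i by simp
      moreover from this have "p ! Suc i \<in> N (p ! i)" using N_I i by (auto simp: D_iff)
      moreover from this have "p ! Suc i \<in> K" by (simp add: N_def)
      ultimately show ?thesis using pot_I[OF i(2)] pot_K by (auto simp: D_iff)
    qed
    have high: "v \<in> N (p ! i)" if i: "i < m" "p ! i \<in> I" "split_type (p ! i)" and v: "v \<in> K" "q (p ! Suc i) \<le> q v" for i v
      using N_above[OF i(2,3) _ _ v] above[OF i(1,2)] i by blast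
    have qle: "q (p ! i) \<le> q (p ! j)" if "p ! i \<in> K" "p ! j \<in> K" "i \<le> j" "j \<le> m" for i j
      using pot_le[OF that(3,4)] pot_K that by simp
    have end0: "p ! m \<in> K" "p ! m \<in> N (p ! 0)" if "p ! 0 \<in> I"
      using N_I[of "p ! 0" "p ! m"] e that by (auto simp: D_iff N_def)
    \<comment> \<open>A first vertex in \<open>I\<close> may be a source whose neighbourhood is an
      interval; the arc to \<open>p ! m\<close> then guarantees that the interval extends to the end
      of the path.\<close>
    have start: "v \<in> N (p ! 0)" if "p ! 0 \<in> I" "v \<in> K" "q (p ! 1) \<le> q v" "q v \<le> q (p ! m)" for v
    proof (cases "split_type (p ! 0)")
      case True then show ?thesis using high[of 0 v] that len by simp
    next
      case False
      show ?thesis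
      proof (rule ccontr)
        assume nv: "v \<notin> N (p ! 0)"
        have 1: "p ! 1 \<in> N (p ! 0)" "p ! 1 \<in> K" using above[of 0] that len by auto
        have "q (p ! 1) \<noteq> q v" "q v \<noteq> q (p ! m)"
          using q_neq[of "p ! 1" v] q_neq[of v "p ! m"] 1 end0[OF that(1)] nv that by metis+
        then show False using False 1 end0[OF that(1)] nv that unfolding split_type_def by force
      qed
    qed
    have conflict: False if i: "0 < i" "i < m" "p ! i \<in> I" and j: "j \<le> m" "j \<noteq> i" "p ! j \<in> I" for i j
    proof -
      let ?x = "p ! i" and ?y = "p ! j" and ?a = "p ! (i - 1)" and ?c = "p ! Suc i"
      have a: "?a \<in> K" "?a \<in> N ?x" "q ?a < gap ?x" "split_type ?x" using below[of i] i by auto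
      have c: "?c \<in> K" "?c \<in> N ?x" "gap ?x < q ?c" using above[OF i(2,3)] a by auto
      obtain b where b: "b \<in> K" "b \<notin> N ?x" "q b = gap ?x" using gap_ex[OF i(3)] by blast
      obtain d0 where d0: "d0 \<in> K" "d0 \<notin> N ?y" "q d0 = gap ?y" using gap_ex[OF j(3)] by blast
      have "\<exists>d. ?a \<in> N ?y \<and> ?c \<in> N ?y \<and> d \<in> K \<and> d \<notin> N ?y \<and> (q d < q ?a \<or> q ?c < q d)"
      proof (cases "i < j")
        case True
        then have "Suc i \<noteq> j" using c(1) j(3) IK by auto
        then have ij: "Suc i \<le> j - 1" using True by simp
        note bl = below[of j]
        have "p ! (j - 1) \<in> K" "q (p ! (j - 1)) < gap ?y" using bl j True by auto
        moreover from this have "q ?c \<le> q (p ! (j - 1))" using qle[of "Suc i" "j - 1"] c ij j by auto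
        moreover have "q ?a \<le> q ?c" using a c by simp
        ultimately show ?thesis using low[of j ?a] low[of j ?c] True j a c d0 by (intro exI[of _ d0]) auto
      next
        case False
        then have ji: "j < i" using j by simp
        have "j \<noteq> i - 1" using a(1) j(3) IK by auto
        then have ji': "Suc j \<le> i - 1" using ji by simp
        have ab: "p ! Suc j \<in> K" "p ! Suc j \<in> N ?y" using above[of j] ji i j by auto
        have qa: "q (p ! Suc j) \<le> q ?a" using qle[of "Suc j" "i - 1"] ab a ji' i by simp
        have ac: "q ?a < q ?c" using a c by simp
        show ?thesis
        proof (cases "split_type ?y")
          case True
          then have "gap ?y < q (p ! Suc j)" using above[of j] ji i j by auto
          then show ?thesis using high[of j ?a] high[of j ?c] True ji i j a c qa ac d0 by (intro exI[of _ d0]) auto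
        next
          case False
          then have j0: "j = 0" using below[of j] j by auto
          then have m': "p ! 0 \<in> I" using j by simp
          have cm: "q ?c \<le> q (p ! m)" using qle[of "Suc i" m] c end0[OF m'] i by simp
          have N: "?a \<in> N ?y" "?c \<in> N ?y" using start[OF m', of ?a] start[OF m', of ?c] a c qa ac cm j0 by auto
          have "q d0 < q ?a \<or> q ?c < q d0"
          proof (rule ccontr)
            assume "\<not> ?thesis"
            then have "q (p ! 1) \<le> q d0" "q d0 \<le> q (p ! m)" using qa cm j0 by auto
            then show False using start[OF m' d0(1)] d0(2) j0 by simp
          qed
          then show ?thesis using N d0 by blast
        qed
      qed
      then obtain d where "?a \<in> N ?y" "?c \<in> N ?y" "d \<in> K" "d \<notin> N ?y" "q d < q ?a \<or> q ?c < q d" by blast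
      with no_cover[OF i(3) j(3) a(2) _ c(2) _ b(1,2), of d] b a c show False by auto
    qed
    have "(p ! i, p ! j) \<in> parcs D" if ij: "i < j" "j \<le> m" for i j
    proof -
      have po: "pot (p ! i) < pot (p ! j)" using pot_less[OF ij] .
      have "(p ! i, p ! j) \<in> parcs G"
      proof (cases "p ! i \<in> I")
        case iI: True
        show ?thesis
        proof (cases "p ! j \<in> I")
          case True
          have "\<not> (i = 0 \<and> j = m)" using e ind[OF iI True] by (auto simp: D_iff)
          then show ?thesis using conflict[of i j] conflict[of j i] ij iI True by auto
        next
          case False
          then have jK: "p ! j \<in> K" using inV[of j] ij by blast
          have ab: "p ! Suc i \<in> K" using above[of i] iI ij by auto
          have "q (p ! Suc i) \<le> q (p ! j)" using qle[OF ab jK] ij by simp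
          moreover have "q (p ! j) \<le> q (p ! m)" if "i = 0" using qle[OF jK, of m] end0 iI ij that by simp
          moreover have "split_type (p ! i)" if "i \<noteq> 0" using below[of i] that iI ij by simp
          ultimately have "p ! j \<in> N (p ! i)" using high[of i "p ! j"] start[of "p ! j"] iI ij jK by (cases "i = 0") auto
          then show ?thesis by (simp add: N_def)
        qed
      next
        case False
        then have iK: "p ! i \<in> K" using inV[of i] ij by simp
        show ?thesis
        proof (cases "p ! j \<in> I")
          case True
          have "p ! (j - 1) \<in> K" using below[of j] True ij by simp
          then have "q (p ! i) \<le> q (p ! (j - 1))" using qle[OF iK, of "j - 1"] ij by simp
          then have "p ! i \<in> N (p ! j)" using low[of j "p ! i"] True ij iK by simp
          then show ?thesis by (auto simp: N_def intro: arcs_symmetric)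
        next
          case False
          then have "p ! j \<in> K" using inV[of j] ij by blast
          moreover have "p ! i \<noteq> p ! j" using po by auto
          ultimately show ?thesis using clique iK by blast
        qed
      qed
      with po show ?thesis by (simp add: D_iff)
    qed
    then show ?thesis using len by auto
  qed
qed

end

section \<open>Forbidden configurations have no circular order\<close>

definition arc_order :: "'v set \<Rightarrow> 'v set set \<Rightarrow> ('v \<Rightarrow> int) \<Rightarrow> bool" where
  "arc_order K F p \<longleftrightarrow> inj_on p K \<and> (\<forall>r\<in>F. \<forall>s\<in>F. is_arc K p (r \<inter> s))"

text \<open>After the cut, whichever of \<open>A\<close> and its complement avoids \<open>z\<close>
  is an interval. The equivalences with \<open>z \<notin> A\<close> treat both cases at
  once.\<close>

lemma linear_cut:
  assumes fin: "finite K" and inj: "inj_on p K" and z: "z \<in> K"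
  obtains q :: "'v \<Rightarrow> int" where "inj_on q K"
    "\<And>A a b c. is_arc K p A \<Longrightarrow> a \<in> K - {z} \<Longrightarrow> b \<in> K - {z} \<Longrightarrow> c \<in> K - {z} \<Longrightarrow> q a < q b \<Longrightarrow> q b < q c \<Longrightarrow>
       a \<in> A \<longleftrightarrow> z \<notin> A \<Longrightarrow> c \<in> A \<longleftrightarrow> z \<notin> A \<Longrightarrow> b \<in> A \<longleftrightarrow> z \<notin> A"
proof -
  have "\<bar>p v\<bar> \<le> (\<Sum>v\<in>K. \<bar>p v\<bar>)" if "v \<in> K" for v
    using fin that by (intro member_le_sum) auto
  then obtain N where N: "\<And>v. v \<in> K \<Longrightarrow> \<bar>p v\<bar> < N" by (metis zless_add1_eq order_le_less)
  define q where "q v = (if p v \<ge> p z then p v else p v + 2 * N)" for v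
  have cyc: "cyc p z a b" if "a \<in> K - {z}" "b \<in> K - {z}" "q a < q b" for a b
    using that N[of a] N[of b] N[OF z] inj_onD[OF inj, of a z] inj_onD[OF inj, of b z] z
    unfolding q_def cyc_def by (auto split: if_splits) force+
  have "inj_on q K"
  proof (rule inj_onI)
    fix a b assume ab: "a \<in> K" "b \<in> K" "q a = q b"
    then have "p a = p b" using N[of a] N[of b] N[OF z] unfolding q_def by (auto split: if_splits)
    then show "a = b" using inj_onD[OF inj] ab by blast
  qed
  moreover have "b \<in> A \<longleftrightarrow> z \<notin> A"
    if "is_arc K p A" "a \<in> K - {z}" "b \<in> K - {z}" "c \<in> K - {z}" "q a < q b" "q b < q c"
      "a \<in> A \<longleftrightarrow> z \<notin> A" "c \<in> A \<longleftrightarrow> z \<notin> A" for A a b c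
  proof -
    have c: "cyc p z a b" "cyc p z b c" using cyc that by blast+
    have K: "a \<in> K" "b \<in> K" "c \<in> K" using that by auto
    show ?thesis
    proof (cases "z \<in> A")
      case True
      then show ?thesis using is_arcD[OF that(1) c True _ _ _ z K] that(7,8) by blast
    next
      case False
      then show ?thesis using is_arc_outD[OF that(1) c False _ _ _ z K] that(7,8) by blast
    qed
  qed
  ultimately show thesis by (rule that)
qed

text \<open>Cut at \<open>z\<close>, the rows are intervals, and this makes the columns of a
  staircase monotone. So \<open>c 1\<close> lies strictly between \<open>c 0\<close> and
  \<open>c n\<close>, although these two are on the convex side of \<open>A\<close> and
  \<open>c 1\<close> is not.\<close>

lemma path_rows_no_arc:
  fixes K :: "'v set"
  assumes fin: "finite K" and inj: "inj_on p K" and p: "path_rows K F n c \<rho>" and n: "2 \<le> n"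
    and z: "z \<in> K" "\<And>i. i < n \<Longrightarrow> z \<notin> \<rho> i" and arcs: "\<And>i. i < n \<Longrightarrow> is_arc K p (\<rho> i)"
    and A: "is_arc K p A" "c 0 \<in> A \<longleftrightarrow> z \<notin> A" "c n \<in> A \<longleftrightarrow> z \<notin> A" "c 1 \<in> A \<longleftrightarrow> z \<in> A"
  shows False
proof -
  obtain q :: "'v \<Rightarrow> int" where q: "inj_on q K"
    "\<And>A a b c. is_arc K p A \<Longrightarrow> a \<in> K - {z} \<Longrightarrow> b \<in> K - {z} \<Longrightarrow> c \<in> K - {z} \<Longrightarrow> q a < q b \<Longrightarrow> q b < q c \<Longrightarrow>
       a \<in> A \<longleftrightarrow> z \<notin> A \<Longrightarrow> c \<in> A \<longleftrightarrow> z \<notin> A \<Longrightarrow> b \<in> A \<longleftrightarrow> z \<notin> A"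
    by (rule linear_cut[OF fin inj z(1)]) (rule that)
  have pr: "c j \<in> \<rho> i \<longleftrightarrow> j = i \<or> j = Suc i" if "i < n" "j \<le> n" for i j
    using p that by (auto simp: path_rows_def)
  have cK: "c i \<in> K - {z}" if "i \<le> n" for i
  proof -
    have "\<exists>k<n. c i \<in> \<rho> k"
    proof (cases "i < n")
      case True then show ?thesis using pr[of i i] by auto
    next
      case False then show ?thesis using that pr[of "n - 1" i] n by (intro exI[of _ "n - 1"]) auto
    qed
    then have "c i \<noteq> z" using z(2) by blast
    then show ?thesis using p that by (auto simp: path_rows_def)
  qed
  have neq: "q (c i) \<noteq> q (c (Suc i))" if "i < n" for i
  proof
    assume "q (c i) = q (c (Suc i))"
    then have e: "c i = c (Suc i)" using inj_onD[OF q(1)] cK[of i] cK[of "Suc i"] that by auto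
    show False
    proof (cases "Suc i < n")
      case True
      then show False using pr[of "Suc i" i] pr[of "Suc i" "Suc i"] e by auto
    next
      case False
      then have "i = Suc (i - 1)" "i - 1 < n" using n that by auto
      then show False using pr[of "i - 1" i] pr[of "i - 1" "Suc i"] e that by auto
    qed
  qed
  have between: "\<not> (q (c a) < q (c b) \<and> q (c b) < q (c d))"
    if "i < n" "a \<le> n" "b \<le> n" "d \<le> n" "a = i \<or> a = Suc i" "d = i \<or> d = Suc i" "b \<noteq> i" "b \<noteq> Suc i" for i a b d
    using q(2)[OF arcs[OF that(1)], of "c a" "c b" "c d"] pr that cK z(2)[OF that(1)] by auto
  \<comment> \<open>Column \<open>i + 2\<close> cannot separate the columns of row \<open>i\<close>,
    nor column \<open>i\<close> those of row \<open>i + 1\<close>; only the two monotone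
    arrangements of the three columns remain.\<close>
  have adj: "q (c i) < q (c (Suc i)) \<longleftrightarrow> q (c (Suc i)) < q (c (Suc (Suc i)))" if "Suc i < n" for i
  proof -
    let ?x = "q (c i)" and ?y = "q (c (Suc i))" and ?z = "q (c (Suc (Suc i)))"
    have b: "\<not> (?x < ?z \<and> ?z < ?y)" "\<not> (?y < ?z \<and> ?z < ?x)" 
      using between[of i i "Suc (Suc i)" "Suc i"] between[of i "Suc i" "Suc (Suc i)" i] that by simp_all
    have b': "\<not> (?y < ?x \<and> ?x < ?z)" "\<not> (?z < ?x \<and> ?x < ?y)" 
      using between[of "Suc i" "Suc i" i "Suc (Suc i)"] between[of "Suc i" "Suc (Suc i)" i "Suc i"] that by simp_all
    have "c i \<noteq> c (Suc (Suc i))" using pr[of i i] pr[of i "Suc (Suc i)"] that by auto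
    then have "?x \<noteq> ?z" using inj_onD[OF q(1)] cK[of i] cK[of "Suc (Suc i)"] that by auto
    moreover have "?x \<noteq> ?y" "?y \<noteq> ?z" using neq[of i] neq[of "Suc i"] that by auto
    ultimately show ?thesis using b b' by linarith
  qed
  have dir: "q (c i) < q (c (Suc i)) \<longleftrightarrow> q (c 0) < q (c 1)" if "i < n" for i
    using that adj by (induction i) auto
  have mono: "(q (c 0) < q (c 1) \<longrightarrow> q (c 1) < q (c i)) \<and> (\<not> q (c 0) < q (c 1) \<longrightarrow> q (c i) < q (c 1))" if "2 \<le> i" "i \<le> n" for i
    using that
  proof (induction i rule: dec_induct)
    case base
    then show ?case using dir[of 1] neq[of 1] n by (auto simp: numeral_2_eq_2)
  next
    case (step i)
    then show ?case using dir[of i] neq[of i] by (smt (verit) Suc_leD Suc_le_lessD)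
  qed
  have "q (c 0) < q (c 1) \<and> q (c 1) < q (c n) \<or> q (c n) < q (c 1) \<and> q (c 1) < q (c 0)"
    using mono[OF n] neq[of 0] n by force
  then show False
    using q(2)[OF A(1), of "c 0" "c 1" "c n"] q(2)[OF A(1), of "c n" "c 1" "c 0"] cK[of 0] cK[of 1] cK[of n] A(2-4) n by auto
qed

text \<open>The conflicting arc is \<open>A \<inter> B\<close>, which contains \<open>z\<close> and
  the inner columns but neither end. Here the conditions on intersections are essential: for
  \<open>A \<noteq> B\<close> each of the two sets may contain one end.\<close>

lemma obst_path_no_order:
  assumes fin: "finite K" and o: "obst_path K F" shows "\<not> arc_order K F p"
proof
  assume ord: "arc_order K F p"
  from o obtain n c \<rho> A B z where *: "2 \<le> n" "path_rows K F n c \<rho>" "A \<in> F" "B \<in> F"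
    "z \<in> K" "z \<in> A" "z \<in> B" "\<forall>i<n. z \<notin> \<rho> i"
    "\<forall>j. 0 < j \<and> j < n \<longrightarrow> c j \<in> A \<and> c j \<in> B" "c 0 \<notin> B" "c n \<notin> A"
    unfolding obst_path_def by (elim exE conjE) (rule that)
  have r: "\<rho> i \<in> F" if "i < n" for i using *(2) that by (simp add: path_rows_def)
  have arc: "is_arc K p (r \<inter> s)" if "r \<in> F" "s \<in> F" for r s using ord that by (simp add: arc_order_def)
  show False
  proof (rule path_rows_no_arc[OF fin _ *(2,1,5)])
    show "is_arc K p (A \<inter> B)" using arc * by blast
    show "is_arc K p (\<rho> i)" if "i < n" for i using arc[OF r[OF that] r[OF that]] by simp
    show "c 1 \<in> A \<inter> B \<longleftrightarrow> z \<in> A \<inter> B" using * by auto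
  qed (use * ord in \<open>auto simp: arc_order_def\<close>)
qed

text \<open>The last row plays the part of \<open>A\<close>: it contains both ends of the staircase
  formed by the other rows and misses \<open>c 1\<close>, as \<open>k\<close> is at least 3.\<close>

lemma obst_cycle_no_order:
  assumes fin: "finite K" and o: "obst_cycle K F" shows "\<not> arc_order K F p"
proof
  assume ord: "arc_order K F p"
  from o obtain k c \<rho> z where c: "cycle_rows K F k c \<rho>" and z: "z \<in> K" "\<forall>i<k. z \<notin> \<rho> i"
    unfolding obst_cycle_def by blast
  have k: "3 \<le> k" and r: "\<And>i. i < k \<Longrightarrow> \<rho> i \<in> F"
    and m: "\<And>i j. i < k \<Longrightarrow> j < k \<Longrightarrow> c j \<in> \<rho> i \<longleftrightarrow> j = i \<or> j = Suc i mod k"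
    using c by (auto simp: cycle_rows_def)
  have arc: "is_arc K p r" if "r \<in> F" for r using ord that unfolding arc_order_def by (metis Int_absorb)
  have P: "path_rows K F (k - 1) c \<rho>"
    using c by (auto simp: cycle_rows_def path_rows_def mod_less)
  show False
  proof (rule path_rows_no_arc[OF fin _ P _ z(1)])
    show "is_arc K p (\<rho> (k - 1))" using arc r k by simp
    show "is_arc K p (\<rho> i)" if "i < k - 1" for i using arc r that by simp
    show "c 0 \<in> \<rho> (k - 1) \<longleftrightarrow> z \<notin> \<rho> (k - 1)" "c (k - 1) \<in> \<rho> (k - 1) \<longleftrightarrow> z \<notin> \<rho> (k - 1)" "c 1 \<in> \<rho> (k - 1) \<longleftrightarrow> z \<in> \<rho> (k - 1)"
      using m[of "k - 1"] z k by auto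
  qed (use k z ord in \<open>auto simp: arc_order_def\<close>)
qed

text \<open>The arc condition as an equation between two orientations, the form in which the
  concrete patterns are evaluated.\<close>

lemma arc_same_side:
  assumes "is_arc K p A" "inj_on p K" "a \<in> K" "b \<in> K" "c \<in> K" "d \<in> K" "a \<in> A" "c \<in> A" "b \<notin> A" "d \<notin> A"
  shows "cyc p a b c \<longleftrightarrow> cyc p a d c"
proof -
  have "cyc p a d c" if "cyc p a b c" "b \<in> K" "d \<in> K" "b \<notin> A" "d \<notin> A" for b d
  proof (rule ccontr)
    assume "\<not> ?thesis"
    moreover have "p a \<noteq> p d" "p d \<noteq> p c" using that assms inj_onD[OF assms(2)] by blast+
    ultimately have "cyc p a c d" using cyc_total[of p a d c] cyc_neq[OF that(1)] cyc_rotate by metis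
    then show False using is_arcD[OF assms(1) that(1)] that assms by blast
  qed
  then show ?thesis using assms by blast
qed

text \<open>The arc conditions restricted to the chosen columns, numbered by position, so that each
  concrete pattern yields a finite problem about integers. A product of entries is 1 exactly for a
  column in both rows.\<close>

definition pattern_order :: "nat list list \<Rightarrow> (nat \<Rightarrow> int) \<Rightarrow> bool" where
  "pattern_order P x \<longleftrightarrow>
     (\<forall>i<length P. \<forall>a<length (P ! i). \<forall>b<length (P ! i). P ! i ! a \<noteq> P ! i ! b \<longrightarrow> x a \<noteq> x b) \<and>
     (\<forall>i<length P. \<forall>k<length P. \<forall>a b c d. list_all (\<lambda>j. j < length (P ! i)) [a, b, c, d] \<and>
        P ! i ! a * P ! k ! a = 1 \<and> P ! i ! c * P ! k ! c = 1 \<and> P ! i ! b * P ! k ! b = 0 \<and> P ! i ! d * P ! k ! d = 0 \<longrightarrow>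
        cyc x a b c = cyc x a d c)"

lemma pattern_orderD:
  assumes "pattern_order P x"
  shows "i < length P \<Longrightarrow> a < length (P ! i) \<Longrightarrow> b < length (P ! i) \<Longrightarrow> P ! i ! a \<noteq> P ! i ! b \<Longrightarrow> x a \<noteq> x b"
    and "i < length P \<Longrightarrow> k < length P \<Longrightarrow> list_all (\<lambda>j. j < length (P ! i)) [a, b, c, d] \<Longrightarrow>
      P ! i ! a * P ! k ! a = 1 \<Longrightarrow> P ! i ! c * P ! k ! c = 1 \<Longrightarrow> P ! i ! b * P ! k ! b = 0 \<Longrightarrow>
      P ! i ! d * P ! k ! d = 0 \<Longrightarrow> cyc x a b c \<longleftrightarrow> cyc x a d c"
  using assms unfolding pattern_order_def by blast+

lemma pattern_arc_order:
  assumes "arc_order K F p" "has_pattern K F P"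
  obtains x where "pattern_order P x"
proof -
  from assms(2) obtain cs rs where cs: "set cs \<subseteq> K" and rs: "set rs \<subseteq> F"
    and P: "P = map (\<lambda>r. map (\<lambda>c. if c \<in> r then 1 else 0) cs) rs" unfolding has_pattern_def by blast
  have inj: "inj_on p K" and arc: "\<And>r s. r \<in> F \<Longrightarrow> s \<in> F \<Longrightarrow> is_arc K p (r \<inter> s)"
    using assms(1) by (auto simp: arc_order_def)
  have K: "cs ! j \<in> K" if "j < length cs" for j using cs that by auto
  have "pattern_order P (\<lambda>j. p (cs ! j))"
    unfolding pattern_order_def
  proof (intro conjI allI impI, goal_cases)
    case (1 i a b)
    then have "cs ! a \<noteq> cs ! b" "a < length cs" "b < length cs" by (auto simp: P)
    then show ?case using inj_onD[OF inj] K by blast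
  next
    case (2 i k a b c d)
    then have "rs ! i \<in> set rs" "rs ! k \<in> set rs" by (simp_all add: P)
    then have "is_arc K p (rs ! i \<inter> rs ! k)" using arc rs by blast
    note same = arc_same_side[OF this inj]
    have lt: "i < length rs" "k < length rs" "a < length cs" "b < length cs" "c < length cs" "d < length cs"
      using 2 by (auto simp: P)
    have ind: "P ! i' ! j = (if cs ! j \<in> rs ! i' then 1 else 0)" if "i' < length rs" "j < length cs" for i' j
      using that by (simp add: P)
    have "cyc (\<lambda>j. p (cs ! j)) u v w \<longleftrightarrow> cyc p (cs ! u) (cs ! v) (cs ! w)" for u v w by (simp add: cyc_def)
    moreover have "cyc p (cs ! a) (cs ! b) (cs ! c) \<longleftrightarrow> cyc p (cs ! a) (cs ! d) (cs ! c)"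
      by (rule same) (use 2 K lt in \<open>auto simp: ind split: if_splits\<close>)
    ultimately show ?case by simp
  qed
  then show thesis by (rule that)
qed

text \<open>Single rows already conflict here. In each instance the two indices name the rows whose
  intersection gives the condition.\<close>

lemma pattern_IV_no_order: "arc_order K F p \<Longrightarrow> \<not> has_pattern K F P_IV"
proof (rule notI, erule (1) pattern_arc_order)
  fix x assume x: "pattern_order P_IV x"
  have "cyc x 0 2 1 \<longleftrightarrow> cyc x 0 3 1" by (rule pattern_orderD(2)[OF x, of 0 0]) (simp_all add: P_IV_def)
  moreover have "cyc x 1 0 3 \<longleftrightarrow> cyc x 1 2 3" by (rule pattern_orderD(2)[OF x, of 3 3]) (simp_all add: P_IV_def)
  moreover have "cyc x 4 0 5 \<longleftrightarrow> cyc x 4 3 5" by (rule pattern_orderD(2)[OF x, of 2 2]) (simp_all add: P_IV_def)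
  moreover have "cyc x 3 0 5 \<longleftrightarrow> cyc x 3 4 5" by (rule pattern_orderD(2)[OF x, of 3 3]) (simp_all add: P_IV_def)
  moreover have "cyc x 0 2 1 \<longleftrightarrow> cyc x 0 4 1" by (rule pattern_orderD(2)[OF x, of 0 0]) (simp_all add: P_IV_def)
  moreover have "cyc x 2 0 3 \<longleftrightarrow> cyc x 2 5 3" by (rule pattern_orderD(2)[OF x, of 1 1]) (simp_all add: P_IV_def)
  moreover have "cyc x 1 2 5 \<longleftrightarrow> cyc x 1 4 5" by (rule pattern_orderD(2)[OF x, of 3 3]) (simp_all add: P_IV_def)
  moreover have "x 0 \<noteq> x 1" "x 0 \<noteq> x 2" "x 0 \<noteq> x 3" "x 0 \<noteq> x 4" "x 0 \<noteq> x 5" "x 1 \<noteq> x 2" "x 1 \<noteq> x 3" "x 1 \<noteq> x 4" "x 1 \<noteq> x 5" "x 2 \<noteq> x 3" "x 2 \<noteq> x 4" "x 2 \<noteq> x 5" "x 3 \<noteq> x 4" "x 3 \<noteq> x 5" "x 4 \<noteq> x 5"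
    using pattern_orderD(1)[OF x, of 0] pattern_orderD(1)[OF x, of 1] pattern_orderD(1)[OF x, of 3] by (simp_all add: P_IV_def)
  ultimately show False unfolding cyc_def by (smt (verit))
qed

lemma pattern_V_no_order: "arc_order K F p \<Longrightarrow> \<not> has_pattern K F P_V"
proof (rule notI, erule (1) pattern_arc_order)
  fix x assume x: "pattern_order P_V x"
  have "cyc x 0 2 1 \<longleftrightarrow> cyc x 0 3 1" by (rule pattern_orderD(2)[OF x, of 0 0]) (simp_all add: P_V_def)
  moreover have "cyc x 0 1 3 \<longleftrightarrow> cyc x 0 2 3" by (rule pattern_orderD(2)[OF x, of 1 3]) (simp_all add: P_V_def)
  moreover have "cyc x 0 2 1 \<longleftrightarrow> cyc x 0 4 1" by (rule pattern_orderD(2)[OF x, of 0 0]) (simp_all add: P_V_def)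
  moreover have "cyc x 2 0 3 \<longleftrightarrow> cyc x 2 4 3" by (rule pattern_orderD(2)[OF x, of 1 2]) (simp_all add: P_V_def)
  moreover have "cyc x 0 1 3 \<longleftrightarrow> cyc x 0 4 3" by (rule pattern_orderD(2)[OF x, of 1 3]) (simp_all add: P_V_def)
  moreover have "cyc x 0 1 4 \<longleftrightarrow> cyc x 0 2 4" by (rule pattern_orderD(2)[OF x, of 3 3]) (simp_all add: P_V_def)
  moreover have "x 0 \<noteq> x 1" "x 0 \<noteq> x 2" "x 0 \<noteq> x 3" "x 0 \<noteq> x 4" "x 1 \<noteq> x 2" "x 1 \<noteq> x 3" "x 1 \<noteq> x 4" "x 2 \<noteq> x 3" "x 2 \<noteq> x 4" "x 3 \<noteq> x 4"
    using pattern_orderD(1)[OF x, of 0] pattern_orderD(1)[OF x, of 1] pattern_orderD(1)[OF x, of 3] by (simp_all add: P_V_def)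
  ultimately show False unfolding cyc_def by (smt (verit))
qed

text \<open>Each row misses just one of the four columns and is an arc in every order. The conflict
  comes from the pairwise intersections, which would make column 3 a cyclic neighbour of all three
  others.\<close>

lemma pattern_VI_no_order: "arc_order K F p \<Longrightarrow> \<not> has_pattern K F P_VI"
proof (rule notI, erule (1) pattern_arc_order)
  fix x assume x: "pattern_order P_VI x"
  have "cyc x 1 0 3 \<longleftrightarrow> cyc x 1 2 3" by (rule pattern_orderD(2)[OF x, of 0 1]) (simp_all add: P_VI_def)
  moreover have "cyc x 0 1 3 \<longleftrightarrow> cyc x 0 2 3" by (rule pattern_orderD(2)[OF x, of 0 2]) (simp_all add: P_VI_def)
  moreover have "cyc x 2 0 3 \<longleftrightarrow> cyc x 2 1 3" by (rule pattern_orderD(2)[OF x, of 1 2]) (simp_all add: P_VI_def)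
  moreover have "x 0 \<noteq> x 1" "x 0 \<noteq> x 2" "x 0 \<noteq> x 3" "x 1 \<noteq> x 2" "x 1 \<noteq> x 3" "x 2 \<noteq> x 3"
    using pattern_orderD(1)[OF x, of 0] pattern_orderD(1)[OF x, of 1] pattern_orderD(1)[OF x, of 2] by (simp_all add: P_VI_def)
  ultimately show False unfolding cyc_def by (smt (verit))
qed

lemma pattern_comp_no_order: "arc_order K F p \<Longrightarrow> \<not> has_pattern K F P_comp"
proof (rule notI, erule (1) pattern_arc_order)
  fix x assume x: "pattern_order P_comp x"
  have "cyc x 0 2 1 \<longleftrightarrow> cyc x 0 3 1" by (rule pattern_orderD(2)[OF x, of 0 0]) (simp_all add: P_comp_def)
  moreover have "cyc x 0 1 3 \<longleftrightarrow> cyc x 0 2 3" by (rule pattern_orderD(2)[OF x, of 1 1]) (simp_all add: P_comp_def)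
  moreover have "cyc x 0 2 1 \<longleftrightarrow> cyc x 0 4 1" by (rule pattern_orderD(2)[OF x, of 0 0]) (simp_all add: P_comp_def)
  moreover have "cyc x 0 1 4 \<longleftrightarrow> cyc x 0 2 4" by (rule pattern_orderD(2)[OF x, of 1 1]) (simp_all add: P_comp_def)
  moreover have "cyc x 2 0 3 \<longleftrightarrow> cyc x 2 4 3" by (rule pattern_orderD(2)[OF x, of 2 2]) (simp_all add: P_comp_def)
  moreover have "cyc x 1 0 4 \<longleftrightarrow> cyc x 1 3 4" by (rule pattern_orderD(2)[OF x, of 3 3]) (simp_all add: P_comp_def)
  moreover have "x 0 \<noteq> x 1" "x 0 \<noteq> x 2" "x 0 \<noteq> x 3" "x 0 \<noteq> x 4" "x 1 \<noteq> x 2" "x 1 \<noteq> x 3" "x 1 \<noteq> x 4" "x 2 \<noteq> x 3" "x 2 \<noteq> x 4" "x 3 \<noteq> x 4"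
    using pattern_orderD(1)[OF x, of 0] pattern_orderD(1)[OF x, of 1] pattern_orderD(1)[OF x, of 2] by (simp_all add: P_comp_def)
  ultimately show False unfolding cyc_def by (smt (verit))
qed

section \<open>Split graphs of matrices\<close>

definition row_set :: "nat mat \<Rightarrow> nat \<Rightarrow> nat set" where
  "row_set M i = {j. j < dim_col M \<and> M $$ (i, j) = 1}"

definition mat_rows :: "nat mat \<Rightarrow> nat set set" where
  "mat_rows M = row_set M ` {..<dim_row M}"

lemma SG_simps:
  "pverts (SG M) = Inl ` {0..<dim_row M} \<union> Inr ` {0..<dim_col M}"
  "(Inl i, Inl i') \<notin> parcs (SG M)"
  "(Inl i, Inr j) \<in> parcs (SG M) \<longleftrightarrow> i < dim_row M \<and> j < dim_col M \<and> M $$ (i, j) = 1"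
  "(Inr j, Inl i) \<in> parcs (SG M) \<longleftrightarrow> i < dim_row M \<and> j < dim_col M \<and> M $$ (i, j) = 1"
  "(Inr j, Inr j') \<in> parcs (SG M) \<longleftrightarrow> j < dim_col M \<and> j' < dim_col M \<and> j \<noteq> j'"
  by (auto simp: SG_def)

lemma SG_wf: "pair_wf_digraph (SG M)"
  by unfold_locales (auto simp: SG_def)

text \<open>An embedded copy of \<open>SG M\<close> need not respect a given partition of
  \<open>G\<close>. The order is therefore taken on the image of the columns, for which being a
  clique is enough.\<close>

lemma induced_arc_order:
  assumes G: "pair_graph G" and st: "semi_transitive G" and H: "contains_induced G (SG M)"
  shows "\<exists>p. arc_order {..<dim_col M} (mat_rows M) p"
proof -
  from st obtain D where D: "semi_transitive_orientation G D" by (auto simp: semi_transitive_def)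
  interpret st_orientation G D by (rule st_orientation.intro[OF G D])
  obtain \<phi> where inj: "inj_on \<phi> (pverts (SG M))" and sub: "\<phi> ` pverts (SG M) \<subseteq> pverts G"
    and arcs: "\<And>u v. u \<in> pverts (SG M) \<Longrightarrow> v \<in> pverts (SG M) \<Longrightarrow> (u, v) \<in> parcs (SG M) \<longleftrightarrow> (\<phi> u, \<phi> v) \<in> parcs G"
    using contains_inducedD[OF H] by blast
  let ?n = "dim_col M" and ?m = "dim_row M"
  let ?C = "(\<lambda>j. \<phi> (Inr j)) ` {..<?n}" and ?I = "(\<lambda>i. \<phi> (Inl i)) ` {..<?m}"
  have V: "Inr j \<in> pverts (SG M) \<longleftrightarrow> j < ?n" "Inl i \<in> pverts (SG M) \<longleftrightarrow> i < ?m" for i j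
    by (auto simp: SG_simps)
  have 1: "?C \<subseteq> pverts G" using sub V by auto
  have 2: "(u, v) \<in> parcs G" if uv: "u \<in> ?C" "v \<in> ?C" "u \<noteq> v" for u v
  proof -
    from uv obtain j j' where j: "u = \<phi> (Inr j)" "v = \<phi> (Inr j')" "j < ?n" "j' < ?n" by auto
    then show ?thesis using arcs[of "Inr j" "Inr j'"] uv(3) V SG_simps(5)[of j j' M] by auto
  qed
  have 3: "(x, y) \<notin> parcs G" if "x \<in> ?I" "y \<in> ?I" for x y
    using that arcs[of "Inl _" "Inl _"] V SG_simps(2) by auto
  from circular_order_exists[of ?C ?I, OF 1 2 3] obtain f where f: "inj_on f ?C"
    "\<And>x y. x \<in> ?I \<Longrightarrow> y \<in> ?I \<Longrightarrow> is_arc ?C f ({v\<in>?C. (x, v) \<in> parcs G} \<inter> {v\<in>?C. (y, v) \<in> parcs G})" by blast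
  let ?p = "\<lambda>j. f (\<phi> (Inr j))"
  have "inj_on ?p {..<?n}"
  proof (rule inj_onI)
    fix j j' assume j: "j \<in> {..<?n}" "j' \<in> {..<?n}" "?p j = ?p j'"
    then have "\<phi> (Inr j) = \<phi> (Inr j')" using inj_onD[OF f(1)] by blast
    then show "j = j'" using inj_onD[OF inj] V j by blast
  qed
  moreover have "is_arc {..<?n} ?p (row_set M i \<inter> row_set M i')" if i: "i < ?m" "i' < ?m" for i i'
  proof -
    let ?A = "{v\<in>?C. (\<phi> (Inl i), v) \<in> parcs G} \<inter> {v\<in>?C. (\<phi> (Inl i'), v) \<in> parcs G}"
    have arc: "is_arc ?C f ?A" using f(2) i by blast
    have mem: "\<phi> (Inr j) \<in> ?A \<longleftrightarrow> j \<in> row_set M i \<inter> row_set M i'" if "j < ?n" for j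
      using arcs[of "Inl i" "Inr j"] arcs[of "Inl i'" "Inr j"] V i that SG_simps(3) by (auto simp: row_set_def)
    have cyc: "cyc ?p a b c \<longleftrightarrow> cyc f (\<phi> (Inr a)) (\<phi> (Inr b)) (\<phi> (Inr c))" for a b c by (simp add: cyc_def)
    show ?thesis unfolding is_arc_def
    proof (intro ballI impI, rule ccontr)
      fix a b c d assume K: "a \<in> {..<?n}" "b \<in> {..<?n}" "c \<in> {..<?n}" "d \<in> {..<?n}"
      assume *: "cyc ?p a b c \<and> cyc ?p a c d \<and> a \<in> row_set M i \<inter> row_set M i' \<and> c \<in> row_set M i \<inter> row_set M i'"
        and n: "\<not> (b \<in> row_set M i \<inter> row_set M i' \<or> d \<in> row_set M i \<inter> row_set M i')"
      show False
        by (rule is_arcD[OF arc, of "\<phi> (Inr a)" "\<phi> (Inr b)" "\<phi> (Inr c)" "\<phi> (Inr d)"])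
          (use * n K mem[of a] mem[of b] mem[of c] mem[of d] cyc in blast)+
    qed
  qed
  ultimately have "arc_order {..<?n} (mat_rows M) ?p" by (auto simp: arc_order_def mat_rows_def)
  then show ?thesis by blast
qed

text \<open>The columns may be any clique of \<open>G\<close>, so that an independent vertex can
  serve as a column in \<open>contains_cycle_full\<close>.\<close>

lemma SG_containedI:
  assumes G: "pair_graph G"
    and x: "\<And>i. i < dim_row M \<Longrightarrow> x i \<in> pverts G" "inj_on x {..<dim_row M}"
      "\<And>i i'. i < dim_row M \<Longrightarrow> i' < dim_row M \<Longrightarrow> (x i, x i') \<notin> parcs G"
    and c: "\<And>j. j < dim_col M \<Longrightarrow> c j \<in> pverts G"
      "\<And>j j'. j < dim_col M \<Longrightarrow> j' < dim_col M \<Longrightarrow> j \<noteq> j' \<Longrightarrow> (c j, c j') \<in> parcs G"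
    and xc: "\<And>i j. i < dim_row M \<Longrightarrow> j < dim_col M \<Longrightarrow> x i \<noteq> c j"
      "\<And>i j. i < dim_row M \<Longrightarrow> j < dim_col M \<Longrightarrow> (x i, c j) \<in> parcs G \<longleftrightarrow> M $$ (i, j) = 1"
  shows "contains_induced G (SG M)"
proof (rule contains_inducedI[OF SG_wf, of "case_sum x c"])
  interpret pair_graph G by (rule G)
  have loop: "(v, v) \<notin> parcs G" for v using no_loops by fastforce
  have cj: "j = j'" if "j < dim_col M" "j' < dim_col M" "c j = c j'" for j j'
    using c(2)[OF that(1,2)] loop that(3) by metis
  show "inj_on (case_sum x c) (pverts (SG M))"
  proof (rule inj_onI)
    fix u v assume "u \<in> pverts (SG M)" "v \<in> pverts (SG M)" "case_sum x c u = case_sum x c v"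
    then show "u = v"
      using cj xc(1) inj_onD[OF x(2)] by (cases u; cases v) (auto simp: SG_simps, metis+)
  qed
  show "case_sum x c ` pverts (SG M) \<subseteq> pverts G" using x c by (auto simp: SG_simps)
  fix u v assume uv: "u \<in> pverts (SG M)" "v \<in> pverts (SG M)"
  have sym: "(a, b) \<in> parcs G \<longleftrightarrow> (b, a) \<in> parcs G" for a b using arcs_symmetric by blast
  show "(u, v) \<in> parcs (SG M) \<longleftrightarrow> (case_sum x c u, case_sum x c v) \<in> parcs G"
  proof (cases u)
    case u: (Inl i)
    then have i: "i < dim_row M" using uv by (auto simp: SG_simps)
    show ?thesis
    proof (cases v)
      case (Inl i')
      then show ?thesis using u i uv x(3)[of i i'] by (auto simp: SG_simps)
    next
      case (Inr j)
      then show ?thesis using u i uv xc(2)[of i j] by (auto simp: SG_simps)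
    qed
  next
    case u: (Inr j)
    then have j: "j < dim_col M" using uv by (auto simp: SG_simps)
    show ?thesis
    proof (cases v)
      case (Inl i)
      then show ?thesis using u j uv xc(2)[of i j] sym[of "c j" "x i"] by (auto simp: SG_simps)
    next
      case (Inr j')
      then show ?thesis using u j uv c(2)[of j j'] loop by (auto simp: SG_simps)
    qed
  qed
qed

section \<open>Entries of the forbidden matrices and their obstructions\<close>

lemma M_I_star:
  assumes "3 \<le> k"
  shows "dim_row (append_zero_col (M_I k)) = k" "dim_col (append_zero_col (M_I k)) = Suc k"
    "i < k \<Longrightarrow> j < Suc k \<Longrightarrow> append_zero_col (M_I k) $$ (i, j) = 1 \<longleftrightarrow> j < k \<and> (j = i \<or> j = Suc i mod k)"
proof -
  show "dim_row (append_zero_col (M_I k)) = k" "dim_col (append_zero_col (M_I k)) = Suc k"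
    by (simp_all add: append_zero_col_def M_I_def mat_of_row_supports_def)
  show "append_zero_col (M_I k) $$ (i, j) = 1 \<longleftrightarrow> j < k \<and> (j = i \<or> j = Suc i mod k)" if ij: "i < k" "j < Suc k"
  proof (cases "Suc i = k")
    case True
    then have i: "i = k - 1" by simp
    show ?thesis using ij assms unfolding i
      by (auto simp: append_zero_col_def M_I_def mat_of_row_supports_def)
  next
    case False
    then have "Suc i < k" using ij by simp
    then show ?thesis using ij by (auto simp: append_zero_col_def M_I_def mat_of_row_supports_def)
  qed
qed

lemma M_II_entries:
  assumes "2 \<le> n"
  shows "dim_row (M_II (n + 2)) = n + 2" "dim_col (M_II (n + 2)) = n + 2"
    "i < n + 2 \<Longrightarrow> j < n + 2 \<Longrightarrow> M_II (n + 2) $$ (i, j) = 1 \<longleftrightarrow>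
       (if i < n then j = i \<or> j = Suc i else if i = n then j \<noteq> n else j \<noteq> 0)"
  using assms by (auto simp: M_II_def mat_of_row_supports_def)

lemma M_III_entries:
  assumes "2 \<le> n"
  shows "dim_row (M_III (n + 1)) = n + 1" "dim_col (M_III (n + 1)) = n + 2"
    "i < n + 1 \<Longrightarrow> j < n + 2 \<Longrightarrow> M_III (n + 1) $$ (i, j) = 1 \<longleftrightarrow>
       (if i < n then j = i \<or> j = Suc i else 0 < j \<and> j \<noteq> n)"
  using assms by (auto simp: M_III_def mat_of_row_supports_def)

lemma M_comp_eq: "complement_rows [0, 1, 0, 1] (append_zero_col (M_I 4)) = mat_of_rows_list 5 P_comp"
proof (rule eq_matI)
  fix i j assume "i < dim_row (mat_of_rows_list 5 P_comp)" "j < dim_col (mat_of_rows_list 5 P_comp)"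
  then have "i \<in> {0, 1, 2, 3}" "j \<in> {0, 1, 2, 3, 4}" by (auto simp: P_comp_def mat_of_rows_list_def)
  then show "complement_rows [0, 1, 0, 1] (append_zero_col (M_I 4)) $$ (i, j) = mat_of_rows_list 5 P_comp $$ (i, j)"
    by (auto simp: P_comp_def mat_of_rows_list_def complement_rows_def append_zero_col_def M_I_def mat_of_row_supports_def)
qed (auto simp: P_comp_def mat_of_rows_list_def complement_rows_def append_zero_col_def M_I_def mat_of_row_supports_def)

lemma mat_of_rows_list_pattern:
  assumes "\<forall>r\<in>set P. length r = n \<and> set r \<subseteq> {0, 1}"
  shows "has_pattern {..<n} (mat_rows (mat_of_rows_list n P)) P"
proof -
  let ?M = "mat_of_rows_list n P"
  let ?rs = "map (row_set ?M) [0..<length P]"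
  have "map (\<lambda>r. map (\<lambda>c. if c \<in> r then 1 else 0) [0..<n]) ?rs = P"
  proof (rule nth_equalityI)
    fix i assume "i < length (map (\<lambda>r. map (\<lambda>c. if c \<in> r then 1 else (0::nat)) [0..<n]) ?rs)"
    then have i: "i < length P" by simp
    then have l: "length (P ! i) = n" "set (P ! i) \<subseteq> {0, 1}" using assms nth_mem by blast+
    show "map (\<lambda>r. map (\<lambda>c. if c \<in> r then 1 else (0::nat)) [0..<n]) ?rs ! i = P ! i"
    proof (rule nth_equalityI)
      fix j assume "j < length (map (\<lambda>r. map (\<lambda>c. if c \<in> r then 1 else (0::nat)) [0..<n]) ?rs ! i)"
      then have j: "j < n" using i by simp
      then have "P ! i ! j = 0 \<or> P ! i ! j = 1" using l nth_mem[of j "P ! i"] by blast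
      then show "map (\<lambda>r. map (\<lambda>c. if c \<in> r then 1 else (0::nat)) [0..<n]) ?rs ! i ! j = P ! i ! j"
        using i j l by (auto simp: row_set_def mat_of_rows_list_def)
    qed (use i l in simp)
  qed simp
  moreover have "set [0..<n] \<subseteq> {..<n}" "set ?rs \<subseteq> mat_rows ?M"
    by (auto simp: mat_rows_def mat_of_rows_list_def)
  ultimately show ?thesis unfolding has_pattern_def by blast
qed

lemma G_split_no_arc_order:
  assumes "H \<in> G_split"
  obtains M where "H = SG M" "\<And>p. \<not> arc_order {..<dim_col M} (mat_rows M) p"
proof -
  note witness = that
  have pat: thesis if H: "H = SG (mat_of_rows_list n P)" and P: "\<forall>r\<in>set P. length r = n \<and> set r \<subseteq> {0, 1}"
    and no: "\<And>p. arc_order {..<n} (mat_rows (mat_of_rows_list n P)) p \<Longrightarrow> \<not> has_pattern {..<n} (mat_rows (mat_of_rows_list n P)) P" for n P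
  proof (rule witness[OF H])
    have "dim_col (mat_of_rows_list n P) = n" by (simp add: mat_of_rows_list_def)
    then show "\<not> arc_order {..<dim_col (mat_of_rows_list n P)} (mat_rows (mat_of_rows_list n P)) p" for p
      using no mat_of_rows_list_pattern[OF P] by auto
  qed
  from assms consider (I) k where "3 \<le> k" "H = SG (append_zero_col (M_I k))"
    | (II) k where "4 \<le> k" "H = SG (M_II k)" | (III) k where "3 \<le> k" "H = SG (M_III k)"
    | (IV) "H = SG M_IV" | (V) "H = SG M_V" | (VI) "H = SG M_VI"
    | (comp) "H = SG (complement_rows [0, 1, 0, 1] (append_zero_col (M_I 4)))"
    unfolding G_split_def by blast
  then show thesis
  proof cases
    case I
    let ?M = "append_zero_col (M_I k)"
    note M = M_I_star[OF I(1)]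
    have r: "row_set ?M i \<in> mat_rows ?M" if "i < k" for i using that M by (auto simp: mat_rows_def)
    have m: "j \<in> row_set ?M i \<longleftrightarrow> j < k \<and> (j = i \<or> j = Suc i mod k)" if "i < k" for i j
      using M(2) M(3)[OF that] by (auto simp: row_set_def)
    have "cycle_rows {..<Suc k} (mat_rows ?M) k id (row_set ?M)"
      using I(1) r m by (auto simp: cycle_rows_def)
    moreover have "k \<in> {..<Suc k}" "\<forall>i<k. k \<notin> row_set ?M i" using m by auto
    ultimately have "obst_cycle {..<dim_col ?M} (mat_rows ?M)" unfolding obst_cycle_def M(2) by blast
    then show thesis using that[OF I(2)] obst_cycle_no_order[OF finite_lessThan] by blast
  next
    case II
    define n where "n = k - 2"
    have n: "2 \<le> n" "k = n + 2" using II by (auto simp: n_def)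
    let ?M = "M_II (n + 2)"
    note M = M_II_entries[OF n(1)]
    have r: "row_set ?M i \<in> mat_rows ?M" if "i < n + 2" for i using that M by (auto simp: mat_rows_def)
    have m: "j \<in> row_set ?M i \<longleftrightarrow> j < n + 2 \<and> (if i < n then j = i \<or> j = Suc i else if i = n then j \<noteq> n else j \<noteq> 0)"
      if "i < n + 2" for i j
      using M(2) M(3)[OF that] by (auto simp: row_set_def)
    have "path_rows {..<n + 2} (mat_rows ?M) n id (row_set ?M)"
      using r m by (auto simp: path_rows_def)
    moreover have "row_set ?M n \<in> mat_rows ?M" "row_set ?M (n + 1) \<in> mat_rows ?M" using r by auto
    moreover have "n + 1 \<in> {..<n + 2}" "n + 1 \<in> row_set ?M n" "n + 1 \<in> row_set ?M (n + 1)"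
      "\<forall>i<n. n + 1 \<notin> row_set ?M i" "\<forall>j. 0 < j \<and> j < n \<longrightarrow> id j \<in> row_set ?M n \<and> id j \<in> row_set ?M (n + 1)"
      "id 0 \<notin> row_set ?M (n + 1)" "id n \<notin> row_set ?M n"
      using m by auto
    ultimately have "obst_path {..<dim_col ?M} (mat_rows ?M)" unfolding obst_path_def M(2) using n(1) by blast
    then show thesis using that[of ?M] II n obst_path_no_order[OF finite_lessThan] by blast
  next
    case III
    define n where "n = k - 1"
    have n: "2 \<le> n" "k = n + 1" using III by (auto simp: n_def)
    let ?M = "M_III (n + 1)"
    note M = M_III_entries[OF n(1)]
    have r: "row_set ?M i \<in> mat_rows ?M" if "i < n + 1" for i using that M by (auto simp: mat_rows_def)
    have m: "j \<in> row_set ?M i \<longleftrightarrow> j < n + 2 \<and> (if i < n then j = i \<or> j = Suc i else 0 < j \<and> j \<noteq> n)"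
      if "i < n + 1" for i j
      using M(2) M(3)[OF that] by (auto simp: row_set_def)
    have "path_rows {..<n + 2} (mat_rows ?M) n id (row_set ?M)"
      using r m by (auto simp: path_rows_def)
    moreover have "row_set ?M n \<in> mat_rows ?M" using r by auto
    moreover have "n + 1 \<in> {..<n + 2}" "n + 1 \<in> row_set ?M n"
      "\<forall>i<n. n + 1 \<notin> row_set ?M i" "\<forall>j. 0 < j \<and> j < n \<longrightarrow> id j \<in> row_set ?M n \<and> id j \<in> row_set ?M n"
      "id 0 \<notin> row_set ?M n" "id n \<notin> row_set ?M n"
      using m by auto
    ultimately have "obst_path {..<dim_col ?M} (mat_rows ?M)" unfolding obst_path_def M(2) using n(1) by blast
    then show thesis using that[of ?M] III n obst_path_no_order[OF finite_lessThan] by blast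
  next
    case IV
    show thesis by (rule pat[of 6 P_IV]) (use IV pattern_IV_no_order in \<open>auto simp: M_IV_def P_IV_def\<close>)
  next
    case V
    show thesis by (rule pat[of 5 P_V]) (use V pattern_V_no_order in \<open>auto simp: M_V_def P_V_def\<close>)
  next
    case VI
    show thesis by (rule pat[of 4 P_VI]) (use VI pattern_VI_no_order in \<open>auto simp: M_VI_def P_VI_def\<close>)
  next
    case comp
    show thesis
      by (rule pat[OF comp[unfolded M_comp_eq] _ pattern_comp_no_order]) (simp_all add: P_comp_def)
  qed
qed

text \<open>An embedding has to be injective. Two columns in a common row are consecutive, and a row
  adjacent to the common one tells them apart; for \<open>n = 1\<close> there is no such
  row.\<close>

lemma path_rows_distinct:
  assumes p: "path_rows K F n c \<rho>" and n: "2 \<le> n"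
  shows "inj_on c {..n}" "inj_on \<rho> {..<n}"
proof -
  have m: "c j \<in> \<rho> i \<longleftrightarrow> j = i \<or> j = Suc i" if "i < n" "j \<le> n" for i j
    using p that by (auto simp: path_rows_def)
  have "c i \<noteq> c j" if "i < j" "j \<le> n" for i j
  proof
    assume e: "c i = c j"
    have ij: "j = Suc i" using m[of i i] m[of i j] that e by auto
    show False
    proof (cases "j < n")
      case True
      then show False using m[of j j] m[of j i] e that by auto
    next
      case False
      then have "i - 1 < n" "Suc (i - 1) = i" using ij n that by auto
      then show False using m[of "i - 1" i] m[of "i - 1" j] e that ij by auto
    qed
  qed
  then show "inj_on c {..n}" by (intro inj_onI) (metis atMost_iff linorder_neqE_nat)
  have "\<rho> i \<noteq> \<rho> j" if "i < j" "j < n" for i j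
    using m[of i i] m[of j i] that by auto
  then show "inj_on \<rho> {..<n}" by (intro inj_onI) (metis lessThan_iff linorder_neqE_nat)
qed

lemma cycle_rows_distinct:
  assumes p: "cycle_rows K F k c \<rho>" shows "inj_on c {..<k}" "inj_on \<rho> {..<k}"
proof -
  have k: "3 \<le> k" and m: "\<And>i j. i < k \<Longrightarrow> j < k \<Longrightarrow> c j \<in> \<rho> i \<longleftrightarrow> j = i \<or> j = Suc i mod k"
    using p by (auto simp: cycle_rows_def)
  have ne: "i = j" if "i < k" "j < k" "j = i \<or> j = Suc i mod k" "i = j \<or> i = Suc j mod k" for i j
    using that k by (cases "Suc i = k"; cases "Suc j = k") auto
  show "inj_on c {..<k}"
  proof (rule inj_onI)
    fix i j assume "i \<in> {..<k}" "j \<in> {..<k}" and e: "c i = c j"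
    then have k: "i < k" "j < k" by auto
    have "c j \<in> \<rho> i" "c i \<in> \<rho> j" using m[OF k(1,1)] m[OF k(2,2)] e by auto
    then show "i = j" using ne[OF k] m[OF k] m[OF k(2,1)] by blast
  qed
  show "inj_on \<rho> {..<k}"
  proof (rule inj_onI)
    fix i j assume "i \<in> {..<k}" "j \<in> {..<k}" and e: "\<rho> i = \<rho> j"
    then have k: "i < k" "j < k" by auto
    have "c j \<in> \<rho> i" "c i \<in> \<rho> j" using m[OF k(2,2)] m[OF k(1,1)] e by auto
    then show "i = j" using ne[OF k] m[OF k] m[OF k(2,1)] by blast
  qed
qed

section \<open>Forbidden graphs inside a split graph\<close>

locale split_partition =
  fixes G :: "'a pair_pre_digraph" and I K :: "'a set"
  assumes G: "pair_graph G" and IK: "I \<union> K = pverts G" "I \<inter> K = {}"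
    and ind: "\<And>x y. x \<in> I \<Longrightarrow> y \<in> I \<Longrightarrow> (x, y) \<notin> parcs G"
    and clique: "\<And>u v. u \<in> K \<Longrightarrow> v \<in> K \<Longrightarrow> u \<noteq> v \<Longrightarrow> (u, v) \<in> parcs G"
begin

definition "nb x = {v\<in>K. (x, v) \<in> parcs G}"

text \<open>Different neighbourhoods belong to different vertices, so any choice of representatives
  is injective.\<close>

lemma row_vertices:
  assumes "\<And>i. i < m \<Longrightarrow> \<rho> i \<in> nb ` I" "inj_on \<rho> {..<m}"
  obtains x where "\<And>i. i < m \<Longrightarrow> x i \<in> I \<and> nb (x i) = \<rho> i" "inj_on x {..<m}"
proof -
  have "\<exists>y. y \<in> I \<and> nb y = \<rho> i" if "i < m" for i using assms(1)[OF that] by blast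
  then obtain x where x: "\<And>i. i < m \<Longrightarrow> x i \<in> I \<and> nb (x i) = \<rho> i" by metis
  moreover have "inj_on x {..<m}"
  proof (rule inj_onI)
    fix i j assume ij: "i \<in> {..<m}" "j \<in> {..<m}" "x i = x j"
    then have "\<rho> i = \<rho> j" using x by (metis lessThan_iff)
    then show "i = j" using inj_onD[OF assms(2)] ij by blast
  qed
  ultimately show thesis using that by blast
qed

lemma contains_matrix:
  assumes \<rho>: "\<And>i. i < dim_row M \<Longrightarrow> \<rho> i \<in> nb ` I" "inj_on \<rho> {..<dim_row M}"
    and c: "\<And>j. j < dim_col M \<Longrightarrow> c j \<in> K" "inj_on c {..<dim_col M}"
    and M: "\<And>i j. i < dim_row M \<Longrightarrow> j < dim_col M \<Longrightarrow> c j \<in> \<rho> i \<longleftrightarrow> M $$ (i, j) = 1"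
  shows "contains_induced G (SG M)"
proof -
  obtain x where x: "\<And>i. i < dim_row M \<Longrightarrow> x i \<in> I \<and> nb (x i) = \<rho> i" "inj_on x {..<dim_row M}"
    by (rule row_vertices[OF \<rho>]) (assumption, rule that)
  show ?thesis
  proof (rule SG_containedI[OF G _ x(2), of c])
    show "(x i, c j) \<in> parcs G \<longleftrightarrow> M $$ (i, j) = 1" if "i < dim_row M" "j < dim_col M" for i j
      using M[OF that] c(1)[OF that(2)] x(1)[OF that(1)] by (auto simp: nb_def)
    show "(c j, c j') \<in> parcs G" if "j < dim_col M" "j' < dim_col M" "j \<noteq> j'" for j j'
      using clique[OF c(1)[OF that(1)] c(1)[OF that(2)]] inj_onD[OF c(2), of j j'] that by auto
    show "x i \<noteq> c j" if "i < dim_row M" "j < dim_col M" for i j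
      using x(1)[OF that(1)] c(1)[OF that(2)] IK by auto
    show "x i \<in> pverts G" if "i < dim_row M" for i using x(1)[OF that] IK by blast
    show "c j \<in> pverts G" if "j < dim_col M" for j using c(1)[OF that] IK by blast
    show "(x i, x i') \<notin> parcs G" if "i < dim_row M" "i' < dim_row M" for i i'
      using ind x(1)[OF that(1)] x(1)[OF that(2)] by blast
  qed
qed

lemma contains_cycle:
  assumes o: "obst_cycle K (nb ` I)" shows "\<exists>H\<in>G_split. contains_induced G H"
proof -
  from o obtain k c \<rho> z where cyc: "cycle_rows K (nb ` I) k c \<rho>" and z: "z \<in> K" "\<forall>i<k. z \<notin> \<rho> i"
    unfolding obst_cycle_def by blast
  have k: "3 \<le> k" and r: "\<And>i. i < k \<Longrightarrow> \<rho> i \<in> nb ` I \<and> c i \<in> K"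
    and m: "\<And>i j. i < k \<Longrightarrow> j < k \<Longrightarrow> c j \<in> \<rho> i \<longleftrightarrow> j = i \<or> j = Suc i mod k"
    using cyc by (auto simp: cycle_rows_def)
  note M = M_I_star[OF k] and inj = cycle_rows_distinct[OF cyc]
  let ?c = "\<lambda>j. if j < k then c j else z"
  have cz: "c j \<noteq> z" if "j < k" for j using m[of j j] z that by auto
  have "inj_on ?c {..<Suc k}"
    using inj_onD[OF inj(1)] cz by (intro inj_onI) (auto split: if_splits simp: less_Suc_eq)
  then have "contains_induced G (SG (append_zero_col (M_I k)))"
    using r m inj(2) z M(3) by (intro contains_matrix[of _ \<rho> ?c]) (auto simp: M(1,2))
  then show ?thesis using k unfolding G_split_def by blast
qed

lemma contains_cycle_full:
  assumes o: "obst_cycle_full K (nb ` I)" shows "\<exists>H\<in>G_split. contains_induced G H"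
proof -
  from o obtain k c \<rho> s where cyc: "cycle_rows K (nb ` I) k c \<rho>" and s: "s \<in> nb ` I" "\<forall>j<k. c j \<in> s"
    unfolding obst_cycle_full_def by blast
  have k: "3 \<le> k" and r: "\<And>i. i < k \<Longrightarrow> \<rho> i \<in> nb ` I \<and> c i \<in> K"
    and m: "\<And>i j. i < k \<Longrightarrow> j < k \<Longrightarrow> c j \<in> \<rho> i \<longleftrightarrow> j = i \<or> j = Suc i mod k"
    using cyc by (auto simp: cycle_rows_def)
  note M = M_I_star[OF k] and inj = cycle_rows_distinct[OF cyc]
  obtain x where x: "\<And>i. i < k \<Longrightarrow> x i \<in> I \<and> nb (x i) = \<rho> i" "inj_on x {..<k}"
    by (rule row_vertices[of k \<rho>]) (use r inj(2) in auto)
  obtain y where y: "y \<in> I" "nb y = s" using s by blast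
  \<comment> \<open>A row of the cycle contains only two of its at least three columns, whereas
    \<open>y\<close> is adjacent to all of them.\<close>
  have yx: "x i \<noteq> y" if "i < k" for i
  proof -
    obtain j where "j < k" "j \<noteq> i" "j \<noteq> Suc i mod k"
    proof -
      have "card {i, Suc i mod k} < card {..<k}" using k by (auto simp: card_insert_if)
      then have "\<not> {..<k} \<subseteq> {i, Suc i mod k}" by (metis card_mono finite.emptyI finite.insertI not_le)
      then show thesis using that by blast
    qed
    then have "c j \<notin> \<rho> i" "c j \<in> s" using m that s by auto
    then show ?thesis using x(1)[OF that] y by auto
  qed
  have sym: "(a, b) \<in> parcs G \<Longrightarrow> (b, a) \<in> parcs G" for a b
    by (rule pair_sym_digraph.arcs_symmetric[OF pair_pseudo_graph.axioms(2)[OF pair_graph.axioms(2)[OF G]]])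
  let ?c = "\<lambda>j. if j < k then c j else y"
  have "contains_induced G (SG (append_zero_col (M_I k)))"
  proof (rule SG_containedI[OF G, of _ x ?c], unfold M(1,2))
    show "x i \<in> pverts G" if "i < k" for i using x(1)[OF that] IK by blast
    show "inj_on x {..<k}" by (rule x(2))
    show "(x i, x i') \<notin> parcs G" if "i < k" "i' < k" for i i' using ind x(1)[OF that(1)] x(1)[OF that(2)] by blast
    show "?c j \<in> pverts G" if "j < Suc k" for j using r y IK by auto
    show "(?c j, ?c j') \<in> parcs G" if "j < Suc k" "j' < Suc k" "j \<noteq> j'" for j j'
    proof -
      have yc: "(y, c j) \<in> parcs G" if "j < k" for j using s(2) y that by (auto simp: nb_def)
      show ?thesis
      proof (cases "j < k \<and> j' < k")
        case True
        then have "c j \<noteq> c j'" using inj_onD[OF inj(1), of j j'] that by auto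
        then show ?thesis using True clique r by auto
      next
        case False
        then show ?thesis using that yc[of j] yc[of j'] sym by auto
      qed
    qed
    show "x i \<noteq> ?c j" if "i < k" "j < Suc k" for i j using x(1)[OF that(1)] r[of j] yx[OF that(1)] IK by auto
    show "(x i, ?c j) \<in> parcs G \<longleftrightarrow> append_zero_col (M_I k) $$ (i, j) = 1" if "i < k" "j < Suc k" for i j
    proof (cases "j < k")
      case True
      then show ?thesis using m[of i j] M(3)[OF that] x(1)[OF that(1)] r[of j] that(1) by (auto simp: nb_def)
    next
      case False
      then show ?thesis using M(3)[OF that] ind x(1)[OF that(1)] y by auto
    qed
  qed
  then show ?thesis using k unfolding G_split_def by blast
qed

text \<open>If one of the long rows misses both ends, it alone completes \<open>M_III\<close>.
  Otherwise \<open>A\<close> contains \<open>c 0\<close> and \<open>B\<close> contains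
  \<open>c n\<close>, so each misses exactly one end, and both together complete
  \<open>M_II\<close>.\<close>

lemma contains_path:
  assumes o: "obst_path K (nb ` I)" shows "\<exists>H\<in>G_split. contains_induced G H"
proof -
  from o obtain n c \<rho> A B z where n: "2 \<le> n" and P: "path_rows K (nb ` I) n c \<rho>" and AB: "A \<in> nb ` I" "B \<in> nb ` I"
    and z: "z \<in> K" "z \<in> A" "z \<in> B" "\<forall>i<n. z \<notin> \<rho> i"
    and mid: "\<forall>j. 0 < j \<and> j < n \<longrightarrow> c j \<in> A \<and> c j \<in> B" and ends: "c 0 \<notin> B" "c n \<notin> A"
    unfolding obst_path_def by (elim exE conjE) (rule that)
  have m: "c j \<in> \<rho> i \<longleftrightarrow> j = i \<or> j = Suc i" if "i < n" "j \<le> n" for i j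
    using P that by (auto simp: path_rows_def)
  have r: "\<rho> i \<in> nb ` I" if "i < n" for i using P that by (auto simp: path_rows_def)
  have cK: "c i \<in> K" if "i \<le> n" for i using P that by (auto simp: path_rows_def)
  note inj = path_rows_distinct[OF P n]
  let ?c = "\<lambda>j. if j \<le> n then c j else z"
  have cz: "c j \<noteq> z" if "j \<le> n" for j
  proof (cases "j < n")
    case True then show ?thesis using m[of j j] z by auto
  next
    case False
    then have "n - 1 < n" "j = Suc (n - 1)" using that n by auto
    then show ?thesis using m[of "n - 1" j] z(4) that by blast
  qed
  have ic: "inj_on ?c {..<n + 2}"
    using inj_onD[OF inj(1)] cz by (intro inj_onI) (auto split: if_splits simp: less_Suc_eq)
  have injr: "\<rho> i \<noteq> \<rho> j" if "i < n" "j < n" "i \<noteq> j" for i j using inj_onD[OF inj(2), of i j] that by auto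
  have rAB: "\<rho> i \<noteq> A" "\<rho> i \<noteq> B" if "i < n" for i using z that by auto
  have three: "\<exists>H\<in>G_split. contains_induced G H" if C: "C \<in> nb ` I" "z \<in> C" "c 0 \<notin> C" "c n \<notin> C"
    "\<And>j. 0 < j \<Longrightarrow> j < n \<Longrightarrow> c j \<in> C" "\<And>i. i < n \<Longrightarrow> \<rho> i \<noteq> C" for C
  proof -
    note M = M_III_entries[OF n]
    let ?r = "\<lambda>i. if i < n then \<rho> i else C"
    have "contains_induced G (SG (M_III (n + 1)))"
    proof (rule contains_matrix[of _ ?r ?c], unfold M(1,2))
      show "?r i \<in> nb ` I" for i using r C by auto
      show "inj_on ?r {..<n + 1}" using injr C(6) by (intro inj_onI) (auto split: if_splits simp: less_Suc_eq)
      show "?c j \<in> K" for j using cK z by auto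
      show "inj_on ?c {..<n + 2}" by (rule ic)
      fix i j assume ij: "i < n + 1" "j < n + 2"
      have "j = 0 \<or> 0 < j \<and> j < n \<or> j = n \<or> j = n + 1" using ij by linarith
      then show "?c j \<in> ?r i \<longleftrightarrow> M_III (n + 1) $$ (i, j) = 1"
        unfolding M(3)[OF ij] using m[of i j] z C n by auto
    qed
    moreover have "3 \<le> n + 1" using n by simp
    ultimately show ?thesis unfolding G_split_def by blast
  qed
  show ?thesis
  proof (cases "c 0 \<notin> A \<or> c n \<notin> B")
    case True
    then show ?thesis using three[of A] three[of B] AB z mid ends rAB by auto
  next
    case False
    note M = M_II_entries[OF n]
    let ?r = "\<lambda>i. if i < n then \<rho> i else if i = n then A else B"
    have "A \<noteq> B" using False ends by auto
    have "contains_induced G (SG (M_II (n + 2)))"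
    proof (rule contains_matrix[of _ ?r ?c], unfold M(1,2))
      show "?r i \<in> nb ` I" for i using r AB by auto
      show "inj_on ?r {..<n + 2}"
        using injr rAB \<open>A \<noteq> B\<close> by (intro inj_onI) (auto split: if_splits simp: less_Suc_eq)
      show "?c j \<in> K" for j using cK z by auto
      show "inj_on ?c {..<n + 2}" by (rule ic)
      fix i j assume ij: "i < n + 2" "j < n + 2"
      have "j = 0 \<or> 0 < j \<and> j < n \<or> j = n \<or> j = n + 1" using ij by linarith
      then show "?c j \<in> ?r i \<longleftrightarrow> M_II (n + 2) $$ (i, j) = 1"
        unfolding M(3)[OF ij] using m[of i j] z mid ends False n ij by auto
    qed
    moreover have "4 \<le> n + 2" using n by simp
    ultimately show ?thesis unfolding G_split_def by blast
  qed
qed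

text \<open>Repeated rows or columns in the choice would show as repeated rows or columns of
  \<open>P\<close>; distinctness in \<open>P\<close> therefore gives injectivity.\<close>

lemma contains_pattern:
  assumes P: "has_pattern K (nb ` I) P" and n: "\<forall>r\<in>set P. length r = n" "P \<noteq> []"
    and d: "distinct P" "distinct (map (\<lambda>j. map (\<lambda>r. r ! j) P) [0..<n])"
  shows "contains_induced G (SG (mat_of_rows_list n P))"
proof -
  from P obtain cs rs where cr: "set cs \<subseteq> K" "set rs \<subseteq> nb ` I"
    and eq: "map (\<lambda>r. map (\<lambda>c. if c \<in> r then 1 else 0) cs) rs = P"
    unfolding has_pattern_def by blast
  have l: "length rs = length P" using eq by auto
  have lc: "length cs = n" using n eq by (cases rs) auto
  have m: "P ! i ! j = (if cs ! j \<in> rs ! i then 1 else 0)" if "i < length P" "j < n" for i j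
    unfolding eq[symmetric] using that l lc by simp
  have dim: "dim_row (mat_of_rows_list n P) = length P" "dim_col (mat_of_rows_list n P) = n"
    by (auto simp: mat_of_rows_list_def)
  show ?thesis
  proof (rule contains_matrix[of _ "\<lambda>i. rs ! i" "\<lambda>j. cs ! j"], unfold dim)
    show "rs ! i \<in> nb ` I" if "i < length P" for i using cr l that by auto
    show "inj_on ((!) rs) {..<length P}"
    proof (rule inj_onI)
      fix i i' assume i: "i \<in> {..<length P}" "i' \<in> {..<length P}" "rs ! i = rs ! i'"
      have "P ! i = P ! i'" using i n m by (intro nth_equalityI) auto
      then show "i = i'" using d(1) i by (simp add: nth_eq_iff_index_eq)
    qed
    show "cs ! j \<in> K" if "j < n" for j using cr lc that by auto
    show "inj_on ((!) cs) {..<n}"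
    proof (rule inj_onI)
      fix j j' assume j: "j \<in> {..<n}" "j' \<in> {..<n}" "cs ! j = cs ! j'"
      have "map (\<lambda>r. r ! j) P = map (\<lambda>r. r ! j') P" using j m by (intro nth_equalityI) auto
      then show "j = j'" using d(2) j by (auto simp: distinct_conv_nth)
    qed
    show "cs ! j \<in> rs ! i \<longleftrightarrow> mat_of_rows_list n P $$ (i, j) = 1" if "i < length P" "j < n" for i j
      using m[OF that] that by (simp add: mat_of_rows_list_def)
  qed
qed

lemma contains_obst:
  assumes "obst K (nb ` I)" shows "\<exists>H\<in>G_split. contains_induced G H"
proof -
  have mem: "SG (mat_of_rows_list 6 P_IV) \<in> G_split" "SG (mat_of_rows_list 5 P_V) \<in> G_split"
    "SG (mat_of_rows_list 4 P_VI) \<in> G_split" "SG (mat_of_rows_list 5 P_comp) \<in> G_split"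
    unfolding G_split_def M_comp_eq by (auto simp: M_IV_def M_V_def M_VI_def P_IV_def P_V_def P_VI_def)
  have "contains_induced G (SG (mat_of_rows_list 6 P_IV))" if "has_pattern K (nb ` I) P_IV"
    by (rule contains_pattern[OF that]) (simp_all add: P_IV_def upt_rec)
  moreover have "contains_induced G (SG (mat_of_rows_list 5 P_V))" if "has_pattern K (nb ` I) P_V"
    by (rule contains_pattern[OF that]) (simp_all add: P_V_def upt_rec)
  moreover have "contains_induced G (SG (mat_of_rows_list 4 P_VI))" if "has_pattern K (nb ` I) P_VI"
    by (rule contains_pattern[OF that]) (simp_all add: P_VI_def upt_rec)
  moreover have "contains_induced G (SG (mat_of_rows_list 5 P_comp))" if "has_pattern K (nb ` I) P_comp"
    by (rule contains_pattern[OF that]) (simp_all add: P_comp_def upt_rec)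
  ultimately show ?thesis
    using assms contains_cycle contains_cycle_full contains_path mem unfolding obst_def by blast
qed

lemma semi_transitive_if_no_obst:
  assumes nonfull: "\<And>x. x \<in> I \<Longrightarrow> \<exists>v\<in>K. (x, v) \<notin> parcs G" and no: "\<not> obst K (nb ` I)"
  shows "semi_transitive G"
proof -
  have "finite (pverts G)" using G by (simp add: pair_graph_def pair_digraph_def pair_fin_digraph_def pair_fin_digraph_axioms_def)
  then have fin: "finite K" "finite I" using IK by (metis finite_Un)+
  have "\<exists>f. circ_good K (nb ` I) f"
    by (rule circ_good_exists[OF fin(1) _ no]) (use fin nonfull in \<open>auto simp: nb_def\<close>)
  then obtain f where "circ_good K (nb ` I) f" by blast
  from circ_good_injective[OF fin(1) this] obtain q where q: "inj_on q K"
    "\<forall>r\<in>nb ` I. \<forall>s\<in>nb ` I. is_arc K q (r \<inter> s)" by blast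
  have "circular_split G I K q"
    by (rule circular_split.intro[OF G IK ind clique nonfull]) (use q in \<open>auto simp: nb_def\<close>)
  from circular_split.D_semi_transitive[OF this] show ?thesis unfolding semi_transitive_def by blast
qed

end

theorem theorem4p4:
  fixes G :: "'a pair_pre_digraph"
  assumes "pair_graph G" and "split_graph G"
  shows "semi_transitive G \<longleftrightarrow> (\<forall>H\<in>G_split. \<not> contains_induced G H)"
proof
  assume st: "semi_transitive G"
  show "\<forall>H\<in>G_split. \<not> contains_induced G H"
  proof (intro ballI notI)
    fix H :: "(nat + nat) pair_pre_digraph" assume H: "H \<in> G_split" "contains_induced G H"
    obtain M where "H = SG M" "\<And>p. \<not> arc_order {..<dim_col M} (mat_rows M) p"
      by (rule G_split_no_arc_order[OF H(1)]) (rule that)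
    then show False using induced_arc_order[OF assms(1) st] H(2) by blast
  qed
next
  assume no: "\<forall>H\<in>G_split. \<not> contains_induced G H"
  interpret pair_graph G by (rule assms(1))
  from assms(2) obtain I K where IK: "I \<union> K = pverts G" "I \<inter> K = {}"
    and indI: "\<forall>u\<in>I. \<forall>v\<in>I. (u, v) \<notin> parcs G" and clK: "\<forall>u\<in>K. \<forall>v\<in>K. u \<noteq> v \<longrightarrow> (u, v) \<in> parcs G"
    unfolding split_graph_def by blast
  show "semi_transitive G"
  proof (cases "\<exists>x\<in>I. \<forall>v\<in>K. (x, v) \<in> parcs G")
    case False
    interpret split_partition G I K
      by (rule split_partition.intro[OF assms(1) IK]) (use indI clK in auto)
    show ?thesis
      by (rule semi_transitive_if_no_obst) (use False no contains_obst in auto)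
  next
    \<comment> \<open>One move suffices: \<open>x\<close> is not adjacent to any remaining
      independent vertex, so as a new clique vertex it witnesses that no other neighbourhood is
      full.\<close>
    case True
    then obtain x where x: "x \<in> I" "\<forall>v\<in>K. (x, v) \<in> parcs G" by blast
    have x': "\<forall>v\<in>K. (v, x) \<in> parcs G" using x arcs_symmetric by blast
    interpret split_partition G "I - {x}" "insert x K"
      by (rule split_partition.intro[OF assms(1)]) (use IK indI clK x x' in auto)
    show ?thesis
      by (rule semi_transitive_if_no_obst) (use x indI no contains_obst in auto)
  qed
qed

end
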